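(* Let $h\ge 2$ be an integer, $q=\exp(i\pi/h)$, and let $\mathcal{H}=\mathcal{F}\otimes\bar{\mathcal{F}}$, the Hopf algebra $\mathcal{U}_q$ acting on $\mathcal{H}$, the subspace $\mathcal{H}_I$ of $\mathcal{U}_q$-invariant vectors, the nilpotent operator $A$, the $h$-differential space $(\mathcal{H}^\bullet,Q)$, the $h$-differential space $(C(\mathcal{U}_q,\mathcal{H}),Q)$ with $Q=d+A$, the inclusion $\mathcal{H}^\bullet\subset C(\mathcal{U}_q,\mathcal{H})$ and the filtration $F^n$ be as defined in the context. Then for $1\le k\le h-1$ the inclusion $\mathcal{H}^\bullet\subset C(\mathcal{U}_q,\mathcal{H})$ induces isomorphisms $$H_{(k)}(\mathcal{H}^\bullet,Q)\simeq F^0H_{(k)}(C(\mathcal{U}_q,\mathcal{H}),Q).$$ In particular, with the obvious identifications (induced by $\mathcal{H}_I\subset\mathcal{H}=C^0(\mathcal{U}_q,\mathcal{H})$), $$F^0H_{(k)}(C(\mathcal{U}_q,\mathcal{H}),Q)=H_{(k)}(\mathcal{H}_I,A)\qquad\text{for all }k\in\{1,\dots,h-1\}.$$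
   Context: Generalized homology. For a vector space $E$ with an endomorphism $\delta$ satisfying $\delta^h=0$, $H_{(k)}(E,\delta)=\ker(\delta^k)/\mathrm{Im}(\delta^{h-k})$, $1\le k\le h-1$. Notation: $[n]=\frac{q^n-q^{-n}}{q-q^{-1}}$; for half-integers $x$, $q^x=\exp(i\pi x/h)$. The space $\mathcal{H}$. $\mathcal{F}$ is the $h^2$-dimensional complex vector space with basis $|p,m\rangle$, $0<p<2h$, $\max(0,p-h)\le m\le\min(p-1,h-1)$; put $|p,m\rangle=0$ for all other $(p,m)$. It is the Fock module with $|p,m\rangle=(a^1_1)^m(a^1_2)^{p-1-m}|1,0\rangle$, $a^2_\alpha|1,0\rangle=0$, of the algebra of zero modes $a^i_\alpha$ ($i,\alpha=1,2$), which act by $$a^1_1|p,m\rangle=|p+1,m+1\rangle,\quad a^1_2|p,m\rangle=q^m|p+1,m\rangle,$$ $$a^2_1|p,m\rangle=q^{1/2}[p-1-m]\,|p-1,m\rangle,\quad a^2_2|p,m\rangle=-q^{m-p+1/2}[m]\,|p-1,m-1\rangle.$$ $\bar{\mathcal{F}}$ is a second copy of $\mathcal{F}$, with operators $\bar a^\alpha_i$ given by the same formulas as $a^i_\alpha$. Operators on $\mathcal{F}$ and on $\bar{\mathcal{F}}$ act on $\mathcal{H}=\mathcal{F}\otimes\bar{\mathcal{F}}$ on the first and second factor respectively (so they commute). $p$ (resp. $\bar p$) denotes the operator with eigenvalue $p$ (resp. $p'$) on $|p,m\rangle\otimes|p',m'\rangle$. The operator $A$: $A=a^2_1\bar a^1_2+a^2_2\bar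 a^2_2$ on $\mathcal{H}$; it satisfies $A^h=0$. The Hopf algebra $\mathcal{U}_q$. Let $\tilde U_q(\mathfrak{sl}_2)$ be the finite-dimensional (reduced) Hopf algebra over $\mathbb{C}$ generated by $\mathsf E,\mathsf F,\mathsf K^{\pm1/2}$ with relations $\mathsf K^{1/2}\mathsf E\mathsf K^{-1/2}=q\mathsf E$, $\mathsf K^{1/2}\mathsf F\mathsf K^{-1/2}=q^{-1}\mathsf F$, $[\mathsf E,\mathsf F]=\frac{\mathsf K-\mathsf K^{-1}}{q-q^{-1}}$, $\mathsf E^h=\mathsf F^h=0$, $(\mathsf K^{1/2})^{4h}=1$, coproduct $\Delta(\mathsf K^{1/2})=\mathsf K^{1/2}\otimes\mathsf K^{1/2}$, $\Delta(\mathsf E)=\mathsf E\otimes 1+\mathsf K\otimes\mathsf E$, $\Delta(\mathsf F)=\mathsf F\otimes\mathsf K^{-1}+1\otimes\mathsf F$, and counit $\varepsilon(\mathsf E)=\varepsilon(\mathsf F)=0$, $\varepsilon(\mathsf K^{1/2})=1$. Set $\mathcal{U}_q=\tilde U_q(\mathfrak{sl}_2)_\Delta\otimes\tilde U_q(\mathfrak{sl}_2)_B$ (tensor product of two copies), with counit $\varepsilon$ and unit $\mathbf 1$. It acts on $\mathcal{H}$ as follows. First factor: $\mathsf K^{\pm1/2}\mapsto q^{\pm(H+\bar H)/2}$, $\mathsf E\mapsto E+q^H\bar E$, $\mathsf F\mapsto Fq^{-\bar H}+\bar F$, where on $\mathcal{F}$: $H|p,m\rangle=(2m-p+1)|p,m\rangle$,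 $E|p,m\rangle=[p-1-m]\,|p,m+1\rangle$, $F|p,m\rangle=[m]\,|p,m-1\rangle$; and on $\bar{\mathcal{F}}$: $\bar H|p,m\rangle=(p-1-2m)|p,m\rangle$, $\bar E|p,m\rangle=-q^{-1}[m]\,|p,m-1\rangle$, $\bar F|p,m\rangle=-q[p-1-m]\,|p,m+1\rangle$. Second factor: $\mathsf K^{\pm1/2}\mapsto q^{\pm(p-\bar p)/2}$, $\mathsf E\mapsto B=a^1_1\bar a^1_2+a^1_2\bar a^2_2$, $\mathsf F\mapsto B'=-(a^2_1\bar a^1_1+a^2_2\bar a^2_1)$. These two actions commute with each other and with $A$. The invariant subspace is $\mathcal{H}_I=\{\Psi\in\mathcal{H}: X\Psi=\varepsilon(X)\Psi\ \ \forall X\in\mathcal{U}_q\}$; one has $A(\mathcal{H}_I)\subset\mathcal{H}_I$, and $H_{(k)}(\mathcal{H}_I,A)$ is computed with the restriction of $A$ to $\mathcal{H}_I$. Hochschild cochains. $C(\mathcal{U}_q,\mathcal{H})=\bigoplus_{n\ge0}C^n(\mathcal{U}_q,\mathcal{H})$, where $C^n(\mathcal{U}_q,\mathcal{H})$ is the space of $n$-linear maps $(\mathcal{U}_q)^n\to\mathcal{H}$ and $C^0=\mathcal{H}$. For $\omega\in C^n$, $$d(\omega)(X_0,\dots,X_n)=X_0\omega(X_1,\dots,X_n)+\sum_{k=1}^nq^{2k}\omega(X_0,\dots,X_{k-1}X_k,\dots,X_n)-q^{2n}\omega(X_0,\dots,X_{n-1})\varepsilon(X_n),$$ which satisfies $d^h=0$.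 $A$ is extended to $C(\mathcal{U}_q,\mathcal{H})$ by $(A\omega)(X_1,\dots,X_n)=q^{2n}A(\omega(X_1,\dots,X_n))$ for $\omega\in C^n$. Then $Q=d+A$ satisfies $Q^h=0$. The space $\mathcal{H}^\bullet$. $\mathcal{H}^\bullet=\bigoplus_{n\ge0}\mathcal{H}^n$ with $\mathcal{H}^0=\mathcal{H}$, $\mathcal{H}^n=\mathcal{H}/\mathcal{H}_I$ for $1\le n\le h-1$, $\mathcal{H}^n=0$ for $n\ge h$; $d$ is the canonical projection $\mathcal{H}\to\mathcal{H}/\mathcal{H}_I$ on $\mathcal{H}^0$, the identity $\mathcal{H}^n\to\mathcal{H}^{n+1}$ for $1\le n\le h-2$, and $0$ on $\mathcal{H}^n$ for $n\ge h-1$. $A$ acts on $\mathcal{H}^0$ as $A$ and on $\mathcal{H}^n$, $1\le n\le h-1$, as $q^{2n}$ times the endomorphism of $\mathcal{H}/\mathcal{H}_I$ induced by $A$; $Q=d+A$, and $Q^h=0$. The inclusion $\mathcal{H}^\bullet\subset C(\mathcal{U}_q,\mathcal{H})$ is the unique degree-$0$ linear map commuting with $d$ that is the identity on $\mathcal{H}^0=\mathcal{H}=C^0(\mathcal{U}_q,\mathcal{H})$; it is injective, with image $\mathcal{H}\oplus d\mathcal{H}\oplus\cdots\oplus d^{h-1}\mathcal{H}$, and commutes with $A$ and $Q$. Filtration. For $n\ge 0$, $F^nH_{(k)}(C(\mathcal{U}_q,\mathcal{H}),Q)$ is the canonical image in $H_{(k)}(C(\mathcal{U}_q,\mathcal{H}),Q)$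 of $\ker(Q^k)\cap\bigoplus_{r=0}^{n}C^r(\mathcal{U}_q,\mathcal{H})$. In particular $F^0H_{(k)}$ is the image of $\ker(Q^k)\cap\mathcal{H}$. *)

theory Defs
  imports Complex_Main "HOL-Library.Poly_Mapping" "HOL-Library.FuncSet"
    "HOL-Algebra.Module" "HOL-Algebra.QuotRing"
begin

text \<open>
  Complex vector spaces and complex algebras are carried by records of type
  \<open>(complex, 'a) module\<close>. For a mere vector space the fields \<open>mult\<close> and \<open>one\<close> are left
  unspecified.
\<close>

section \<open>Linear algebra over carriers\<close>

definition lin_map :: "(complex, 'a) module \<Rightarrow> (complex, 'b) module \<Rightarrow> ('a \<Rightarrow> 'b) \<Rightarrow> bool" where
  "lin_map V W f \<longleftrightarrow> f \<in> carrier V \<rightarrow> carrier W \<and>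
     (\<forall>x\<in>carrier V. \<forall>y\<in>carrier V. f (x \<oplus>\<^bsub>V\<^esub> y) = f x \<oplus>\<^bsub>W\<^esub> f y) \<and>
     (\<forall>c. \<forall>x\<in>carrier V. f (c \<odot>\<^bsub>V\<^esub> x) = c \<odot>\<^bsub>W\<^esub> f x)"

definition lin_iso :: "(complex, 'a) module \<Rightarrow> (complex, 'b) module \<Rightarrow> ('a \<Rightarrow> 'b) \<Rightarrow> bool" where
  "lin_iso V W f \<longleftrightarrow> lin_map V W f \<and> bij_betw f (carrier V) (carrier W)"

text \<open>
  Quotient by a subspace (or by a two-sided ideal): the library's quotient ring together with
  scalar multiplication of cosets. Adding \<open>N\<close> back in \<open>smult\<close> matters for the scalar 0.
\<close>

definition quot :: "(complex, 'a) module \<Rightarrow> 'a set \<Rightarrow> (complex, 'a set) module" where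
  "quot V N = \<lparr>carrier = a_rcosets\<^bsub>V\<^esub> N, mult = rcoset_mult V N, one = N +>\<^bsub>V\<^esub> \<one>\<^bsub>V\<^esub>,
     zero = N, add = set_add V, smult = (\<lambda>c X. N <+>\<^bsub>V\<^esub> (\<lambda>x. c \<odot>\<^bsub>V\<^esub> x) ` X)\<rparr>"

lemma truncate_quot: "ring.truncate (quot V N) = V Quot N"
  by (simp add: quot_def FactRing_def ring.defs)

text \<open>
  The map \<open>x + N' \<mapsto> f x + N\<close> into the quotient of \<open>V\<close> by \<open>N\<close> induced by \<open>f\<close>. Its value on a
  coset is again a single coset of \<open>N\<close> exactly when this is well defined on that coset.
\<close>

definition induced :: "(complex, 'b) module \<Rightarrow> 'b set \<Rightarrow> ('a \<Rightarrow> 'b) \<Rightarrow> 'a set \<Rightarrow> 'b set" where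
  "induced V N f X = N <+>\<^bsub>V\<^esub> f ` X"

section \<open>Generalized homology\<close>

definition ker_pow :: "(complex, 'a) module \<Rightarrow> ('a \<Rightarrow> 'a) \<Rightarrow> nat \<Rightarrow> 'a set" where
  "ker_pow V \<delta> k = {x \<in> carrier V. (\<delta> ^^ k) x = \<zero>\<^bsub>V\<^esub>}"

definition im_pow :: "(complex, 'a) module \<Rightarrow> ('a \<Rightarrow> 'a) \<Rightarrow> nat \<Rightarrow> 'a set" where
  "im_pow V \<delta> k = (\<delta> ^^ k) ` carrier V"

definition homology ::
  "nat \<Rightarrow> nat \<Rightarrow> (complex, 'a) module \<Rightarrow> ('a \<Rightarrow> 'a) \<Rightarrow> (complex, 'a set) module" where
  "homology h k V \<delta> = quot (V\<lparr>carrier := ker_pow V \<delta> k\<rparr>) (im_pow V \<delta> (h - k))"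

definition homology_map ::
  "nat \<Rightarrow> nat \<Rightarrow> (complex, 'b) module \<Rightarrow> ('b \<Rightarrow> 'b) \<Rightarrow> ('a \<Rightarrow> 'b) \<Rightarrow> 'a set \<Rightarrow> 'b set" where
  "homology_map h k W \<delta> f = induced W (im_pow W \<delta> (h - k)) f"

section \<open>Free vector spaces, free algebras, tensor products\<close>

definition scale :: "complex \<Rightarrow> ('b \<Rightarrow>\<^sub>0 complex) \<Rightarrow> ('b \<Rightarrow>\<^sub>0 complex)" where
  "scale c v = Poly_Mapping.map (\<lambda>x. c * x) v"

definition lin_ext :: "('a \<Rightarrow> ('b \<Rightarrow>\<^sub>0 complex)) \<Rightarrow> ('a \<Rightarrow>\<^sub>0 complex) \<Rightarrow> ('b \<Rightarrow>\<^sub>0 complex)" where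
  "lin_ext f v = (\<Sum>b\<in>Poly_Mapping.keys v. scale (Poly_Mapping.lookup v b) (f b))"

definition free_space :: "'b set \<Rightarrow> (complex, 'b \<Rightarrow>\<^sub>0 complex) module" where
  "free_space S = \<lparr>carrier = {v. Poly_Mapping.keys v \<subseteq> S}, mult = undefined, one = undefined,
     zero = 0, add = (+), smult = scale\<rparr>"

definition tens :: "('a \<Rightarrow>\<^sub>0 complex) \<Rightarrow> ('b \<Rightarrow>\<^sub>0 complex) \<Rightarrow> ('a \<times> 'b \<Rightarrow>\<^sub>0 complex)" where
  "tens v w = (\<Sum>a\<in>Poly_Mapping.keys v. \<Sum>b\<in>Poly_Mapping.keys w.
     Poly_Mapping.single (a, b) (Poly_Mapping.lookup v a * Poly_Mapping.lookup w b))"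

definition op_tensor :: "(('a \<Rightarrow>\<^sub>0 complex) \<Rightarrow> ('a \<Rightarrow>\<^sub>0 complex)) \<Rightarrow>
    (('b \<Rightarrow>\<^sub>0 complex) \<Rightarrow> ('b \<Rightarrow>\<^sub>0 complex)) \<Rightarrow> ('a \<times> 'b \<Rightarrow>\<^sub>0 complex) \<Rightarrow> ('a \<times> 'b \<Rightarrow>\<^sub>0 complex)" where
  "op_tensor S T =
     lin_ext (\<lambda>(a, b). tens (S (Poly_Mapping.single a 1)) (T (Poly_Mapping.single b 1)))"

definition monoid_algebra :: "('m, 'z) monoid_scheme \<Rightarrow> (complex, 'm \<Rightarrow>\<^sub>0 complex) module" where
  "monoid_algebra M = \<lparr>carrier = {x. Poly_Mapping.keys x \<subseteq> carrier M},
     mult = (\<lambda>x y. \<Sum>a\<in>Poly_Mapping.keys x. \<Sum>b\<in>Poly_Mapping.keys y.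
       Poly_Mapping.single (a \<otimes>\<^bsub>M\<^esub> b) (Poly_Mapping.lookup x a * Poly_Mapping.lookup y b)),
     one = Poly_Mapping.single \<one>\<^bsub>M\<^esub> 1, zero = 0, add = (+), smult = scale\<rparr>"

definition free_algebra :: "(complex, 'g list \<Rightarrow>\<^sub>0 complex) module" where
  "free_algebra = monoid_algebra \<lparr>carrier = UNIV, mult = (@), one = []\<rparr>"

definition presented_algebra ::
  "('g list \<Rightarrow>\<^sub>0 complex) set \<Rightarrow> (complex, ('g list \<Rightarrow>\<^sub>0 complex) set) module" where
  "presented_algebra R = quot free_algebra (genideal free_algebra R)"

text \<open>
  Tensor product of two algebras: formal linear combinations of pairs, multiplied
  componentwise, modulo bilinearity. The span of the bilinearity relators is already an ideal.
\<close>

definition tensor_relators ::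
  "(complex, 'a) module \<Rightarrow> (complex, 'b) module \<Rightarrow> ('a \<times> 'b \<Rightarrow>\<^sub>0 complex) set" where
  "tensor_relators A B =
     {Poly_Mapping.single (a \<oplus>\<^bsub>A\<^esub> a', b) 1 - Poly_Mapping.single (a, b) 1
        - Poly_Mapping.single (a', b) 1 | a a' b. a \<in> carrier A \<and> a' \<in> carrier A \<and> b \<in> carrier B}
   \<union> {Poly_Mapping.single (a, b \<oplus>\<^bsub>B\<^esub> b') 1 - Poly_Mapping.single (a, b) 1
        - Poly_Mapping.single (a, b') 1 | a b b'. a \<in> carrier A \<and> b \<in> carrier B \<and> b' \<in> carrier B}
   \<union> {Poly_Mapping.single (c \<odot>\<^bsub>A\<^esub> a, b) 1 - Poly_Mapping.single (a, b) c
        | c a b. a \<in> carrier A \<and> b \<in> carrier B}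
   \<union> {Poly_Mapping.single (a, c \<odot>\<^bsub>B\<^esub> b) 1 - Poly_Mapping.single (a, b) c
        | c a b. a \<in> carrier A \<and> b \<in> carrier B}"

definition tensor_algebra ::
  "(complex, 'a) module \<Rightarrow> (complex, 'b) module \<Rightarrow> (complex, ('a \<times> 'b \<Rightarrow>\<^sub>0 complex) set) module" where
  "tensor_algebra A B =
     quot (monoid_algebra (A \<times>\<times> B)) (genideal (monoid_algebra (A \<times>\<times> B)) (tensor_relators A B))"

section \<open>The Fock space of zero modes\<close>

definition qpow :: "nat \<Rightarrow> real \<Rightarrow> complex" where
  "qpow h x = exp (\<i> * of_real (pi * x / real h))"

definition qnum :: "nat \<Rightarrow> int \<Rightarrow> complex" where
  "qnum h n = (qpow h (of_int n) - qpow h (- of_int n)) / (qpow h 1 - qpow h (-1))"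

type_synonym fock = "int \<times> int \<Rightarrow>\<^sub>0 complex"
type_synonym hvec = "(int \<times> int) \<times> (int \<times> int) \<Rightarrow>\<^sub>0 complex"

definition fock_idx :: "nat \<Rightarrow> (int \<times> int) set" where
  "fock_idx h = {(p, m). 0 < p \<and> p < 2 * int h \<and>
     max 0 (p - int h) \<le> m \<and> m \<le> min (p - 1) (int h - 1)}"

definition ket :: "nat \<Rightarrow> int \<Rightarrow> int \<Rightarrow> fock" where
  "ket h p m = (if (p, m) \<in> fock_idx h then Poly_Mapping.single (p, m) 1 else 0)"

text \<open>\<open>zm h i \<alpha>\<close> is \<open>a\<close> with upper index \<open>i\<close> and lower index \<open>\<alpha>\<close>, for \<open>i, \<alpha> \<in> {1, 2}\<close>.\<close>

definition zm :: "nat \<Rightarrow> nat \<Rightarrow> nat \<Rightarrow> fock \<Rightarrow> fock" where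
  "zm h i \<alpha> = lin_ext (\<lambda>(p, m).
     if i = 1 \<and> \<alpha> = 1 then ket h (p + 1) (m + 1)
     else if i = 1 \<and> \<alpha> = 2 then scale (qpow h (of_int m)) (ket h (p + 1) m)
     else if i = 2 \<and> \<alpha> = 1 then scale (qpow h (1/2) * qnum h (p - 1 - m)) (ket h (p - 1) m)
     else if i = 2 \<and> \<alpha> = 2 then
       scale (- qpow h (of_int (m - p) + 1/2) * qnum h m) (ket h (p - 1) (m - 1))
     else 0)"

text \<open>
  On the second copy of the Fock space the upper index is \<open>\<alpha>\<close> and the lower one is \<open>i\<close>.
\<close>

definition zmbar :: "nat \<Rightarrow> nat \<Rightarrow> nat \<Rightarrow> fock \<Rightarrow> fock" where
  "zmbar h \<alpha> i = zm h i \<alpha>"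

definition opE :: "nat \<Rightarrow> fock \<Rightarrow> fock" where
  "opE h = lin_ext (\<lambda>(p, m). scale (qnum h (p - 1 - m)) (ket h p (m + 1)))"

definition opF :: "nat \<Rightarrow> fock \<Rightarrow> fock" where
  "opF h = lin_ext (\<lambda>(p, m). scale (qnum h m) (ket h p (m - 1)))"

definition opEbar :: "nat \<Rightarrow> fock \<Rightarrow> fock" where
  "opEbar h = lin_ext (\<lambda>(p, m). scale (- qpow h (-1) * qnum h m) (ket h p (m - 1)))"

definition opFbar :: "nat \<Rightarrow> fock \<Rightarrow> fock" where
  "opFbar h = lin_ext (\<lambda>(p, m). scale (- qpow h 1 * qnum h (p - 1 - m)) (ket h p (m + 1)))"

text \<open>The operators \<open>q\<^bsup>s H\<^esup>\<close>, \<open>q\<^bsup>s H\<^esup>\<close> for the second copy, and \<open>q\<^bsup>s p\<^esup>\<close>.\<close>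

definition qH :: "nat \<Rightarrow> real \<Rightarrow> fock \<Rightarrow> fock" where
  "qH h s = lin_ext (\<lambda>(p, m). scale (qpow h (s * of_int (2 * m - p + 1))) (ket h p m))"

definition qHbar :: "nat \<Rightarrow> real \<Rightarrow> fock \<Rightarrow> fock" where
  "qHbar h s = lin_ext (\<lambda>(p, m). scale (qpow h (s * of_int (p - 1 - 2 * m))) (ket h p m))"

definition qp :: "nat \<Rightarrow> real \<Rightarrow> fock \<Rightarrow> fock" where
  "qp h s = lin_ext (\<lambda>(p, m). scale (qpow h (s * of_int p)) (ket h p m))"

text \<open>\<open>F \<otimes> F\<close> is realised on the basis of pairs of basis vectors.\<close>

definition Hspace :: "nat \<Rightarrow> (complex, hvec) module" where
  "Hspace h = free_space (fock_idx h \<times> fock_idx h)"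

definition opA :: "nat \<Rightarrow> hvec \<Rightarrow> hvec" where
  "opA h v = op_tensor (zm h 2 1) (zmbar h 1 2) v + op_tensor (zm h 2 2) (zmbar h 2 2) v"

definition opB :: "nat \<Rightarrow> hvec \<Rightarrow> hvec" where
  "opB h v = op_tensor (zm h 1 1) (zmbar h 1 2) v + op_tensor (zm h 1 2) (zmbar h 2 2) v"

definition opB' :: "nat \<Rightarrow> hvec \<Rightarrow> hvec" where
  "opB' h v = - (op_tensor (zm h 2 1) (zmbar h 1 1) v + op_tensor (zm h 2 2) (zmbar h 2 1) v)"

section \<open>The quantum algebra and its action\<close>

text \<open>\<open>Khalf\<close> and \<open>Kinvhalf\<close> are \<open>K\<^bsup>1/2\<^esup>\<close> and \<open>K\<^bsup>-1/2\<^esup>\<close>.\<close>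

datatype gen = GE | GF | Khalf | Kinvhalf

abbreviation word_elem :: "gen list \<Rightarrow> (gen list \<Rightarrow>\<^sub>0 complex)" where
  "word_elem w \<equiv> Poly_Mapping.single w 1"

definition usl2_relations :: "nat \<Rightarrow> (gen list \<Rightarrow>\<^sub>0 complex) set" where
  "usl2_relations h =
    {word_elem [Khalf, Kinvhalf] - word_elem [],
     word_elem [Kinvhalf, Khalf] - word_elem [],
     word_elem [Khalf, GE, Kinvhalf] - scale (qpow h 1) (word_elem [GE]),
     word_elem [Khalf, GF, Kinvhalf] - scale (qpow h (-1)) (word_elem [GF]),
     word_elem [GE, GF] - word_elem [GF, GE]
       - scale (1 / (qpow h 1 - qpow h (-1))) (word_elem [Khalf, Khalf] - word_elem [Kinvhalf, Kinvhalf]),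
     word_elem (replicate h GE),
     word_elem (replicate h GF),
     word_elem (replicate (4 * h) Khalf) - word_elem []}"

type_synonym usl2 = "(gen list \<Rightarrow>\<^sub>0 complex) set"
type_synonym uq = "(usl2 \<times> usl2 \<Rightarrow>\<^sub>0 complex) set"

text \<open>
  Of the Hopf structure, invariants and cochains involve the algebra structure and the counit.
  The coproduct only serves to derive the action on \<open>F \<otimes> F\<close>, which is written out below.
\<close>

definition Usl2 :: "nat \<Rightarrow> (complex, usl2) module" where
  "Usl2 h = presented_algebra (usl2_relations h)"

definition Uq :: "nat \<Rightarrow> (complex, uq) module" where
  "Uq h = tensor_algebra (Usl2 h) (Usl2 h)"

text \<open>
  Functions on the quotient algebras are the common values on representatives (\<open>the_elem\<close>).
\<close>

fun counit_gen :: "gen \<Rightarrow> complex" where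
  "counit_gen GE = 0"
| "counit_gen GF = 0"
| "counit_gen Khalf = 1"
| "counit_gen Kinvhalf = 1"

definition usl2_counit :: "usl2 \<Rightarrow> complex" where
  "usl2_counit X = the_elem
     ((\<lambda>x. \<Sum>w\<in>Poly_Mapping.keys x. Poly_Mapping.lookup x w * prod_list (map counit_gen w)) ` X)"

definition Uq_counit :: "uq \<Rightarrow> complex" where
  "Uq_counit X = the_elem
     ((\<lambda>x. \<Sum>(a, b)\<in>Poly_Mapping.keys x.
         Poly_Mapping.lookup x (a, b) * usl2_counit a * usl2_counit b) ` X)"

text \<open>
  Action of a class of noncommutative polynomials, given operators for the generators: the word
  \<open>[X\<^sub>1, \<dots>, X\<^sub>r]\<close> acts by \<open>v \<mapsto> X\<^sub>1 (\<dots> (X\<^sub>r v))\<close>.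
\<close>

definition usl2_act :: "(gen \<Rightarrow> hvec \<Rightarrow> hvec) \<Rightarrow> usl2 \<Rightarrow> hvec \<Rightarrow> hvec" where
  "usl2_act g X v = the_elem ((\<lambda>x. lin_ext (\<lambda>w. foldr g w v) x) ` X)"

fun gen_Delta :: "nat \<Rightarrow> gen \<Rightarrow> hvec \<Rightarrow> hvec" where
  "gen_Delta h GE v = op_tensor (opE h) id v + op_tensor (qH h 1) (opEbar h) v"
| "gen_Delta h GF v = op_tensor (opF h) (qHbar h (-1)) v + op_tensor id (opFbar h) v"
| "gen_Delta h Khalf v = op_tensor (qH h (1/2)) (qHbar h (1/2)) v"
| "gen_Delta h Kinvhalf v = op_tensor (qH h (-1/2)) (qHbar h (-1/2)) v"

fun gen_B :: "nat \<Rightarrow> gen \<Rightarrow> hvec \<Rightarrow> hvec" where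
  "gen_B h GE v = opB h v"
| "gen_B h GF v = opB' h v"
| "gen_B h Khalf v = op_tensor (qp h (1/2)) (qp h (-1/2)) v"
| "gen_B h Kinvhalf v = op_tensor (qp h (-1/2)) (qp h (1/2)) v"

definition Uq_act :: "nat \<Rightarrow> uq \<Rightarrow> hvec \<Rightarrow> hvec" where
  "Uq_act h X v = the_elem
     ((\<lambda>x. lin_ext (\<lambda>(a, b). usl2_act (gen_Delta h) a (usl2_act (gen_B h) b v)) x) ` X)"

definition H_inv :: "nat \<Rightarrow> hvec set" where
  "H_inv h = {\<Psi> \<in> carrier (Hspace h).
     \<forall>X\<in>carrier (Uq h). Uq_act h X \<Psi> = scale (Uq_counit X) \<Psi>}"

definition HI_space :: "nat \<Rightarrow> (complex, hvec) module" where
  "HI_space h = (Hspace h)\<lparr>carrier := H_inv h\<rparr>"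

section \<open>Hochschild cochains\<close>

text \<open>
  A cochain of degree \<open>n\<close> is a function on argument lists of length \<open>n\<close>, set to 0 elsewhere.
  An element of the direct sum is the sequence of its homogeneous components.
\<close>

type_synonym cochain = "nat \<Rightarrow> uq list \<Rightarrow> hvec"

definition args :: "nat \<Rightarrow> nat \<Rightarrow> uq list set" where
  "args h n = {xs. length xs = n \<and> set xs \<subseteq> carrier (Uq h)}"

definition cochains :: "nat \<Rightarrow> nat \<Rightarrow> (uq list \<Rightarrow> hvec) set" where
  "cochains h n = {f. (\<forall>xs. xs \<notin> args h n \<longrightarrow> f xs = 0) \<and>
     (\<forall>xs\<in>args h n. f xs \<in> carrier (Hspace h)) \<and>
     (\<forall>xs\<in>args h n. \<forall>i<n.
        (\<forall>Y\<in>carrier (Uq h). f (xs[i := xs ! i \<oplus>\<^bsub>Uq h\<^esub> Y]) = f xs + f (xs[i := Y])) \<and>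
        (\<forall>c. f (xs[i := c \<odot>\<^bsub>Uq h\<^esub> xs ! i]) = scale c (f xs)))}"

definition Cspace :: "nat \<Rightarrow> (complex, cochain) module" where
  "Cspace h = \<lparr>carrier = {\<omega>. (\<forall>n. \<omega> n \<in> cochains h n) \<and> finite {n. \<omega> n \<noteq> (\<lambda>_. 0)}},
     mult = undefined, one = undefined,
     zero = (\<lambda>_ _. 0), add = (\<lambda>\<omega> \<eta> n xs. \<omega> n xs + \<eta> n xs), smult = (\<lambda>c \<omega> n xs. scale c (\<omega> n xs))\<rparr>"

definition C_deg :: "nat \<Rightarrow> nat \<Rightarrow> cochain set" where
  "C_deg h n = {\<omega> \<in> carrier (Cspace h). \<forall>m. m \<noteq> n \<longrightarrow> \<omega> m = (\<lambda>_. 0)}"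

definition C_upto :: "nat \<Rightarrow> nat \<Rightarrow> cochain set" where
  "C_upto h n = {\<omega> \<in> carrier (Cspace h). \<forall>m. m > n \<longrightarrow> \<omega> m = (\<lambda>_. 0)}"

text \<open>\<open>C\<^sup>0 = H\<close>: a vector is the function of the empty argument list with that value.\<close>

definition C_zero :: "hvec \<Rightarrow> cochain" where
  "C_zero v = (\<lambda>n xs. if n = 0 \<and> xs = [] then v else 0)"

text \<open>\<open>[X\<^sub>0, \<dots>, X\<^bsub>k-1\<^esub> X\<^sub>k, \<dots>, X\<^sub>n]\<close> for \<open>1 \<le> k \<le> n\<close>.\<close>

definition merge :: "nat \<Rightarrow> nat \<Rightarrow> uq list \<Rightarrow> uq list" where
  "merge h k xs = take (k - 1) xs @ [xs ! (k - 1) \<otimes>\<^bsub>Uq h\<^esub> xs ! k] @ drop (k + 1) xs"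

definition cochain_d :: "nat \<Rightarrow> nat \<Rightarrow> (uq list \<Rightarrow> hvec) \<Rightarrow> uq list \<Rightarrow> hvec" where
  "cochain_d h n f xs = (if xs \<in> args h (Suc n)
     then Uq_act h (hd xs) (f (tl xs))
        + (\<Sum>k = 1..n. scale (qpow h 1 ^ (2 * k)) (f (merge h k xs)))
        - scale (qpow h 1 ^ (2 * n) * Uq_counit (last xs)) (f (butlast xs))
     else 0)"

definition C_d :: "nat \<Rightarrow> cochain \<Rightarrow> cochain" where
  "C_d h \<omega> n = (case n of 0 \<Rightarrow> (\<lambda>_. 0) | Suc m \<Rightarrow> cochain_d h m (\<omega> m))"

definition C_A :: "nat \<Rightarrow> cochain \<Rightarrow> cochain" where
  "C_A h \<omega> n xs = scale (qpow h 1 ^ (2 * n)) (opA h (\<omega> n xs))"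

definition C_Q :: "nat \<Rightarrow> cochain \<Rightarrow> cochain" where
  "C_Q h \<omega> = C_d h \<omega> \<oplus>\<^bsub>Cspace h\<^esub> C_A h \<omega>"

definition F_homology :: "nat \<Rightarrow> nat \<Rightarrow> nat \<Rightarrow> (complex, cochain set) module" where
  "F_homology h n k = (homology h k (Cspace h) (C_Q h))
     \<lparr>carrier := (\<lambda>\<omega>. im_pow (Cspace h) (C_Q h) (h - k) +>\<^bsub>Cspace h\<^esub> \<omega>)
        ` (ker_pow (Cspace h) (C_Q h) k \<inter> C_upto h n)\<rparr>"

section \<open>The small graded space\<close>

text \<open>
  An element is a pair of its component in degree 0, a vector of \<open>H\<close>, and the sequence of its
  components in degrees \<open>1, \<dots>, h - 1\<close>, cosets of the invariant subspace. The sequence has the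
  dummy value zero at all other indices.
\<close>

type_synonym bul = "hvec \<times> (nat \<Rightarrow> hvec set)"

definition Hquot :: "nat \<Rightarrow> (complex, hvec set) module" where
  "Hquot h = quot (Hspace h) (H_inv h)"

definition Bspace :: "nat \<Rightarrow> (complex, bul) module" where
  "Bspace h = \<lparr>carrier = {(v, u). v \<in> carrier (Hspace h) \<and>
       (\<forall>n. if 1 \<le> n \<and> n \<le> h - 1 then u n \<in> carrier (Hquot h) else u n = \<zero>\<^bsub>Hquot h\<^esub>)},
     mult = undefined, one = undefined, zero = (0, \<lambda>_. \<zero>\<^bsub>Hquot h\<^esub>),
     add = (\<lambda>(v, u) (v', u'). (v + v', \<lambda>n. u n \<oplus>\<^bsub>Hquot h\<^esub> u' n)),
     smult = (\<lambda>c (v, u). (scale c v, \<lambda>n. c \<odot>\<^bsub>Hquot h\<^esub> u n))\<rparr>"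

definition B_deg :: "nat \<Rightarrow> nat \<Rightarrow> bul set" where
  "B_deg h n = {(v, u) \<in> carrier (Bspace h). (n \<noteq> 0 \<longrightarrow> v = 0) \<and>
     (\<forall>m\<ge>1. m \<noteq> n \<longrightarrow> u m = \<zero>\<^bsub>Hquot h\<^esub>)}"

definition B_zero :: "nat \<Rightarrow> hvec \<Rightarrow> bul" where
  "B_zero h v = (v, \<lambda>_. \<zero>\<^bsub>Hquot h\<^esub>)"

definition B_d :: "nat \<Rightarrow> bul \<Rightarrow> bul" where
  "B_d h = (\<lambda>(v, u). (0, \<lambda>n.
     if n = 1 then H_inv h +>\<^bsub>Hspace h\<^esub> v
     else if 2 \<le> n \<and> n \<le> h - 1 then u (n - 1)
     else \<zero>\<^bsub>Hquot h\<^esub>))"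

definition B_A :: "nat \<Rightarrow> bul \<Rightarrow> bul" where
  "B_A h = (\<lambda>(v, u). (opA h v, \<lambda>n.
     if 1 \<le> n \<and> n \<le> h - 1
     then qpow h 1 ^ (2 * n) \<odot>\<^bsub>Hquot h\<^esub> induced (Hspace h) (H_inv h) (opA h) (u n)
     else \<zero>\<^bsub>Hquot h\<^esub>))"

definition B_Q :: "nat \<Rightarrow> bul \<Rightarrow> bul" where
  "B_Q h x = B_d h x \<oplus>\<^bsub>Bspace h\<^esub> B_A h x"

text \<open>
  The unique degree-0 linear map that commutes with \<open>d\<close> and is the identity on \<open>H\<close>;
  \<open>extensional\<close> fixes its junk values outside the carrier.
\<close>

definition inclusion :: "nat \<Rightarrow> bul \<Rightarrow> cochain" where
  "inclusion h = (THE \<iota>. \<iota> \<in> extensional (carrier (Bspace h)) \<and>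
     lin_map (Bspace h) (Cspace h) \<iota> \<and>
     (\<forall>n. \<iota> ` B_deg h n \<subseteq> C_deg h n) \<and>
     (\<forall>x\<in>carrier (Bspace h). \<iota> (B_d h x) = C_d h (\<iota> x)) \<and>
     (\<forall>v\<in>carrier (Hspace h). \<iota> (B_zero h v) = C_zero v))"

end

theory Submission
  imports Defs "HOL-Library.Function_Algebras"
begin

text \<open>
  The differential of a vector \<open>v\<close> of degree 0 can be iterated explicitly:
  \<open>d\<^sup>n v (X\<^sub>1, \<dots>, X\<^sub>n) = [n]! X\<^sub>1 \<cdots> X\<^bsub>n-1\<^esub> (X\<^sub>n - \<epsilon>(X\<^sub>n)) v\<close>, where \<open>[n]!\<close> is the product of the
  \<open>q\<^sup>2\<close>-integers \<open>1 + q\<^sup>2 + \<dots> + q\<^bsup>2(i-1)\<^esup>\<close>, \<open>i \<le> n\<close> (\<open>cochain_d_dcochain\<close>). As \<open>q\<^sup>2\<close> is a primitive root of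
  unity of order \<open>h\<close>, the factor vanishes exactly for \<open>n \<ge> h\<close>. Hence \<open>d\<^sup>n v = 0\<close> for \<open>0 < n < h\<close> holds
  exactly for invariant \<open>v\<close>, which is why the small complex embeds in the cochains
  (\<open>inclusion_eq\<close>). For a vector \<open>v\<close> of degree 0 the component of \<open>Q\<^sup>k v\<close> in degree \<open>k\<close> is \<open>d\<^sup>k v\<close>, and the
  one in degree 0 is \<open>A\<^sup>k v\<close>; so \<open>Q\<^sup>k v = 0\<close> means that \<open>v\<close> is invariant and \<open>A\<^sup>k v = 0\<close>
  (\<open>kernel_in_degree_0\<close>).

  The heart of the matter are the boundaries: an invariant vector that is \<open>Q\<^bsup>h-k\<^esup> \<omega>\<close> for some cochain \<open>\<omega>\<close>,
  however complicated, is already \<open>A\<^bsup>h-k\<^esup>\<close> of an invariant vector (\<open>boundary_in_degree_0\<close>). The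
  invariants have a basis \<open>\<Psi>\<^sub>0, \<dots>, \<Psi>\<^bsub>2h-2\<^esub>\<close> with \<open>A \<Psi>\<^bsub>j+1\<^esub> = [j+2] \<Psi>\<^sub>j\<close>; since \<open>[h] = 0\<close>, they form two Jordan
  chains, \<open>\<Psi>\<^sub>0, \<dots>, \<Psi>\<^bsub>h-2\<^esub>\<close> and \<open>\<Psi>\<^bsub>h-1\<^esub>, \<dots>, \<Psi>\<^bsub>2h-2\<^esub>\<close>, of lengths \<open>h - 1\<close> and \<open>h\<close>. The only vector of these bases
  that is killed by \<open>A\<^sup>k\<close> without being \<open>A\<^bsup>h-k\<^esup>\<close> of an invariant is \<open>\<Psi>\<^bsub>k-1\<^esub>\<close>, so one has to see that its
  coefficient in \<open>v\<close> is 0. The component of \<open>Q\<^bsup>h-k\<^esup> \<omega>\<close> in degree \<open>h - k\<close> vanishes, and it differs from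
  \<open>d\<^bsup>h-k\<^esup> \<omega>\<^sub>0\<close> by a cochain with values in the image of \<open>A\<close>. Its value at \<open>(1, \<dots>, 1, E)\<close> shows that
  \<open>E \<omega>\<^sub>0 = A \<eta>\<close> for some \<open>\<eta>\<close>. On the other hand there are linear functionals \<open>g\<^sub>j\<close> with \<open>g\<^sub>j F = 0\<close> and
  \<open>g\<^sub>j A = q [j+1] g\<^bsub>j+1\<^esub>\<close>, where \<open>g\<^bsub>k-1\<^esub>\<close> reads off the coefficient of \<open>\<Psi>\<^bsub>k-1\<^esub>\<close>; hence that coefficient is a
  multiple of \<open>g\<^bsub>h-1\<^esub>(\<omega>\<^sub>0)\<close>. A functional \<open>l\<close> with \<open>l A = g\<^sub>h\<close>, which cannot be invariant because \<open>[h] = 0\<close>,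
  satisfies \<open>l F E = q\<^bsup>-1\<^esup> g\<^bsub>h-1\<^esub>\<close>. So
  \<open>g\<^bsub>h-1\<^esub>(\<omega>\<^sub>0) = q l(F E \<omega>\<^sub>0) = q l(F A \<eta>) = q l(A F \<eta>) = q g\<^sub>h(F \<eta>) = 0\<close> (\<open>invariant_in_image\<close>).

  In the small complex an element is represented by the sequence of its components \<open>s\<^sub>n\<close>, standing
  for \<open>\<Sum>\<^sub>n d\<^sup>n s\<^sub>n\<close>, and \<open>Q\<close> is the shift plus \<open>A\<close> twisted by \<open>q\<^bsup>2n\<^esup>\<close>. These two operators \<open>q\<^sup>2\<close>-commute, and the
  \<open>q\<close>-binomial theorem at a root of unity gives \<open>Q\<^sup>h = 0\<close>. Solving for the components from the top
  degree downwards writes every element as \<open>Q y\<close> plus a vector of degree 0; repeating this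
  inside \<open>y\<close> shows that every class of \<open>H\<^bsub>(k)\<^esub>\<close> is represented by an invariant vector of degree 0
  (\<open>seqQ_class\<close>). Both isomorphisms follow from this, the description of the cycles and that of the
  boundaries.

  All this presupposes that the algebra given by generators and relations acts at all, that is,
  that the operators on the Fock spaces satisfy the relations. This is checked on basis vectors.
  The nilpotency of \<open>E\<close>, \<open>F\<close>, \<open>B\<close>, \<open>B'\<close> and \<open>A\<close> comes again from the \<open>q\<close>-binomial theorem, because each of them
  is a sum of two \<open>q\<^sup>2\<close>-commuting weighted shifts.
\<close>

section \<open>Finite linear combinations\<close>

lemma lookup_scale [simp]: "Poly_Mapping.lookup (scale c v) k = c * Poly_Mapping.lookup v k"
  by (simp add: scale_def Poly_Mapping.map.rep_eq when_def)

interpretation hv: vector_space scale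
  by unfold_locales (auto intro!: poly_mapping_eqI simp: lookup_add algebra_simps)

lemma scale_single: "scale c (Poly_Mapping.single k d) = Poly_Mapping.single k (c * d)"
  by (rule poly_mapping_eqI) (auto simp: lookup_single when_def)

lemma keys_scale: "Poly_Mapping.keys (scale c v) \<subseteq> Poly_Mapping.keys v"
  by (auto simp: in_keys_iff)

definition lin_comb :: "(complex \<Rightarrow> 'v \<Rightarrow> 'v) \<Rightarrow> ('a \<Rightarrow> 'v) \<Rightarrow> ('a \<Rightarrow>\<^sub>0 complex) \<Rightarrow> 'v::ab_group_add" where
  "lin_comb sc f x = (\<Sum>a\<in>Poly_Mapping.keys x. sc (Poly_Mapping.lookup x a) (f a))"

lemma lin_ext_eq: "lin_ext f = lin_comb scale f"
  by (simp add: fun_eq_iff lin_ext_def lin_comb_def)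

lemma lin_comb_cong:
  assumes "\<And>a. a \<in> Poly_Mapping.keys x \<Longrightarrow> f a = g a"
  shows "lin_comb sc f x = lin_comb sc g x"
  using assms by (simp add: lin_comb_def)

locale cvector_space = vector_space sc for sc :: "complex \<Rightarrow> 'v::ab_group_add \<Rightarrow> 'v"
begin

lemma lin_comb_superset':
  assumes "finite A" "Poly_Mapping.keys x \<subseteq> A"
  shows "lin_comb sc f x = (\<Sum>a\<in>A. sc (Poly_Mapping.lookup x a) (f a))"
  unfolding lin_comb_def using assms
  by (intro sum.mono_neutral_left) (auto simp: in_keys_iff)

lemma lin_comb_add: "lin_comb sc f (x + y) = lin_comb sc f x + lin_comb sc f y"
proof -
  let ?A = "Poly_Mapping.keys x \<union> Poly_Mapping.keys y"
  have *: "finite ?A" by simp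
  have "Poly_Mapping.keys (x + y) \<subseteq> ?A" by (rule keys_add)
  then show ?thesis
    by (simp add: lin_comb_superset'[OF *] lookup_add scale_left_distrib sum.distrib)
qed

lemma lin_comb_scale: "lin_comb sc f (scale c x) = sc c (lin_comb sc f x)"
proof -
  have "lin_comb sc f (scale c x)
      = (\<Sum>a\<in>Poly_Mapping.keys x. sc (Poly_Mapping.lookup (scale c x) a) (f a))"
    by (rule lin_comb_superset') (simp_all add: keys_scale)
  then show ?thesis by (simp add: lin_comb_def scale_sum_right)
qed

lemma lin_comb_zero [simp]: "lin_comb sc f 0 = 0"
  by (simp add: lin_comb_def)

lemma lin_comb_single [simp]: "lin_comb sc f (Poly_Mapping.single a c) = sc c (f a)"
  by (cases "c = 0") (simp_all add: lin_comb_def)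

lemma lin_comb_minus: "lin_comb sc f (- x) = - lin_comb sc f x"
  using lin_comb_add[of f x "- x"] by (simp add: eq_neg_iff_add_eq_0 add.commute)

lemma lin_comb_diff: "lin_comb sc f (x - y) = lin_comb sc f x - lin_comb sc f y"
  using lin_comb_add[of f x "- y"] by (simp add: lin_comb_minus)

lemma lin_comb_sum: "lin_comb sc f (sum g A) = (\<Sum>a\<in>A. lin_comb sc f (g a))"
  by (induction A rule: infinite_finite_induct) (simp_all add: lin_comb_add)

lemma lin_comb_fun_add: "lin_comb sc (\<lambda>a. f a + g a) x = lin_comb sc f x + lin_comb sc g x"
  by (simp add: lin_comb_def scale_right_distrib sum.distrib)

lemma lin_comb_fun_scale: "lin_comb sc (\<lambda>a. sc c (f a)) x = sc c (lin_comb sc f x)"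
  by (simp add: lin_comb_def scale_sum_right mult.commute)

lemma lin_comb_lin_comb:
  "lin_comb sc f (lin_comb Defs.scale g x) = lin_comb sc (\<lambda>a. lin_comb sc f (g a)) x"
  by (simp add: lin_comb_def[of Defs.scale] lin_comb_sum lin_comb_scale)
     (simp add: lin_comb_def)

lemma lin_comb_in_subspace:
  assumes "0 \<in> S" "\<And>u v. u \<in> S \<Longrightarrow> v \<in> S \<Longrightarrow> u + v \<in> S" "\<And>c u. u \<in> S \<Longrightarrow> sc c u \<in> S"
    and "\<And>a. a \<in> Poly_Mapping.keys x \<Longrightarrow> f a \<in> S"
  shows "lin_comb sc f x \<in> S"
proof -
  have "(\<Sum>a\<in>A. sc (Poly_Mapping.lookup x a) (f a)) \<in> S"
    if "finite A" "A \<subseteq> Poly_Mapping.keys x" for A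
    using that by (induction A) (auto intro!: assms)
  then show ?thesis by (simp add: lin_comb_def)
qed

end

interpretation hvs: cvector_space scale
  by (simp add: cvector_space_def hv.vector_space_axioms)

section \<open>Algebras of monoids\<close>

lemma monoid_algebra_simps [simp]:
  "carrier (monoid_algebra M) = {x. Poly_Mapping.keys x \<subseteq> carrier M}"
  "zero (monoid_algebra M) = 0"
  "one (monoid_algebra M) = Poly_Mapping.single \<one>\<^bsub>M\<^esub> 1"
  "add (monoid_algebra M) = (+)"
  "smult (monoid_algebra M) = scale"
  by (simp_all add: monoid_algebra_def)

lemma mult_monoid_algebra:
  "x \<otimes>\<^bsub>monoid_algebra M\<^esub> y =
     lin_comb scale (\<lambda>a. lin_comb scale (\<lambda>b. Poly_Mapping.single (a \<otimes>\<^bsub>M\<^esub> b) 1) y) x"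
  by (simp add: monoid_algebra_def lin_comb_def scale_single hv.scale_sum_right)

lemma keys_lin_comb:
  assumes "\<And>a. a \<in> Poly_Mapping.keys x \<Longrightarrow> Poly_Mapping.keys (f a) \<subseteq> B"
  shows "Poly_Mapping.keys (lin_comb scale f x) \<subseteq> B"
proof -
  have "lin_comb scale f x \<in> {v. Poly_Mapping.keys v \<subseteq> B}"
  proof (rule hvs.lin_comb_in_subspace)
    fix u v :: "'b \<Rightarrow>\<^sub>0 complex" and c
    show "0 \<in> {v :: 'b \<Rightarrow>\<^sub>0 complex. Poly_Mapping.keys v \<subseteq> B}" by simp
    assume u: "u \<in> {v. Poly_Mapping.keys v \<subseteq> B}"
    show "scale c u \<in> {v. Poly_Mapping.keys v \<subseteq> B}"
      using u subset_trans[OF keys_scale[of c u]] by simp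
    assume "v \<in> {v. Poly_Mapping.keys v \<subseteq> B}"
    with u show "u + v \<in> {v. Poly_Mapping.keys v \<subseteq> B}"
      using subset_trans[OF keys_add[of u v]] by simp
  qed (use assms in simp)
  then show ?thesis by simp
qed

text \<open>A linear extension of \<open>f\<close> to the monoid algebra is multiplicative as soon as
  \<open>f\<close> is; this is the form in which that is used.\<close>

lemma (in cvector_space) lin_comb_mult:
  "lin_comb sc f (x \<otimes>\<^bsub>monoid_algebra M\<^esub> y) =
     lin_comb sc (\<lambda>a. lin_comb sc (\<lambda>b. f (a \<otimes>\<^bsub>M\<^esub> b)) y) x"
  by (simp add: mult_monoid_algebra lin_comb_lin_comb)

lemma lin_comb_id: "lin_comb scale (\<lambda>a. Poly_Mapping.single a 1) x = x"
  by (rule poly_mapping_eqI)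
     (auto simp: lin_comb_def lookup_sum lookup_single when_def in_keys_iff
       sum.delta' if_distrib cong: if_cong)

text \<open>Multiplication is a double linear combination, so associativity reduces to that of the monoid.\<close>

lemma monoid_algebra_ring:
  assumes "monoid M"
  shows "ring (monoid_algebra M)"
proof -
  interpret monoid M by fact
  let ?R = "monoid_algebra M"
  have closed: "x \<otimes>\<^bsub>?R\<^esub> y \<in> carrier ?R" if "x \<in> carrier ?R" "y \<in> carrier ?R" for x y
  proof -
    have "Poly_Mapping.keys (x \<otimes>\<^bsub>?R\<^esub> y) \<subseteq> carrier M"
      unfolding mult_monoid_algebra using that
      by (intro keys_lin_comb) (simp add: subset_iff)
    then show ?thesis by simp
  qed
  show ?thesis
  proof (rule ringI)
    show "abelian_group ?R"
    proof (rule abelian_groupI)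
      fix x y assume "x \<in> carrier ?R" "y \<in> carrier ?R"
      then show "x \<oplus>\<^bsub>?R\<^esub> y \<in> carrier ?R"
        using subset_trans[OF keys_add[of x y]] by simp
    next
      fix x assume "x \<in> carrier ?R"
      then show "\<exists>y\<in>carrier ?R. y \<oplus>\<^bsub>?R\<^esub> x = \<zero>\<^bsub>?R\<^esub>"
        by (intro bexI[of _ "- x"]) auto
    qed (auto simp: algebra_simps)
    show "Group.monoid ?R"
    proof (rule monoidI)
      fix x y z assume xyz: "x \<in> carrier ?R" "y \<in> carrier ?R" "z \<in> carrier ?R"
      show "x \<otimes>\<^bsub>?R\<^esub> y \<otimes>\<^bsub>?R\<^esub> z = x \<otimes>\<^bsub>?R\<^esub> (y \<otimes>\<^bsub>?R\<^esub> z)"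
        unfolding mult_monoid_algebra hvs.lin_comb_lin_comb hvs.lin_comb_single hv.scale_one
        using xyz by (intro lin_comb_cong) (simp add: m_assoc subset_iff)
    next
      fix x assume x: "x \<in> carrier ?R"
      have "lin_comb scale (\<lambda>b. Poly_Mapping.single (\<one>\<^bsub>M\<^esub> \<otimes>\<^bsub>M\<^esub> b) 1) x
          = lin_comb scale (\<lambda>b. Poly_Mapping.single b 1) x"
        using x by (intro lin_comb_cong) (simp add: subset_iff)
      then show "\<one>\<^bsub>?R\<^esub> \<otimes>\<^bsub>?R\<^esub> x = x"
        by (simp add: mult_monoid_algebra lin_comb_id)
      have "lin_comb scale (\<lambda>b. Poly_Mapping.single (b \<otimes>\<^bsub>M\<^esub> \<one>\<^bsub>M\<^esub>) 1) x
          = lin_comb scale (\<lambda>b. Poly_Mapping.single b 1) x"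
        using x by (intro lin_comb_cong) (simp add: subset_iff)
      then show "x \<otimes>\<^bsub>?R\<^esub> \<one>\<^bsub>?R\<^esub> = x"
        by (simp add: mult_monoid_algebra lin_comb_id)
    qed (use closed in auto)
  qed (simp_all add: mult_monoid_algebra hvs.lin_comb_add hvs.lin_comb_fun_add)
qed

lemma scale_eq_mult:
  assumes "Group.monoid M" "x \<in> carrier (monoid_algebra M)"
  shows "scale c x = Poly_Mapping.single \<one>\<^bsub>M\<^esub> c \<otimes>\<^bsub>monoid_algebra M\<^esub> x"
proof -
  interpret monoid M by fact
  have "lin_comb scale (\<lambda>b. Poly_Mapping.single (\<one>\<^bsub>M\<^esub> \<otimes>\<^bsub>M\<^esub> b) 1) x
      = lin_comb scale (\<lambda>b. Poly_Mapping.single b 1) x"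
    using assms by (intro lin_comb_cong) (simp add: subset_iff)
  then show ?thesis
    by (simp add: mult_monoid_algebra lin_comb_id)
qed

lemma quot_simps [simp]:
  "carrier (quot V N) = a_rcosets\<^bsub>V\<^esub> N" "zero (quot V N) = N" "one (quot V N) = N +>\<^bsub>V\<^esub> \<one>\<^bsub>V\<^esub>"
  "add (quot V N) = set_add V" "mult (quot V N) = rcoset_mult V N"
  "smult (quot V N) = (\<lambda>c X. N <+>\<^bsub>V\<^esub> (\<lambda>x. c \<odot>\<^bsub>V\<^esub> x) ` X)"
  by (simp_all add: quot_def)

text \<open>Quotient rings are defined on the truncated record, while scalar multiplication lives in the
  extended one.\<close>

lemma ring_of_truncate:
  assumes "ring (ring.truncate R)"
  shows "ring R"
proof -
  interpret T: ring "ring.truncate R" by fact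
  have [simp]: "carrier (ring.truncate R) = carrier R" "add (ring.truncate R) = add R"
    "mult (ring.truncate R) = mult R" "zero (ring.truncate R) = zero R" "one (ring.truncate R) = one R"
    by (simp_all add: ring.truncate_def)
  show ?thesis
  proof (rule ringI)
    show "abelian_group R"
    proof (rule abelian_groupI)
      fix x assume "x \<in> carrier R"
      then show "\<exists>y\<in>carrier R. y \<oplus>\<^bsub>R\<^esub> x = \<zero>\<^bsub>R\<^esub>"
        using T.add.l_inv_ex[of x] by simp
    qed (use T.a_closed T.zero_closed T.a_assoc T.a_comm T.l_zero in simp_all)
    show "Group.monoid R"
      by (rule monoidI) (use T.m_closed T.one_closed T.m_assoc T.l_one T.r_one in simp_all)
  qed (use T.l_distr T.r_distr in simp_all)
qed

lemma quot_ring: "ideal I R \<Longrightarrow> ring (quot R I)"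
  by (rule ring_of_truncate) (simp add: truncate_quot ideal.quotient_is_ring)

text \<open>Ideals of a monoid algebra are subspaces, so cosets are scaled like their representatives.\<close>

lemma coset_scale:
  assumes M: "Group.monoid M" and I: "ideal I (monoid_algebra M)" and x: "x \<in> carrier (monoid_algebra M)"
  shows "c \<odot>\<^bsub>quot (monoid_algebra M) I\<^esub> (I +>\<^bsub>monoid_algebra M\<^esub> x) = I +>\<^bsub>monoid_algebra M\<^esub> scale c x"
proof -
  interpret ideal I "monoid_algebra M" by fact
  have sc: "scale d i \<in> I" if "i \<in> I" for i d
  proof -
    have "Poly_Mapping.single \<one>\<^bsub>M\<^esub> d \<in> carrier (monoid_algebra M)"
      using monoid.one_closed[OF M] by simp
    from I_l_closed[OF that this] show ?thesis
      using scale_eq_mult[OF M, of i d] Icarr[OF that] by simp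
  qed
  have plus: "i + j \<in> I" if "i \<in> I" "j \<in> I" for i j
    using additive_subgroup.a_closed[OF is_additive_subgroup that] by simp
  have z: "0 \<in> I" using additive_subgroup.zero_closed[OF is_additive_subgroup] by simp
  show ?thesis
  proof (rule Set.set_eqI)
    fix y
    show "y \<in> c \<odot>\<^bsub>quot (monoid_algebra M) I\<^esub> (I +>\<^bsub>monoid_algebra M\<^esub> x)
        \<longleftrightarrow> y \<in> I +>\<^bsub>monoid_algebra M\<^esub> scale c x"
    proof
      assume "y \<in> c \<odot>\<^bsub>quot (monoid_algebra M) I\<^esub> (I +>\<^bsub>monoid_algebra M\<^esub> x)"
      then obtain i j where "i \<in> I" "j \<in> I" "y = i + scale c (j + x)"
        by (auto simp: set_add_def' a_r_coset_def')
      then have "i + scale c j \<in> I" "y = (i + scale c j) + scale c x"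
        by (auto intro: plus sc simp: hv.scale_right_distrib add.assoc)
      then show "y \<in> I +>\<^bsub>monoid_algebra M\<^esub> scale c x"
        by (auto simp: a_r_coset_def')
    next
      assume "y \<in> I +>\<^bsub>monoid_algebra M\<^esub> scale c x"
      then obtain i where "i \<in> I" "y = i + scale c (0 + x)"
        by (auto simp: a_r_coset_def')
      then show "y \<in> c \<odot>\<^bsub>quot (monoid_algebra M) I\<^esub> (I +>\<^bsub>monoid_algebra M\<^esub> x)"
      proof -
        have "x \<in> I +>\<^bsub>monoid_algebra M\<^esub> x"
          using z by (force simp: a_r_coset_def')
        then show ?thesis
          using \<open>i \<in> I\<close> \<open>y = i + scale c (0 + x)\<close> by (simp add: set_add_def') blast
      qed
    qed
  qed
qed

section \<open>Modules over an algebra given by generators and relations\<close>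

definition lin_end :: "(complex \<Rightarrow> 'v \<Rightarrow> 'v) \<Rightarrow> 'v set \<Rightarrow> ('v \<Rightarrow> 'v::ab_group_add) \<Rightarrow> bool" where
  "lin_end sc S T \<longleftrightarrow> (\<forall>v\<in>S. T v \<in> S) \<and> (\<forall>u\<in>S. \<forall>v\<in>S. T (u + v) = T u + T v) \<and>
     (\<forall>c. \<forall>v\<in>S. T (sc c v) = sc c (T v))"

lemma lin_endI:
  assumes "\<And>v. v \<in> S \<Longrightarrow> T v \<in> S" "\<And>u v. u \<in> S \<Longrightarrow> v \<in> S \<Longrightarrow> T (u + v) = T u + T v"
    "\<And>c v. v \<in> S \<Longrightarrow> T (sc c v) = sc c (T v)"
  shows "lin_end sc S T"
  using assms by (simp add: lin_end_def)

lemma lin_endD: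
  assumes "lin_end sc S T" "v \<in> S"
  shows "T v \<in> S" "u \<in> S \<Longrightarrow> T (u + v) = T u + T v" "T (sc c v) = sc c (T v)"
  using assms by (auto simp: lin_end_def)

definition class_act ::
  "(complex \<Rightarrow> 'v \<Rightarrow> 'v) \<Rightarrow> ('m \<Rightarrow> 'v \<Rightarrow> 'v) \<Rightarrow> ('m \<Rightarrow>\<^sub>0 complex) set \<Rightarrow> 'v \<Rightarrow> 'v::ab_group_add" where
  "class_act sc \<rho> X v = the_elem ((\<lambda>x. lin_comb sc (\<lambda>a. \<rho> a v) x) ` X)"

locale subspace_of = cvector_space sc for sc :: "complex \<Rightarrow> 'v::ab_group_add \<Rightarrow> 'v" +
  fixes S :: "'v set"
  assumes S_zero: "0 \<in> S"
    and S_add: "u \<in> S \<Longrightarrow> v \<in> S \<Longrightarrow> u + v \<in> S"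
    and S_scale: "v \<in> S \<Longrightarrow> sc c v \<in> S"
begin

lemma lin_comb_closed:
  "(\<And>a. a \<in> Poly_Mapping.keys x \<Longrightarrow> f a \<in> S) \<Longrightarrow> lin_comb sc f x \<in> S"
  by (rule lin_comb_in_subspace) (auto intro: S_zero S_add S_scale)

lemma linear_lin_comb:
  fixes sc' :: "complex \<Rightarrow> 'w::ab_group_add \<Rightarrow> 'w"
  assumes V: "vector_space sc'"
    and T: "\<And>u v. u \<in> S \<Longrightarrow> v \<in> S \<Longrightarrow> T (u + v) = T u + T v"
      "\<And>c v. v \<in> S \<Longrightarrow> T (sc c v) = sc' c (T v)"
    and f: "\<And>a. a \<in> Poly_Mapping.keys x \<Longrightarrow> f a \<in> S"
  shows "T (lin_comb sc f x) = lin_comb sc' (\<lambda>a. T (f a)) x"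
proof -
  interpret V: vector_space sc' by fact
  have "(\<Sum>a\<in>A. sc (Poly_Mapping.lookup x a) (f a)) \<in> S \<and>
        T (\<Sum>a\<in>A. sc (Poly_Mapping.lookup x a) (f a))
      = (\<Sum>a\<in>A. sc' (Poly_Mapping.lookup x a) (T (f a)))"
    if "finite A" "A \<subseteq> Poly_Mapping.keys x" for A
    using that
  proof (induction A)
    case empty
    have "T (sc 0 0) = sc' 0 (T 0)" by (intro T S_zero)
    then show ?case by (simp add: S_zero)
  next
    case (insert a A)
    then show ?case using f[of a] by (simp add: T S_scale S_add)
  qed
  then show ?thesis by (simp add: lin_comb_def)
qed

lemma lin_end_lin_comb:
  assumes "\<And>a. a \<in> Poly_Mapping.keys x \<Longrightarrow> lin_end sc S (F a)"
  shows "lin_end sc S (\<lambda>v. lin_comb sc (\<lambda>a. F a v) x)"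
proof (rule lin_endI)
  fix u v c assume v: "v \<in> S"
  show "lin_comb sc (\<lambda>a. F a v) x \<in> S"
    using assms v by (intro lin_comb_closed) (auto dest: lin_endD)
  show "lin_comb sc (\<lambda>a. F a (sc c v)) x = sc c (lin_comb sc (\<lambda>a. F a v) x)"
    using assms v by (auto simp flip: lin_comb_fun_scale intro!: lin_comb_cong dest: lin_endD)
  assume u: "u \<in> S"
  show "lin_comb sc (\<lambda>a. F a (u + v)) x = lin_comb sc (\<lambda>a. F a u) x + lin_comb sc (\<lambda>a. F a v) x"
    using assms u v by (auto simp flip: lin_comb_fun_add intro!: lin_comb_cong dest: lin_endD)
qed

end

locale algebra_module = subspace_of sc S + M: Group.monoid M
  for sc :: "complex \<Rightarrow> 'v::ab_group_add \<Rightarrow> 'v" and S :: "'v set"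
    and M :: "('m, 'z) monoid_scheme" +
  fixes \<rho> :: "'m \<Rightarrow> 'v \<Rightarrow> 'v" and R :: "('m \<Rightarrow>\<^sub>0 complex) set"
  assumes rep_lin: "a \<in> carrier M \<Longrightarrow> lin_end sc S (\<rho> a)"
    and rep_mult: "a \<in> carrier M \<Longrightarrow> b \<in> carrier M \<Longrightarrow> v \<in> S \<Longrightarrow> \<rho> (a \<otimes>\<^bsub>M\<^esub> b) v = \<rho> a (\<rho> b v)"
    and rep_one: "v \<in> S \<Longrightarrow> \<rho> \<one>\<^bsub>M\<^esub> v = v"
    and R_carrier: "R \<subseteq> carrier (monoid_algebra M)"
    and R_zero: "r \<in> R \<Longrightarrow> v \<in> S \<Longrightarrow> lin_comb sc (\<lambda>a. \<rho> a v) r = 0"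
begin

abbreviation "MA \<equiv> monoid_algebra M"
abbreviation "I \<equiv> genideal MA R"
abbreviation "A \<equiv> quot MA I"
abbreviation "act x v \<equiv> lin_comb sc (\<lambda>a. \<rho> a v) x"

lemma act_lin: "x \<in> carrier MA \<Longrightarrow> lin_end sc S (act x)"
  by (rule lin_end_lin_comb) (auto intro: rep_lin)

lemma act_mult:
  assumes "x \<in> carrier MA" "y \<in> carrier MA" "v \<in> S"
  shows "act (x \<otimes>\<^bsub>MA\<^esub> y) v = act x (act y v)"
proof -
  have "lin_comb sc (\<lambda>b. \<rho> (a \<otimes>\<^bsub>M\<^esub> b) v) y = \<rho> a (act y v)" if "a \<in> carrier M" for a
  proof -
    have "lin_comb sc (\<lambda>b. \<rho> (a \<otimes>\<^bsub>M\<^esub> b) v) y = lin_comb sc (\<lambda>b. \<rho> a (\<rho> b v)) y"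
      using assms that by (intro lin_comb_cong rep_mult) auto
    also have "\<dots> = \<rho> a (act y v)"
      using assms rep_lin that
      by (intro linear_lin_comb[OF vector_space_axioms, symmetric])
         (auto dest: lin_endD rep_lin)
    finally show ?thesis .
  qed
  then show ?thesis
    unfolding lin_comb_mult using assms(1) by (intro lin_comb_cong) auto
qed

lemma ring_MA: "ring MA"
  by (rule monoid_algebra_ring) (rule M.monoid_axioms)

text \<open>Since it is an ideal, the annihilator contains the ideal generated by the relations as soon as it
  contains the relations themselves. Hence the quotient algebra acts.\<close>

lemma kernel_ideal: "ideal {x \<in> carrier MA. \<forall>v\<in>S. act x v = 0} MA" (is "ideal ?K MA")
proof (rule idealI[OF ring_MA])
  interpret R: ring MA by (rule ring_MA)
  have minus: "\<ominus>\<^bsub>MA\<^esub> x = - x" if "x \<in> carrier MA" for x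
    using that by (intro R.minus_equality) auto
  show "subgroup ?K (add_monoid MA)"
  proof (rule R.add.subgroupI)
    show "?K \<noteq> {}" using R.zero_closed by (auto intro!: exI[of _ 0])
    fix x y assume x: "x \<in> ?K"
    then show "\<ominus>\<^bsub>MA\<^esub> x \<in> ?K"
      using minus[of x] by (auto simp: lin_comb_minus)
    assume "y \<in> ?K"
    with x show "x \<oplus>\<^bsub>MA\<^esub> y \<in> ?K"
      using R.a_closed[of x y] by (auto simp: lin_comb_add)
  qed auto
  fix a x assume a: "a \<in> ?K" and x: "x \<in> carrier MA"
  have *: "act x 0 = 0"
    using lin_endD(3)[OF act_lin[OF x] S_zero, of 0] by simp
  show "x \<otimes>\<^bsub>MA\<^esub> a \<in> ?K"
    using a x R.m_closed[of x a] act_mult[of x a] * by auto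
  show "a \<otimes>\<^bsub>MA\<^esub> x \<in> ?K"
    using a x R.m_closed[of a x] act_mult[of a x] lin_endD(1)[OF act_lin[OF x]] by auto
qed

lemma ideal_I: "ideal I MA"
  by (rule ring.genideal_ideal[OF ring_MA R_carrier])

lemma act_ideal: "x \<in> I \<Longrightarrow> v \<in> S \<Longrightarrow> act x v = 0"
  using ring.genideal_minimal[OF ring_MA kernel_ideal] R_carrier R_zero by blast

lemma elem_A: 
  assumes "X \<in> carrier A"
  obtains x where "x \<in> carrier MA" "X = I +>\<^bsub>MA\<^esub> x"
  using assms by (auto simp: A_RCOSETS_def')

lemma coset_in_A: "x \<in> carrier MA \<Longrightarrow> I +>\<^bsub>MA\<^esub> x \<in> carrier A"
  by (auto simp: A_RCOSETS_def')

lemma class_act_coset: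
  assumes "v \<in> S"
  shows "class_act sc \<rho> (I +>\<^bsub>MA\<^esub> x) v = act x v"
proof -
  interpret J: ideal I MA by (rule ideal_I)
  have "0 \<in> I" using additive_subgroup.zero_closed[OF J.is_additive_subgroup] by simp
  then have "(\<lambda>x. act x v) ` (I +>\<^bsub>MA\<^esub> x) = {act x v}"
    using assms by (force simp: a_r_coset_def' lin_comb_add act_ideal)
  then show ?thesis by (simp add: class_act_def)
qed

lemma class_act_lin:
  assumes "X \<in> carrier A" shows "lin_end sc S (class_act sc \<rho> X)"
proof -
  obtain x where "x \<in> carrier MA" "X = I +>\<^bsub>MA\<^esub> x" using elem_A assms by blast
  then show ?thesis using act_lin[of x]
    by (auto simp: lin_end_def class_act_coset S_add S_scale)
qed

lemma class_act_add:
  assumes "X \<in> carrier A" "Y \<in> carrier A" "v \<in> S"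
  shows "class_act sc \<rho> (X \<oplus>\<^bsub>A\<^esub> Y) v = class_act sc \<rho> X v + class_act sc \<rho> Y v"
proof -
  interpret J: ideal I MA by (rule ideal_I)
  obtain x y where "x \<in> carrier MA" "X = I +>\<^bsub>MA\<^esub> x" "y \<in> carrier MA" "Y = I +>\<^bsub>MA\<^esub> y"
    using elem_A assms by metis
  then show ?thesis
    using J.a_rcos_sum[of x y] assms(3) by (simp add: class_act_coset lin_comb_add)
qed

lemma class_act_mult:
  assumes "X \<in> carrier A" "Y \<in> carrier A" "v \<in> S"
  shows "class_act sc \<rho> (X \<otimes>\<^bsub>A\<^esub> Y) v = class_act sc \<rho> X (class_act sc \<rho> Y v)"
proof -
  interpret J: ideal I MA by (rule ideal_I)
  obtain x y where *: "x \<in> carrier MA" "X = I +>\<^bsub>MA\<^esub> x" "y \<in> carrier MA" "Y = I +>\<^bsub>MA\<^esub> y"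
    using elem_A assms by metis
  then have "act y v \<in> S" using act_lin[of y] assms by (auto dest: lin_endD)
  with * show ?thesis
    using J.rcoset_mult_add[of x y] act_mult[of x y v] assms(3) by (simp add: class_act_coset)
qed

lemma class_act_scale:
  assumes "X \<in> carrier A" "v \<in> S"
  shows "class_act sc \<rho> (c \<odot>\<^bsub>A\<^esub> X) v = sc c (class_act sc \<rho> X v)"
proof -
  obtain x where "x \<in> carrier MA" "X = I +>\<^bsub>MA\<^esub> x" using elem_A assms by blast
  then show ?thesis
    using coset_scale[OF M.monoid_axioms ideal_I, of x c] assms(2)
    by (simp add: class_act_coset lin_comb_scale del: quot_simps)
qed

lemma class_act_one: "v \<in> S \<Longrightarrow> class_act sc \<rho> \<one>\<^bsub>A\<^esub> v = v"
  by (simp add: class_act_coset rep_one)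

lemma ring_A: "ring A"
  by (rule quot_ring) (rule ideal_I)

end

text \<open>Linear maps that commute with the generators commute with the whole algebra.\<close>

lemma class_act_intertwine:
  assumes "algebra_module sc S M \<rho> R" "algebra_module sc' S' M \<rho>' R"
    and T: "\<And>v. v \<in> S \<Longrightarrow> T v \<in> S'" "\<And>u v. u \<in> S \<Longrightarrow> v \<in> S \<Longrightarrow> T (u + v) = T u + T v"
      "\<And>c v. v \<in> S \<Longrightarrow> T (sc c v) = sc' c (T v)"
    and comm: "\<And>a v. a \<in> carrier M \<Longrightarrow> v \<in> S \<Longrightarrow> T (\<rho> a v) = \<rho>' a (T v)"
    and X: "X \<in> carrier (quot (monoid_algebra M) (genideal (monoid_algebra M) R))" and v: "v \<in> S"
  shows "T (class_act sc \<rho> X v) = class_act sc' \<rho>' X (T v)"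
proof -
  interpret V: algebra_module sc S M \<rho> R by fact
  interpret W: algebra_module sc' S' M \<rho>' R by fact
  obtain x where x: "x \<in> carrier V.MA" "X = V.I +>\<^bsub>V.MA\<^esub> x" using V.elem_A X by blast
  have "T (V.act x v) = lin_comb sc' (\<lambda>a. T (\<rho> a v)) x"
    using x v V.rep_lin
    by (intro V.linear_lin_comb[OF W.vector_space_axioms]) (auto simp: T dest: lin_endD)
  also have "\<dots> = W.act x (T v)"
    using x v by (intro lin_comb_cong comm) auto
  finally show ?thesis
    using x v T by (simp add: V.class_act_coset W.class_act_coset)
qed

section \<open>Modules over the quantum algebra\<close>

abbreviation "words \<equiv> \<lparr>carrier = UNIV, mult = (@), one = []\<rparr>"

lemma free_algebra_eq: "free_algebra = monoid_algebra words"
  by (simp add: free_algebra_def)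

lemma Usl2_eq: "Usl2 h = quot (monoid_algebra words) (genideal (monoid_algebra words) (usl2_relations h))"
  by (simp add: Usl2_def presented_algebra_def free_algebra_eq)

lemma monoid_words: "Group.monoid words"
  by (rule monoidI) auto

locale usl2_module = subspace_of sc S
  for sc :: "complex \<Rightarrow> 'v::ab_group_add \<Rightarrow> 'v" and S :: "'v set" +
  fixes h :: nat and g :: "gen \<Rightarrow> 'v \<Rightarrow> 'v"
  assumes g_lin: "lin_end sc S (g x)"
    and K_Kinv: "v \<in> S \<Longrightarrow> g Khalf (g Kinvhalf v) = v" "v \<in> S \<Longrightarrow> g Kinvhalf (g Khalf v) = v"
    and K_E: "v \<in> S \<Longrightarrow> g Khalf (g GE (g Kinvhalf v)) = sc (qpow h 1) (g GE v)"
    and K_F: "v \<in> S \<Longrightarrow> g Khalf (g GF (g Kinvhalf v)) = sc (qpow h (-1)) (g GF v)"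
    and E_F: "v \<in> S \<Longrightarrow> g GE (g GF v) - g GF (g GE v) =
       sc (1 / (qpow h 1 - qpow h (-1))) (g Khalf (g Khalf v) - g Kinvhalf (g Kinvhalf v))"
    and E_h: "v \<in> S \<Longrightarrow> (g GE ^^ h) v = 0"
    and F_h: "v \<in> S \<Longrightarrow> (g GF ^^ h) v = 0"
    and K_4h: "v \<in> S \<Longrightarrow> (g Khalf ^^ (4 * h)) v = v"
begin

lemma word_lin: "lin_end sc S (foldr g w)"
proof (induction w)
  case (Cons x w)
  then show ?case using g_lin[of x] by (auto simp: lin_end_def)
qed (simp add: lin_end_def)

lemma algebra_module_words: "algebra_module sc S words (foldr g) (usl2_relations h)"
proof -
  interpret monoid words by (rule monoid_words)
  have replicate: "foldr g (replicate n x) v = (g x ^^ n) v" for n x v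
    by (induction n) simp_all
  have "lin_comb sc (\<lambda>w. foldr g w v) r = 0" if r: "r \<in> usl2_relations h" and v: "v \<in> S" for r v
    using r unfolding usl2_relations_def
    by (elim insertE emptyE)
       (simp_all add: lin_comb_diff lin_comb_scale lin_comb_single K_Kinv K_E K_F E_F E_h F_h K_4h v replicate
         scale_right_diff_distrib)
  then show ?thesis
    by unfold_locales (auto intro: word_lin)
qed

sublocale W: algebra_module sc S words "foldr g" "usl2_relations h"
  by (rule algebra_module_words)

lemma W_A: "W.A = Usl2 h"
  by (simp add: Usl2_eq)

end

lemma ring_Usl2: "ring (Usl2 h)"
proof -
  have "ideal (genideal (monoid_algebra words) (usl2_relations h)) (monoid_algebra words)"
    by (rule ring.genideal_ideal[OF monoid_algebra_ring[OF monoid_words]]) simp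
  then show ?thesis unfolding Usl2_eq by (rule quot_ring)
qed

text \<open>The class of a generator in the first and in the second tensor factor.\<close>

definition gen_class :: "nat \<Rightarrow> gen \<Rightarrow> usl2" where
  "gen_class h x = genideal (monoid_algebra words) (usl2_relations h) +>\<^bsub>monoid_algebra words\<^esub> word_elem [x]"

definition pure_tensor :: "nat \<Rightarrow> usl2 \<Rightarrow> usl2 \<Rightarrow> uq" where
  "pure_tensor h a b = genideal (monoid_algebra (Usl2 h \<times>\<times> Usl2 h)) (tensor_relators (Usl2 h) (Usl2 h))
     +>\<^bsub>monoid_algebra (Usl2 h \<times>\<times> Usl2 h)\<^esub> Poly_Mapping.single (a, b) 1"

definition "gen_left h x = pure_tensor h (gen_class h x) \<one>\<^bsub>Usl2 h\<^esub>"
definition "gen_right h x = pure_tensor h \<one>\<^bsub>Usl2 h\<^esub> (gen_class h x)"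

locale uq_module = L: usl2_module sc S h g + R: usl2_module sc S h g'
  for sc :: "complex \<Rightarrow> 'v::ab_group_add \<Rightarrow> 'v" and S h g g' +
  assumes g_comm: "v \<in> S \<Longrightarrow> g x (g' y v) = g' y (g x v)"
begin

definition rep :: "usl2 \<times> usl2 \<Rightarrow> 'v \<Rightarrow> 'v" where
  "rep = (\<lambda>(a, b) v. class_act sc (foldr g) a (class_act sc (foldr g') b v))"

text \<open>Generators of one factor commute with words of the other, and then with classes of words, so the
  two actions combine to one of the tensor product.\<close>

lemma word_comm:
  assumes "v \<in> S" shows "foldr g w (g' y v) = g' y (foldr g w v)"
proof (induction w)
  case (Cons x w)
  then show ?case using g_comm[of "foldr g w v" x y] L.word_lin[of w] assms by (auto dest: lin_endD)
qed simp

lemma word_comm':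
  assumes "v \<in> S" shows "foldr g w (foldr g' w' v) = foldr g' w' (foldr g w v)"
proof (induction w')
  case (Cons x w')
  then show ?case using word_comm[of "foldr g' w' v" w x] R.word_lin[of w'] assms by (auto dest: lin_endD)
qed simp

lemma class_comm:
  assumes "a \<in> carrier (Usl2 h)" "b \<in> carrier (Usl2 h)" "v \<in> S"
  shows "class_act sc (foldr g) a (class_act sc (foldr g') b v)
       = class_act sc (foldr g') b (class_act sc (foldr g) a v)"
proof (rule class_act_intertwine[OF R.algebra_module_words R.algebra_module_words])
  fix w' v assume v: "v \<in> S"
  show "class_act sc (foldr g) a (foldr g' w' v) = foldr g' w' (class_act sc (foldr g) a v)"
    by (rule class_act_intertwine[OF L.algebra_module_words L.algebra_module_words, symmetric])
       (use R.word_lin[of w'] assms v in \<open>auto simp: word_comm' Usl2_eq dest: lin_endD\<close>)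
qed (use assms L.W.class_act_lin[of a] in \<open>auto simp: Usl2_eq dest: lin_endD\<close>)

lemma monoid_pairs: "Group.monoid (Usl2 h \<times>\<times> Usl2 h)"
  using ring_Usl2 by (intro DirProd_monoid) (auto intro: ring.is_monoid)

text \<open>The relators of bilinearity are supported on pairs of elements, which needs closure of the
  quotient algebra under scalars.\<close>

lemma tensor_relators_carrier:
  "tensor_relators (Usl2 h) (Usl2 h) \<subseteq> carrier (monoid_algebra (Usl2 h \<times>\<times> Usl2 h))"
proof -
  interpret U: ring "Usl2 h" by (rule ring_Usl2)
  have sc: "c \<odot>\<^bsub>Usl2 h\<^esub> a \<in> carrier (Usl2 h)" if a: "a \<in> carrier (Usl2 h)" for c a
  proof -
    obtain x where "a = L.W.I +>\<^bsub>L.W.MA\<^esub> x" using L.W.elem_A[unfolded L.W_A, OF a] by blast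
    then have "c \<odot>\<^bsub>Usl2 h\<^esub> a = L.W.I +>\<^bsub>L.W.MA\<^esub> scale c x"
      using coset_scale[OF monoid_words L.W.ideal_I, of x c] by (simp add: Usl2_eq del: quot_simps)
    then show ?thesis using L.W.coset_in_A[of "scale c x"] unfolding L.W_A by simp
  qed
  have keys3: "Poly_Mapping.keys (Poly_Mapping.single a 1 - Poly_Mapping.single b 1 - Poly_Mapping.single c (1::complex))
      \<subseteq> {a, b, c}" for a b c :: "usl2 \<times> usl2"
    by (auto simp: in_keys_iff lookup_minus lookup_single when_def split: if_splits)
  have keys2: "Poly_Mapping.keys (Poly_Mapping.single a 1 - Poly_Mapping.single b (d::complex)) \<subseteq> {a, b}"
    for a b :: "usl2 \<times> usl2" and d
    by (auto simp: in_keys_iff lookup_minus lookup_single when_def split: if_splits)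
  show ?thesis
    unfolding tensor_relators_def
    by (intro Un_least subsetI; elim CollectE exE conjE; simp;
        rule subset_trans[OF keys3] subset_trans[OF keys2]; simp add: sc)
qed

sublocale U: algebra_module sc S "Usl2 h \<times>\<times> Usl2 h" rep "tensor_relators (Usl2 h) (Usl2 h)"
proof -
  interpret U: ring "Usl2 h" by (rule ring_Usl2)
  interpret monoid "Usl2 h \<times>\<times> Usl2 h" by (rule monoid_pairs)
  have L: "lin_end sc S (class_act sc (foldr g) a)" "lin_end sc S (class_act sc (foldr g') a)"
    if "a \<in> carrier (Usl2 h)" for a
    using that L.W.class_act_lin[of a] R.W.class_act_lin[of a] by (simp_all add: Usl2_eq)
  have L1: "class_act sc (foldr g) a v \<in> S" "class_act sc (foldr g') a v \<in> S"
    if "a \<in> carrier (Usl2 h)" "v \<in> S" for a v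
    using L[OF that(1)] that(2) by (auto dest: lin_endD)
  note laws = L.W.class_act_add R.W.class_act_add L.W.class_act_mult R.W.class_act_mult
    L.W.class_act_scale R.W.class_act_scale L.W.class_act_one R.W.class_act_one
  note laws = laws[unfolded L.W_A]
  show "algebra_module sc S (Usl2 h \<times>\<times> Usl2 h) rep (tensor_relators (Usl2 h) (Usl2 h))"
  proof unfold_locales
    fix a assume "a \<in> carrier (Usl2 h \<times>\<times> Usl2 h)"
    then show "lin_end sc S (rep a)"
      using L by (auto simp: rep_def lin_end_def)
  next
    fix a b v assume "a \<in> carrier (Usl2 h \<times>\<times> Usl2 h)" "b \<in> carrier (Usl2 h \<times>\<times> Usl2 h)" "v \<in> S"
    then show "rep (a \<otimes>\<^bsub>Usl2 h \<times>\<times> Usl2 h\<^esub> b) v = rep a (rep b v)"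
      by (auto simp: rep_def laws L1 class_comm)
  next
    fix v assume "v \<in> S"
    then show "rep \<one>\<^bsub>Usl2 h \<times>\<times> Usl2 h\<^esub> v = v" by (simp add: rep_def laws)
  next
    show "tensor_relators (Usl2 h) (Usl2 h) \<subseteq> carrier (monoid_algebra (Usl2 h \<times>\<times> Usl2 h))"
      by (rule tensor_relators_carrier)
  next
    fix r v assume r: "r \<in> tensor_relators (Usl2 h) (Usl2 h)" and v: "v \<in> S"
    show "lin_comb sc (\<lambda>a. rep a v) r = 0"
      using r v unfolding tensor_relators_def
      by (elim UnE CollectE exE conjE)
         (simp_all add: L.lin_comb_diff L.lin_comb_single rep_def laws L1 lin_endD[OF L(1)] lin_endD[OF L(2)])
  qed
qed

lemma U_A: "U.A = Uq h"
  by (simp add: Uq_def tensor_algebra_def)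

abbreviation "uact \<equiv> class_act sc rep"

lemma g_closed: "v \<in> S \<Longrightarrow> g x v \<in> S" "v \<in> S \<Longrightarrow> g' x v \<in> S"
  using L.g_lin R.g_lin by (auto dest: lin_endD)

lemma uact_gen_left: "v \<in> S \<Longrightarrow> uact (gen_left h x) v = g x v"
  and uact_gen_right: "v \<in> S \<Longrightarrow> uact (gen_right h x) v = g' x v"
proof -
  assume v: "v \<in> S"
  have pure: "uact (pure_tensor h a b) v = rep (a, b) v" for a b
    by (simp add: pure_tensor_def U.class_act_coset v)
  have gen: "class_act sc (foldr g) (gen_class h x) v = g x v"
    "class_act sc (foldr g') (gen_class h x) v = g' x v"
    by (simp_all add: gen_class_def L.W.class_act_coset R.W.class_act_coset v)
  show "uact (gen_left h x) v = g x v" "uact (gen_right h x) v = g' x v"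
    unfolding gen_left_def gen_right_def pure
    using v L.W.class_act_one R.W.class_act_one g_closed[of v x]
    by (simp_all only: rep_def prod.case gen L.W_A)
qed

lemma gen_left_closed: "gen_left h x \<in> carrier (Uq h)"
  and gen_right_closed: "gen_right h x \<in> carrier (Uq h)"
proof -
  interpret U: ring "Usl2 h" by (rule ring_Usl2)
  have "gen_class h x \<in> carrier (Usl2 h)"
    unfolding L.W_A[symmetric] gen_class_def by (rule L.W.coset_in_A) simp
  then show "gen_left h x \<in> carrier (Uq h)" "gen_right h x \<in> carrier (Uq h)"
    unfolding U_A[symmetric] gen_left_def gen_right_def pure_tensor_def
    by (auto intro!: U.coset_in_A simp del: quot_simps)
qed

lemmas uact_lin = U.class_act_lin[unfolded U_A]
  and uact_add = U.class_act_add[unfolded U_A]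
  and uact_mult = U.class_act_mult[unfolded U_A]
  and uact_scale = U.class_act_scale[unfolded U_A]
  and uact_one = U.class_act_one[unfolded U_A]
  and ring_Uq = U.ring_A[unfolded U_A]

end

text \<open>Applied to \<open>c \<mapsto> c \<Psi>\<close> on the module given by the counit, this reduces
  invariance of \<open>\<Psi>\<close> to the generators; applied to \<open>A\<close>, it shows
  that \<open>A\<close> commutes with the whole algebra.\<close>

lemma uact_intertwine:
  assumes "uq_module sc S h g g'" "uq_module sc' S' h k k'"
    and T: "\<And>v. v \<in> S \<Longrightarrow> T v \<in> S'" "\<And>u v. u \<in> S \<Longrightarrow> v \<in> S \<Longrightarrow> T (u + v) = T u + T v"
      "\<And>c v. v \<in> S \<Longrightarrow> T (sc c v) = sc' c (T v)"
    and comm: "\<And>x v. v \<in> S \<Longrightarrow> T (g x v) = k x (T v)" "\<And>x v. v \<in> S \<Longrightarrow> T (g' x v) = k' x (T v)"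
    and X: "X \<in> carrier (Uq h)" and v: "v \<in> S"
  shows "T (class_act sc (uq_module.rep sc g g') X v) = class_act sc' (uq_module.rep sc' k k') X (T v)"
proof -
  interpret V: uq_module sc S h g g' by fact
  interpret W: uq_module sc' S' h k k' by fact
  have words: "T (foldr g w v) = foldr k w (T v)" "T (foldr g' w v) = foldr k' w (T v)" if "v \<in> S" for w v
    using that lin_endD(1)[OF V.L.word_lin that] lin_endD(1)[OF V.R.word_lin that]
    by (induction w) (simp_all add: comm)
  have "T (class_act sc (foldr g) a v) = class_act sc' (foldr k) a (T v)"
    if "a \<in> carrier (Usl2 h)" "v \<in> S" for a v
    by (rule class_act_intertwine[OF V.L.algebra_module_words W.L.algebra_module_words])
       (use that T words in \<open>auto simp: Usl2_eq\<close>)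
  moreover have "T (class_act sc (foldr g') a v) = class_act sc' (foldr k') a (T v)"
    if "a \<in> carrier (Usl2 h)" "v \<in> S" for a v
    by (rule class_act_intertwine[OF V.R.algebra_module_words W.R.algebra_module_words])
       (use that T words in \<open>auto simp: Usl2_eq\<close>)
  moreover have "class_act sc (foldr g') a v \<in> S" if "a \<in> carrier (Usl2 h)" "v \<in> S" for a v
    using V.R.W.class_act_lin[of a] that by (auto simp: Usl2_eq dest: lin_endD)
  ultimately show ?thesis
    by (intro class_act_intertwine[OF V.U.algebra_module_axioms W.U.algebra_module_axioms])
       (use T X v in \<open>auto simp: V.rep_def W.rep_def V.U_A[symmetric]\<close>)
qed

text \<open>The counit makes the complex numbers a module over the quantum algebra.\<close>

lemma counit_usl2_module: "usl2_module (*) (UNIV :: complex set) h (\<lambda>x v. counit_gen x * v)"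
  if "2 \<le> h"
proof -
  have pow: "((\<lambda>v. counit_gen x * v) ^^ n) v = counit_gen x ^ n * v" for x v n
    by (induction n) simp_all
  have lin: "lin_end (*) (UNIV :: complex set) (\<lambda>v. counit_gen x * v)" for x
    by (rule lin_endI) (simp_all add: distrib_left)
  show ?thesis using that
    by unfold_locales (simp_all only: lin, simp_all only: pow, simp_all add: distrib_left distrib_right)
qed

lemma counit_uq_module:
  "uq_module (*) (UNIV :: complex set) h (\<lambda>x v. counit_gen x * v) (\<lambda>x v. counit_gen x * v)"
  if "2 \<le> h"
  using that counit_usl2_module[OF that] by (auto simp: uq_module_def uq_module_axioms_def)

lemma Uq_counit_eq:
  assumes "2 \<le> h" "X \<in> carrier (Uq h)"
  shows "Uq_counit X = class_act (*)
    (uq_module.rep (*) (\<lambda>x v. counit_gen x * v) (\<lambda>x v. counit_gen x * v)) X 1"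
proof -
  interpret C: uq_module "(*)" "UNIV :: complex set" h "\<lambda>x v. counit_gen x * v" "\<lambda>x v. counit_gen x * v"
    by (rule counit_uq_module) fact
  have fold: "foldr (\<lambda>x v. counit_gen x * v) w 1 = prod_list (map counit_gen w)" for w
    by (induction w) simp_all
  have usl2: "usl2_counit a = class_act (*) (foldr (\<lambda>x v. counit_gen x * v)) a 1" for a
    by (simp add: usl2_counit_def class_act_def lin_comb_def fold)
  obtain x where x: "x \<in> carrier C.U.MA" "X = C.U.I +>\<^bsub>C.U.MA\<^esub> x"
    using C.U.elem_A[unfolded C.U_A, OF assms(2)] by blast
  have "(\<Sum>(a, b)\<in>Poly_Mapping.keys y. Poly_Mapping.lookup y (a, b) * usl2_counit a * usl2_counit b)
      = lin_comb (*) (\<lambda>p. C.rep p 1) y" if "y \<in> X" for y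
  proof -
    interpret J: ideal C.U.I C.U.MA by (rule C.U.ideal_I)
    have y: "Poly_Mapping.keys y \<subseteq> carrier (Usl2 h) \<times> carrier (Usl2 h)"
      using J.a_elemrcos_carrier[of x y] that x by simp
    have "C.rep (a, b) 1 = usl2_counit a * usl2_counit b"
      if "a \<in> carrier (Usl2 h)" for a b
    proof -
      have "class_act (*) (foldr (\<lambda>x v. counit_gen x * v)) a (usl2_counit b * 1)
          = usl2_counit b * class_act (*) (foldr (\<lambda>x v. counit_gen x * v)) a 1"
        using that by (intro lin_endD(3)[OF C.L.W.class_act_lin]) (simp_all add: Usl2_eq)
      then show ?thesis
        unfolding C.rep_def usl2 prod.case mult_1_right by (rule trans) (rule mult.commute)
    qed
    with y show ?thesis
      by (auto simp: lin_comb_def intro!: sum.cong)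
  qed
  then show ?thesis by (simp add: Uq_counit_def class_act_def cong: image_cong)
qed

section \<open>Quantum numbers\<close>

lemma qpow_eq_cis: "qpow h x = cis (pi * x / real h)"
  by (simp add: qpow_def cis_conv_exp)

lemma qpow_0 [simp]: "qpow h 0 = 1"
  and qpow_nonzero [simp]: "qpow h x \<noteq> 0"
  and qpow_add: "qpow h (x + y) = qpow h x * qpow h y"
  and qpow_minus: "qpow h (- x) = inverse (qpow h x)"
  and qpow_diff: "qpow h (x - y) = qpow h x / qpow h y"
  by (simp_all add: qpow_eq_cis cis_mult cis_divide add_divide_distrib diff_divide_distrib distrib_left
      right_diff_distrib flip: cis_inverse)

lemma qpow_1_power: "qpow h 1 ^ n = qpow h (real n)"
  by (simp add: qpow_eq_cis DeMoivre mult.commute)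

locale root_order =
  fixes h :: nat
  assumes h: "2 \<le> h"
begin

definition q :: complex where "q = qpow h 1"
definition qn :: "nat \<Rightarrow> complex" where "qn n = qnum h (int n)"

lemma qpow_h: "qpow h (real h) = -1"
  using h by (simp add: qpow_eq_cis)

lemma q_nonzero [simp]: "q \<noteq> 0" by (simp add: q_def)

lemma qpow_nat: "qpow h (real n) = q ^ n"
  by (simp add: q_def qpow_1_power)

lemma qpow_1: "qpow h 1 = q" "qpow h (-1) = inverse q"
  by (simp_all add: q_def qpow_minus)

lemma q_h: "q ^ h = -1"
  using qpow_h by (simp add: qpow_nat)

lemma sin_pos:
  assumes "0 < n" "n < h" shows "sin (pi * real n / real h) > 0"
proof (rule sin_gt_zero)
  show "pi * real n / real h < pi" using assms by (simp add: field_simps)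
qed (use assms in simp)

lemma qpow_minus_qpow: "qpow h x - qpow h (- x) = 2 * \<i> * sin (pi * x / real h)"
  by (simp add: qpow_eq_cis complex_eq_iff)

lemma q_sq_ne: "q * q \<noteq> 1" "q - inverse q \<noteq> 0"
proof -
  have "q - inverse q \<noteq> 0"
    using qpow_minus_qpow[of 1] sin_pos[of 1] h by (simp add: qpow_1)
  then show "q - inverse q \<noteq> 0" "q * q \<noteq> 1" by (auto simp: field_simps)
qed

lemma qn_eq: "qn n = (q ^ n - inverse (q ^ n)) / (q - inverse q)"
  by (simp add: qn_def qnum_def qpow_nat qpow_minus qpow_1)

lemma qn_0 [simp]: "qn 0 = 0" by (simp add: qn_eq)
lemma qn_h [simp]: "qn h = 0" by (simp add: qn_eq q_h)

lemma qn_nonzero: "0 < n \<Longrightarrow> n < h \<Longrightarrow> qn n \<noteq> 0"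
  using qpow_minus_qpow[of "real n"] sin_pos[of n] q_sq_ne
  by (simp add: qn_eq qpow_nat qpow_minus)

text \<open>The number \<open>q\<^sup>2\<close> is a primitive root of unity of order \<open>h\<close>.\<close>

definition qint :: "nat \<Rightarrow> complex" where "qint n = (\<Sum>i<n. q ^ (2 * i))"

lemma qint_eq: "qint n = (q ^ (2 * n) - 1) / (q ^ 2 - 1)"
  using q_sq_ne geometric_sum[of "q ^ 2" n] by (simp add: qint_def power_mult power2_eq_square)

lemma qint_qn: "qint n * q = q ^ n * qn n"
proof -
  have "q ^ n * (q ^ n - inverse (q ^ n)) = q ^ (2 * n) - 1" "q * (q - inverse q) = q ^ 2 - 1"
    by (simp_all add: right_diff_distrib mult_2 power_add power2_eq_square)
  then show ?thesis
    using q_sq_ne by (simp add: qint_eq qn_eq divide_simps mult.commute)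
qed

lemma qint_h: "qint h = 0"
  using qint_qn[of h] by simp

lemma qint_nonzero: "0 < n \<Longrightarrow> n < h \<Longrightarrow> qint n \<noteq> 0"
  using qint_qn[of n] qn_nonzero[of n] by auto

definition qfact :: "nat \<Rightarrow> complex" where "qfact n = (\<Prod>i=1..n. qint i)"

lemma qfact_0 [simp]: "qfact 0 = 1" and qfact_Suc: "qfact (Suc n) = qfact n * qint (Suc n)"
  by (simp_all add: qfact_def)

lemma qfact_nonzero: "n < h \<Longrightarrow> qfact n \<noteq> 0"
  by (auto simp: qfact_def qint_nonzero)

lemma qfact_zero: "h \<le> n \<Longrightarrow> qfact n = 0"
  using qint_h h by (simp add: qfact_def) (metis One_nat_def Suc_leI atLeastAtMost_iff less_le_trans pos2)

section \<open>The q-binomial theorem at a root of unity\<close>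

fun qbinom :: "nat \<Rightarrow> nat \<Rightarrow> complex" where
  "qbinom n 0 = 1"
| "qbinom 0 (Suc k) = 0"
| "qbinom (Suc n) (Suc k) = q ^ (2 * Suc k) * qbinom n (Suc k) + qbinom n k"

lemma qbinom_eq_0: "n < k \<Longrightarrow> qbinom n k = 0"
  by (induction n k rule: qbinom.induct) auto

text \<open>The usual quotient of factorials, multiplied out because the factorials vanish from
  \<open>h\<close> on.\<close>

lemma qbinom_qfact: "k \<le> n \<Longrightarrow> qbinom n k * (qfact k * qfact (n - k)) = qfact n"
proof (induction n k rule: qbinom.induct)
  case (3 n k)
  have add: "qint (a + b) = qint a + q ^ (2 * a) * qint b" for a b
    by (induction b) (simp_all add: qint_def algebra_simps power_add)
  show ?case
  proof (cases "k = n")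
    case True
    then show ?thesis using 3 by (simp add: qbinom_eq_0 qfact_Suc mult.assoc[symmetric])
  next
    case False
    then obtain d where d: "n = Suc k + d" using 3(3) less_iff_Suc_add[of k n] by auto
    from 3(1,2) have IH: "qbinom n (Suc k) * (qfact (Suc k) * qfact d) = qfact n"
      "qbinom n k * (qfact k * qfact (Suc d)) = qfact n" by (simp_all add: d)
    have "qbinom (Suc n) (Suc k) * (qfact (Suc k) * qfact (Suc n - Suc k))
        = q ^ (2 * Suc k) * qint (Suc d) * (qbinom n (Suc k) * (qfact (Suc k) * qfact d))
          + qint (Suc k) * (qbinom n k * (qfact k * qfact (Suc d)))"
    proof -
      have rec: "qbinom (Suc n) (Suc k) = q ^ (2 * Suc k) * qbinom n (Suc k) + qbinom n k"
        and nk: "Suc n - Suc k = Suc d" by (simp_all add: d)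
      show ?thesis
        unfolding rec nk by (simp only: qfact_Suc[of k] qfact_Suc[of d] distrib_left distrib_right mult_ac)
    qed
    also have "\<dots> = qfact n * (qint (Suc k) + q ^ (2 * Suc k) * qint (Suc d))"
      unfolding IH by (simp only: distrib_left mult_ac add_ac)
    also have "\<dots> = qfact (Suc n)"
      using add[of "Suc k" "Suc d"] by (simp add: qfact_Suc d)
    finally show ?thesis .
  qed
qed simp_all

lemma qbinom_self: "qbinom n n = 1"
  by (induction n) (simp_all add: qbinom_eq_0)

text \<open>The numerator contains the vanishing \<open>q\<^sup>2\<close>-integer of \<open>h\<close>, the
  denominator does not.\<close>

lemma qbinom_h: "0 < k \<Longrightarrow> k < h \<Longrightarrow> qbinom h k = 0"
  using qbinom_qfact[of k h] qfact_zero[of h] qfact_nonzero[of k] qfact_nonzero[of "h - k"] by auto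

end

lemma (in subspace_of) lin_end_funpow: "lin_end sc S T \<Longrightarrow> lin_end sc S (T ^^ n)"
  by (induction n) (auto simp: lin_end_def)

lemma (in subspace_of) lin_end_sum:
  assumes T: "lin_end sc S T" and "finite A" and f: "\<And>a. a \<in> A \<Longrightarrow> f a \<in> S"
  shows "T (sum f A) = (\<Sum>a\<in>A. T (f a)) \<and> sum f A \<in> S"
  using \<open>finite A\<close> f
proof (induction A)
  case empty
  then show ?case using lin_endD(3)[OF T S_zero, of 0] by (simp add: S_zero)
next
  case (insert a A)
  then show ?case using lin_endD(2)[OF T] by (simp add: S_add)
qed

context root_order
begin

lemma q_binomial_theorem:
  fixes X Y :: "'v::ab_group_add \<Rightarrow> 'v"
  assumes S: "subspace_of sc S" and X: "lin_end sc S X" and Y: "lin_end sc S Y"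
    and comm: "\<And>v. v \<in> S \<Longrightarrow> X (Y v) = sc (q ^ 2) (Y (X v))" and v: "v \<in> S"
  shows "((\<lambda>v. X v + Y v) ^^ n) v = (\<Sum>k\<le>n. sc (qbinom n k) ((Y ^^ k) ((X ^^ (n - k)) v)))"
proof (induction n)
  case 0
  interpret S: subspace_of sc S by fact
  show ?case by simp
next
  case (Suc n)
  interpret S: subspace_of sc S by fact
  have in_S: "(Y ^^ k) u \<in> S" "(X ^^ k) u \<in> S" if "u \<in> S" for u k
    using that S.lin_end_funpow[OF X, of k] S.lin_end_funpow[OF Y, of k] by (auto dest: lin_endD)
  have XY: "X ((Y ^^ k) u) = sc (q ^ (2 * k)) ((Y ^^ k) (X u))" if "u \<in> S" for u k
    using that
  proof (induction k)
    case (Suc k)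
    then have u: "(Y ^^ k) u \<in> S" "(Y ^^ k) (X u) \<in> S"
      using in_S(1) lin_endD(1)[OF X] by blast+
    have "X ((Y ^^ Suc k) u) = sc (q ^ 2) (Y (X ((Y ^^ k) u)))"
      using u by (simp add: comm)
    also have "\<dots> = sc (q ^ 2 * q ^ (2 * k)) ((Y ^^ Suc k) (X u))"
      using u Suc by (simp add: lin_endD(3)[OF Y])
    finally show ?case by (simp only: power_add[symmetric] mult_Suc_right)
  qed simp
  let ?t = "\<lambda>k. (Y ^^ k) ((X ^^ (Suc n - k)) v)"
  have tS: "?t k \<in> S" for k using in_S v by blast
  have step: "X ((Y ^^ k) ((X ^^ (n - k)) v)) = sc (q ^ (2 * k)) (?t k)" if "k \<le> n" for k
    using that XY[of "(X ^^ (n - k)) v" k] in_S v by (simp add: Suc_diff_le)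
  have "((\<lambda>v. X v + Y v) ^^ Suc n) v = (\<Sum>k\<le>n. sc (qbinom n k) (X ((Y ^^ k) ((X ^^ (n - k)) v))))
      + (\<Sum>k\<le>n. sc (qbinom n k) (Y ((Y ^^ k) ((X ^^ (n - k)) v))))"
    using v in_S
    by (simp add: Suc S.lin_end_sum[OF X] S.lin_end_sum[OF Y] S.S_scale lin_endD[OF X] lin_endD[OF Y])
  also have "\<dots> = (\<Sum>k\<le>n. sc (q ^ (2 * k) * qbinom n k) (?t k)) + (\<Sum>k\<le>n. sc (qbinom n k) (?t (Suc k)))"
    by (simp add: step mult.commute)
  also have "(\<Sum>k\<le>n. sc (q ^ (2 * k) * qbinom n k) (?t k))
      = (\<Sum>k\<le>Suc n. sc (q ^ (2 * k) * qbinom n k) (?t k))"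
    by (simp add: qbinom_eq_0)
  also have "\<dots> = sc 1 (?t 0) + (\<Sum>k\<le>n. sc (q ^ (2 * Suc k) * qbinom n (Suc k)) (?t (Suc k)))"
    by (subst sum.atMost_Suc_shift) simp
  also have "\<dots> + (\<Sum>k\<le>n. sc (qbinom n k) (?t (Suc k)))
      = sc (qbinom (Suc n) 0) (?t 0) + (\<Sum>k\<le>n. sc (qbinom (Suc n) (Suc k)) (?t (Suc k)))"
    by (simp add: S.scale_left_distrib sum.distrib add.assoc)
  also have "\<dots> = (\<Sum>k\<le>Suc n. sc (qbinom (Suc n) k) (?t k))"
    by (rule sum.atMost_Suc_shift[symmetric])
  finally show ?case .
qed

text \<open>All binomial coefficients strictly inside row \<open>h\<close> vanish.\<close>

lemma q_binomial_root:
  fixes X Y :: "'v::ab_group_add \<Rightarrow> 'v"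
  assumes S: "subspace_of sc S" and X: "lin_end sc S X" and Y: "lin_end sc S Y"
    and comm: "\<And>v. v \<in> S \<Longrightarrow> X (Y v) = sc (q ^ 2) (Y (X v))" and v: "v \<in> S"
  shows "((\<lambda>v. X v + Y v) ^^ h) v = (X ^^ h) v + (Y ^^ h) v"
proof -
  interpret S: subspace_of sc S by fact
  have "(\<Sum>k\<le>h. sc (qbinom h k) ((Y ^^ k) ((X ^^ (h - k)) v)))
      = (\<Sum>k\<in>{0, h}. sc (qbinom h k) ((Y ^^ k) ((X ^^ (h - k)) v)))"
    by (rule sum.mono_neutral_right) (auto simp: qbinom_h)
  then show ?thesis
    using h by (simp add: q_binomial_theorem[OF assms] qbinom_self)
qed

end

section \<open>The Fock space operators on basis vectors\<close>

lemma lookup_tens: "Poly_Mapping.lookup (tens v w) (a, b) = Poly_Mapping.lookup v a * Poly_Mapping.lookup w b"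
proof -
  have "Poly_Mapping.lookup (tens v w) (a, b) = (\<Sum>a'\<in>Poly_Mapping.keys v. \<Sum>b'\<in>Poly_Mapping.keys w.
      (if a' = a then if b' = b then Poly_Mapping.lookup v a' * Poly_Mapping.lookup w b' else 0 else 0))"
    by (simp add: tens_def lookup_sum lookup_single when_def if_distrib cong: if_cong)
       (intro sum.cong refl; simp)
  also have "\<dots> = (\<Sum>a'\<in>Poly_Mapping.keys v. if a' = a then
      (\<Sum>b'\<in>Poly_Mapping.keys w. if b' = b then Poly_Mapping.lookup v a' * Poly_Mapping.lookup w b' else 0) else 0)"
    by (intro sum.cong refl) simp
  also have "\<dots> = Poly_Mapping.lookup v a * Poly_Mapping.lookup w b"
    by (simp add: in_keys_iff)
  finally show ?thesis .
qed

lemma tens_0 [simp]: "tens 0 w = 0" "tens v 0 = 0"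
  by (simp_all add: tens_def)

lemma tens_scale: "tens (scale c v) (scale d w) = scale (c * d) (tens v w)"
  by (rule poly_mapping_eqI) (auto simp: lookup_tens)

lemma tens_scale1: "tens (scale c v) w = scale c (tens v w)" "tens v (scale c w) = scale c (tens v w)"
  by (rule poly_mapping_eqI, auto simp: lookup_tens)+

lemma tens_single: "tens (Poly_Mapping.single a c) (Poly_Mapping.single b d) = Poly_Mapping.single (a, b) (c * d)"
  by (rule poly_mapping_eqI) (auto simp: lookup_tens lookup_single when_def split: if_splits)

lemma lin_ext_lin: "lin_end scale UNIV (lin_ext f)"
  by (rule lin_endI) (simp_all add: lin_ext_eq hvs.lin_comb_add hvs.lin_comb_scale)

lemma lin_ext_single: "lin_ext f (Poly_Mapping.single a 1) = f a"
  by (simp add: lin_ext_eq)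

lemma lin_ext_0 [simp]: "lin_ext f 0 = 0"
  by (simp add: lin_ext_eq)

lemma op_tensor_lin: "lin_end scale UNIV (op_tensor S T)"
  unfolding op_tensor_def by (rule lin_ext_lin)

lemma lin_UNIV:
  assumes "lin_end scale UNIV T"
  shows "T (u + v) = T u + T v" "T (scale c v) = scale c (T v)" "T 0 = 0" "T (- v) = - T v"
    "T (u - v) = T u - T v"
proof -
  show *: "T (u + v) = T u + T v" "T (scale c v) = scale c (T v)" for u v c
    using assms by (auto simp: lin_end_def)
  show 0: "T 0 = 0" using *(2)[of 0 0] by simp
  show m: "T (- v) = - T v" for v using *(1)[of v "- v"] 0 by (simp add: eq_neg_iff_add_eq_0 add.commute)
  show "T (u - v) = T u - T v" using *(1)[of u "- v"] m by simp
qed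

lemma lin_UNIV_add: "lin_end scale UNIV S \<Longrightarrow> lin_end scale UNIV T \<Longrightarrow> lin_end scale UNIV (\<lambda>v. S v + T v)"
  and lin_UNIV_comp: "lin_end scale UNIV S \<Longrightarrow> lin_end scale UNIV T \<Longrightarrow> lin_end scale UNIV (\<lambda>v. S (T v))"
  and lin_UNIV_scale: "lin_end scale UNIV S \<Longrightarrow> lin_end scale UNIV (\<lambda>v. scale c (S v))"
  and lin_UNIV_minus: "lin_end scale UNIV S \<Longrightarrow> lin_end scale UNIV (\<lambda>v. - S v)"
  and lin_UNIV_diff: "lin_end scale UNIV S \<Longrightarrow> lin_end scale UNIV T \<Longrightarrow> lin_end scale UNIV (\<lambda>v. S v - T v)"
  and lin_UNIV_id: "lin_end scale UNIV (\<lambda>v. v)"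
  by (auto simp: lin_end_def hv.scale_right_distrib hv.scale_right_diff_distrib mult.commute)

lemma lin_UNIV_funpow: "lin_end scale UNIV S \<Longrightarrow> lin_end scale UNIV (S ^^ n)"
  by (induction n) (auto simp: lin_end_def)

lemmas lin_UNIV_intros = lin_UNIV_add lin_UNIV_scale lin_UNIV_minus lin_UNIV_diff lin_UNIV_id
  op_tensor_lin

declare gen_Delta.simps [simp del] gen_B.simps [simp del]

lemma lin_UNIV_eqI:
  "(\<And>v. T v = T' v) \<Longrightarrow> lin_end scale UNIV T' \<Longrightarrow> lin_end scale UNIV T"
  by (simp add: lin_end_def)

lemma opA_lin: "lin_end scale UNIV (opA h)"
  by (rule lin_UNIV_eqI, rule opA_def, intro lin_UNIV_intros)

lemma opB_lin: "lin_end scale UNIV (opB h)"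
  by (rule lin_UNIV_eqI, rule opB_def, intro lin_UNIV_intros)

lemma opB'_lin: "lin_end scale UNIV (opB' h)"
  by (rule lin_UNIV_eqI, rule opB'_def, intro lin_UNIV_intros)

lemma gen_Delta_lin: "lin_end scale UNIV (gen_Delta h x)"
  by (cases x; simp only:; rule lin_UNIV_eqI, rule gen_Delta.simps, intro lin_UNIV_intros)

lemma gen_B_lin: "lin_end scale UNIV (gen_B h x)"
  by (cases x; simp only:; rule lin_UNIV_eqI, rule gen_B.simps, intro lin_UNIV_intros opB_lin opB'_lin)

text \<open>Linear maps on the whole type of finitely supported functions are convenient because their
  linearity needs no side condition.\<close>

lemmas gen_Delta_simps = lin_UNIV[OF gen_Delta_lin]
lemmas gen_B_simps = lin_UNIV[OF gen_B_lin]
lemmas opA_simps = lin_UNIV[OF opA_lin]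

context root_order
begin

text \<open>A square root of \<open>q\<close>.\<close>

definition r :: complex where "r = qpow h (1 / 2)"

lemma r_sq: "r * r = q"
  unfolding r_def q_def qpow_add[symmetric] by simp

lemma r_nonzero [simp]: "r \<noteq> 0" by (simp add: r_def)

lemma qpow_half: "qpow h (real n / 2) = r ^ n"
  by (induction n) (simp_all add: r_def qpow_add add_divide_distrib)

text \<open>The basis vectors are indexed by the exponents \<open>m\<close> of \<open>a\<^sup>1\<^sub>1\<close> and \<open>n = p - 1 - m\<close> of \<open>a\<^sup>1\<^sub>2\<close>;
  in these coordinates the Fock space is the square \<open>0 \<le> m, n < h\<close>.\<close>

definition ket1 :: "nat \<Rightarrow> nat \<Rightarrow> fock" where
  "ket1 m n = (if m < h \<and> n < h then Poly_Mapping.single (int (m + n + 1), int m) 1 else 0)"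

definition kt :: "nat \<Rightarrow> nat \<Rightarrow> nat \<Rightarrow> nat \<Rightarrow> hvec" where
  "kt m n m' n' = tens (ket1 m n) (ket1 m' n')"

lemma ket_eq: "p = int m + int n + 1 \<Longrightarrow> m' = int m \<Longrightarrow> ket h p m' = ket1 m n"
  by (auto simp: ket_def ket1_def fock_idx_def add_ac)

lemma ket1_zero: "h \<le> m \<or> h \<le> n \<Longrightarrow> ket1 m n = 0"
  by (auto simp: ket1_def)

lemma lin_ext_ket1:
  "lin_ext f (ket1 m n) = (if m < h \<and> n < h then f (int (m + n + 1), int m) else 0)"
  by (simp add: ket1_def lin_ext_single)

lemma zm_11: "zm h 1 1 (ket1 m n) = ket1 (Suc m) n"
proof (cases "m < h \<and> n < h")
  case True
  have "ket h (int (m + n + 1) + 1) (int m + 1) = ket1 (Suc m) n" by (rule ket_eq) simp_all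
  with True show ?thesis by (simp add: zm_def lin_ext_ket1 algebra_simps)
qed (auto simp: zm_def lin_ext_ket1 ket1_zero)

lemma zm_12: "zm h 1 2 (ket1 m n) = scale (q ^ m) (ket1 m (Suc n))"
proof (cases "m < h \<and> n < h")
  case True
  have "ket h (int (m + n + 1) + 1) (int m) = ket1 m (Suc n)" by (rule ket_eq) simp_all
  with True show ?thesis by (simp add: zm_def lin_ext_ket1 qpow_nat algebra_simps)
qed (auto simp: zm_def lin_ext_ket1 ket1_zero)

lemma qn_int: "qnum h (int n) = qn n" "qnum h 0 = 0"
  by (simp_all add: qn_def qnum_def)

lemma zm_21: "zm h 2 1 (ket1 m n) = scale (r * qn n) (ket1 m (n - 1))"
proof (cases "m < h \<and> n < h")
  case True
  then have *: "zm h 2 1 (ket1 m n) = scale (r * qn n) (ket h (int m + int n) (int m))"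
    by (simp add: zm_def r_def lin_ext_ket1 qn_int algebra_simps)
  show ?thesis
  proof (cases n)
    case (Suc k)
    have "ket h (int m + int n) (int m) = ket1 m k" by (rule ket_eq) (simp_all add: Suc)
    then show ?thesis unfolding * by (simp add: Suc)
  qed (unfold *, simp)
next
  case False
  then have "h \<le> m \<or> n = h \<or> h \<le> n - 1" by linarith
  then show ?thesis using False by (auto simp: zm_def r_def lin_ext_ket1 ket1_zero)
qed

lemma zm_22: "zm h 2 2 (ket1 m n) = scale (- (inverse (q ^ n * r) * qn m)) (ket1 (m - 1) n)"
proof (cases "m < h \<and> n < h")
  case True
  have exponent: "of_int (int m - int (m + n + 1)) + 1 / 2 = - (real n + 1 / 2)" by simp
  have swap: "qpow h (- real n - 1 / 2) = qpow h (- (1 / 2) - real n)"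
    by (rule arg_cong[of _ _ "qpow h"]) simp
  have "zm h 2 2 (ket1 m n) = scale (- qpow h (of_int (int m - int (m + n + 1)) + 1 / 2) * qnum h (int m))
      (ket h (int (m + n + 1) - 1) (int m - 1))"
    unfolding zm_def lin_ext_ket1 using True swap by simp
  then have *: "zm h 2 2 (ket1 m n) = scale (- (inverse (q ^ n * r) * qn m)) (ket h (int m + int n) (int m - 1))"
    unfolding exponent qpow_minus qpow_add qpow_nat qn_int r_def by simp
  show ?thesis
  proof (cases m)
    case (Suc k)
    have "ket h (int m + int n) (int m - 1) = ket1 k n" by (rule ket_eq) (simp_all add: Suc)
    then show ?thesis unfolding * by (simp add: Suc)
  qed (unfold *, simp)
next
  case False
  then have "h \<le> n \<or> m = h \<or> h \<le> m - 1" by linarith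
  then show ?thesis using False by (auto simp: zm_def lin_ext_ket1 ket1_zero)
qed

lemma opE_ket: "opE h (ket1 m n) = scale (qn n) (ket1 (Suc m) (n - 1))"
proof (cases "m < h \<and> n < h")
  case True
  then have *: "opE h (ket1 m n) = scale (qn n) (ket h (int m + int n + 1) (int m + 1))"
    by (simp add: opE_def lin_ext_ket1 qn_int algebra_simps)
  show ?thesis
  proof (cases n)
    case (Suc k)
    have "ket h (int m + int n + 1) (int m + 1) = ket1 (Suc m) k" by (rule ket_eq) (simp_all add: Suc)
    then show ?thesis unfolding * by (simp add: Suc)
  qed (unfold *, simp)
next
  case False
  then have "h \<le> m \<or> n = h \<or> h \<le> n - 1" by linarith
  then show ?thesis using False by (auto simp: opE_def lin_ext_ket1 ket1_zero)
qed

lemma opF_ket: "opF h (ket1 m n) = scale (qn m) (ket1 (m - 1) (Suc n))"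
proof (cases "m < h \<and> n < h")
  case True
  then have *: "opF h (ket1 m n) = scale (qn m) (ket h (int m + int n + 1) (int m - 1))"
    by (simp add: opF_def lin_ext_ket1 qn_int algebra_simps)
  show ?thesis
  proof (cases m)
    case (Suc k)
    have "ket h (int m + int n + 1) (int m - 1) = ket1 k (Suc n)" by (rule ket_eq) (simp_all add: Suc)
    then show ?thesis unfolding * by (simp add: Suc)
  qed (unfold *, simp)
next
  case False
  then have "h \<le> n \<or> m = h \<or> h \<le> m - 1" by linarith
  then show ?thesis using False by (auto simp: opF_def lin_ext_ket1 ket1_zero)
qed

lemma opEbar_ket: "opEbar h (ket1 m n) = scale (- (inverse q * qn m)) (ket1 (m - 1) (Suc n))"
proof (cases "m < h \<and> n < h")
  case True
  then have *: "opEbar h (ket1 m n) = scale (- (inverse q * qn m)) (ket h (int m + int n + 1) (int m - 1))"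
    by (simp add: opEbar_def qpow_1 lin_ext_ket1 qn_int algebra_simps)
  show ?thesis
  proof (cases m)
    case (Suc k)
    have "ket h (int m + int n + 1) (int m - 1) = ket1 k (Suc n)" by (rule ket_eq) (simp_all add: Suc)
    then show ?thesis unfolding * by (simp add: Suc)
  qed (unfold *, simp)
next
  case False
  then have "h \<le> n \<or> m = h \<or> h \<le> m - 1" by linarith
  then show ?thesis using False by (auto simp: opEbar_def qpow_1 lin_ext_ket1 ket1_zero)
qed

lemma opFbar_ket: "opFbar h (ket1 m n) = scale (- (q * qn n)) (ket1 (Suc m) (n - 1))"
proof (cases "m < h \<and> n < h")
  case True
  then have *: "opFbar h (ket1 m n) = scale (- (q * qn n)) (ket h (int m + int n + 1) (int m + 1))"
    by (simp add: opFbar_def qpow_1 lin_ext_ket1 qn_int algebra_simps)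
  show ?thesis
  proof (cases n)
    case (Suc k)
    have "ket h (int m + int n + 1) (int m + 1) = ket1 (Suc m) k" by (rule ket_eq) (simp_all add: Suc)
    then show ?thesis unfolding * by (simp add: Suc)
  qed (unfold *, simp)
next
  case False
  then have "h \<le> m \<or> n = h \<or> h \<le> n - 1" by linarith
  then show ?thesis using False by (auto simp: opFbar_def qpow_1 lin_ext_ket1 ket1_zero)
qed

lemma diag_ket:
  "qH h s (ket1 m n) = scale (qpow h (s * (real m - real n))) (ket1 m n)"
  "qHbar h s (ket1 m n) = scale (qpow h (s * (real n - real m))) (ket1 m n)"
  "qp h s (ket1 m n) = scale (qpow h (s * (real m + real n + 1))) (ket1 m n)"
proof -
  have "ket h (int (m + n + 1)) (int m) = ket1 m n" by (rule ket_eq) simp_all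
  then show "qH h s (ket1 m n) = scale (qpow h (s * (real m - real n))) (ket1 m n)"
    "qHbar h s (ket1 m n) = scale (qpow h (s * (real n - real m))) (ket1 m n)"
    "qp h s (ket1 m n) = scale (qpow h (s * (real m + real n + 1))) (ket1 m n)"
    by (auto simp: qH_def qHbar_def qp_def lin_ext_ket1 ket1_zero algebra_simps)
qed

lemma op_tensor_kt:
  assumes "S 0 = 0" "T 0 = 0"
  shows "op_tensor S T (kt m n m' n') = tens (S (ket1 m n)) (T (ket1 m' n'))"
  using assms by (auto simp: kt_def ket1_def op_tensor_def tens_single lin_ext_single)

lemma ops_0: "zm h i j 0 = 0" "zmbar h i j 0 = 0" "opE h 0 = 0" "opF h 0 = 0" "opEbar h 0 = 0" "opFbar h 0 = 0"
  "qH h s 0 = 0" "qHbar h s 0 = 0" "qp h s 0 = 0" "id (0 :: fock) = 0"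
  by (simp_all add: zm_def zmbar_def opE_def opF_def opEbar_def opFbar_def qH_def qHbar_def qp_def)

lemmas kt_expand_factors = op_tensor_kt ops_0 zmbar_def zm_11 zm_12 zm_21 zm_22 opE_ket opF_ket opEbar_ket opFbar_ket
  diag_ket tens_scale tens_scale1 id_apply hv.scale_scale simp_thms

lemma A_kt: "opA h (kt m n m' n') = scale (q * (qn n * qn n')) (kt m (n - 1) m' (n' - 1))
    + scale (inverse (q * q ^ n * q ^ n') * (qn m * qn m')) (kt (m - 1) n (m' - 1) n')"
proof -
  have "opA h (kt m n m' n') = scale (r * qn n * (r * qn n')) (kt m (n - 1) m' (n' - 1))
      + scale (- (inverse (q ^ n * r) * qn m) * - (inverse (q ^ n' * r) * qn m')) (kt (m - 1) n (m' - 1) n')"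
    unfolding opA_def by (simp only: kt_expand_factors) (simp only: kt_def mult_ac)
  also have "r * qn n * (r * qn n') = q * (qn n * qn n')"
    by (simp add: r_sq[symmetric])
  also have "- (inverse (q ^ n * r) * qn m) * - (inverse (q ^ n' * r) * qn m')
      = inverse (q * q ^ n * q ^ n') * (qn m * qn m')"
    by (simp add: r_sq[symmetric] del: power_mult_distrib)
  finally show ?thesis .
qed

lemma B_kt: "gen_B h GE (kt m n m' n') = scale (r * qn n') (kt (Suc m) n m' (n' - 1))
    - scale (q ^ m * inverse (q ^ n' * r) * qn m') (kt m (Suc n) (m' - 1) n')"
proof -
  have "gen_B h GE (kt m n m' n') = scale (r * qn n') (kt (Suc m) n m' (n' - 1))
      + scale (q ^ m * - (inverse (q ^ n' * r) * qn m')) (kt m (Suc n) (m' - 1) n')"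
    unfolding gen_B.simps opB_def by (simp only: kt_expand_factors) (simp only: kt_def mult_ac)
  then show ?thesis by (simp add: mult.assoc)
qed

lemma B'_kt: "gen_B h GF (kt m n m' n') = scale (q ^ m' * inverse (q ^ n * r) * qn m) (kt (m - 1) n m' (Suc n'))
    - scale (r * qn n) (kt m (n - 1) (Suc m') n')"
proof -
  have "gen_B h GF (kt m n m' n') = - (scale (r * qn n) (kt m (n - 1) (Suc m') n')
      + scale (- (inverse (q ^ n * r) * qn m) * q ^ m') (kt (m - 1) n m' (Suc n')))"
    unfolding gen_B.simps opB'_def by (simp only: kt_expand_factors) (simp only: kt_def mult_ac)
  then show ?thesis by (simp add: mult_ac)
qed

lemma E_kt: "gen_Delta h GE (kt m n m' n') = scale (qn n) (kt (Suc m) (n - 1) m' n')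
    - scale (q ^ m * inverse (q ^ n * q) * qn m') (kt m n (m' - 1) (Suc n'))"
proof -
  have e: "qpow h (1 * (real m - real n)) = q ^ m * inverse (q ^ n)"
    by (simp add: qpow_diff qpow_nat divide_inverse)
  have "gen_Delta h GE (kt m n m' n') = scale (qn n) (kt (Suc m) (n - 1) m' n')
      + scale (qpow h (1 * (real m - real n)) * - (inverse q * qn m')) (kt m n (m' - 1) (Suc n'))"
    unfolding gen_Delta.simps by (simp only: kt_expand_factors) (simp only: kt_def mult_ac)
  then show ?thesis unfolding e by (simp add: mult_ac)
qed

lemma F_kt: "gen_Delta h GF (kt m n m' n') = scale (q ^ m' * inverse (q ^ n') * qn m) (kt (m - 1) (Suc n) m' n')
    - scale (q * qn n') (kt m n (Suc m') (n' - 1))"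
proof -
  have e: "qpow h (- 1 * (real n' - real m')) = q ^ m' * inverse (q ^ n')"
    by (simp add: qpow_diff qpow_nat divide_inverse)
  have "gen_Delta h GF (kt m n m' n') = scale (qn m * qpow h (- 1 * (real n' - real m'))) (kt (m - 1) (Suc n) m' n')
      + scale (- (q * qn n')) (kt m n (Suc m') (n' - 1))"
    unfolding gen_Delta.simps by (simp only: kt_expand_factors) (simp only: kt_def mult_ac)
  then show ?thesis unfolding e by (simp add: mult_ac)
qed

lemma qpow_half_diff: "qpow h (1 / 2 * (real m - real n)) = r ^ m / r ^ n"
  "qpow h (- 1 / 2 * (real m - real n)) = r ^ n / r ^ m"
proof -
  have "1 / 2 * (real m - real n) = real m / 2 - real n / 2"
    "- 1 / 2 * (real m - real n) = real n / 2 - real m / 2" by (simp_all add: field_simps)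
  then show "qpow h (1 / 2 * (real m - real n)) = r ^ m / r ^ n"
    "qpow h (- 1 / 2 * (real m - real n)) = r ^ n / r ^ m"
    by (simp_all only: qpow_diff qpow_half)
qed

lemma qpow_half_sum: "qpow h (1 / 2 * (real m + real n + 1)) = r * (r ^ m * r ^ n)"
  "qpow h (- 1 / 2 * (real m + real n + 1)) = inverse (r * (r ^ m * r ^ n))"
proof -
  have "1 / 2 * (real m + real n + 1) = 1 / 2 + (real m / 2 + real n / 2)"
    "- 1 / 2 * (real m + real n + 1) = - (1 / 2 + (real m / 2 + real n / 2))" by (simp_all add: field_simps)
  then show "qpow h (1 / 2 * (real m + real n + 1)) = r * (r ^ m * r ^ n)"
    "qpow h (- 1 / 2 * (real m + real n + 1)) = inverse (r * (r ^ m * r ^ n))"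
    by (simp_all only: qpow_minus qpow_add qpow_half) (simp_all only: r_def)
qed

lemma K_Delta_kt:
  "gen_Delta h Khalf (kt m n m' n') = scale (r ^ m * r ^ n' / (r ^ n * r ^ m')) (kt m n m' n')"
  "gen_Delta h Kinvhalf (kt m n m' n') = scale (r ^ n * r ^ m' / (r ^ m * r ^ n')) (kt m n m' n')"
proof -
  have "gen_Delta h Khalf (kt m n m' n') = scale (r ^ m / r ^ n * (r ^ n' / r ^ m')) (kt m n m' n')"
    "gen_Delta h Kinvhalf (kt m n m' n') = scale (r ^ n / r ^ m * (r ^ m' / r ^ n')) (kt m n m' n')"
    unfolding gen_Delta.simps by (simp_all only: kt_expand_factors qpow_half_diff) (simp_all only: kt_def mult_ac)
  then show "gen_Delta h Khalf (kt m n m' n') = scale (r ^ m * r ^ n' / (r ^ n * r ^ m')) (kt m n m' n')"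
    "gen_Delta h Kinvhalf (kt m n m' n') = scale (r ^ n * r ^ m' / (r ^ m * r ^ n')) (kt m n m' n')"
    by simp_all
qed

lemma K_B_kt:
  "gen_B h Khalf (kt m n m' n') = scale (r ^ m * r ^ n / (r ^ m' * r ^ n')) (kt m n m' n')"
  "gen_B h Kinvhalf (kt m n m' n') = scale (r ^ m' * r ^ n' / (r ^ m * r ^ n)) (kt m n m' n')"
proof -
  have "gen_B h Khalf (kt m n m' n')
      = scale (r * (r ^ m * r ^ n) * inverse (r * (r ^ m' * r ^ n'))) (kt m n m' n')"
    "gen_B h Kinvhalf (kt m n m' n')
      = scale (inverse (r * (r ^ m * r ^ n)) * (r * (r ^ m' * r ^ n'))) (kt m n m' n')"
    unfolding gen_B.simps by (simp_all only: kt_expand_factors qpow_half_sum) (simp_all only: kt_def mult_ac)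
  then show "gen_B h Khalf (kt m n m' n') = scale (r ^ m * r ^ n / (r ^ m' * r ^ n')) (kt m n m' n')"
    "gen_B h Kinvhalf (kt m n m' n') = scale (r ^ m' * r ^ n' / (r ^ m * r ^ n)) (kt m n m' n')"
    by (simp_all add: divide_inverse mult_ac)
qed

abbreviation "Hc \<equiv> carrier (Hspace h)"

lemma Hc_eq: "Hc = {v. Poly_Mapping.keys v \<subseteq> fock_idx h \<times> fock_idx h}"
  by (simp add: Hspace_def free_space_def)

lemma fock_idxE:
  assumes "x \<in> fock_idx h"
  obtains m n where "m < h" "n < h" "x = (int (m + n + 1), int m)"
proof -
  obtain p m where x: "x = (p, m)" by (cases x)
  have "x = (int (nat m + nat (p - 1 - m) + 1), int (nat m))" "nat m < h" "nat (p - 1 - m) < h"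
    using assms by (auto simp: x fock_idx_def)
  then show ?thesis using that by blast
qed

lemma kt_single:
  "m < h \<Longrightarrow> n < h \<Longrightarrow> m' < h \<Longrightarrow> n' < h \<Longrightarrow>
    kt m n m' n' = Poly_Mapping.single ((int (m + n + 1), int m), (int (m' + n' + 1), int m')) 1"
  by (simp add: kt_def ket1_def tens_single)

lemma kt_zero: "\<not> (m < h \<and> n < h \<and> m' < h \<and> n' < h) \<Longrightarrow> kt m n m' n' = 0"
  by (auto simp: kt_def ket1_def)

lemma kt_in_Hc: "kt m n m' n' \<in> Hc"
  by (cases "m < h \<and> n < h \<and> m' < h \<and> n' < h")
     (auto simp: kt_single kt_zero Hc_eq fock_idx_def)

lemma subspace_Hc: "subspace_of scale Hc"
  by unfold_locales (use subset_trans[OF keys_add Un_least] subset_trans[OF keys_scale] in \<open>simp_all add: Hc_eq\<close>)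

sublocale Hc: subspace_of scale Hc
  by (rule subspace_Hc)

lemma basis_kt:
  assumes "v \<in> Hc" "x \<in> Poly_Mapping.keys v"
  obtains m n m' n' where "m < h" "n < h" "m' < h" "n' < h" "Poly_Mapping.single x 1 = kt m n m' n'"
proof -
  obtain a b where x: "x = (a, b)" by (cases x)
  with assms have "a \<in> fock_idx h" "b \<in> fock_idx h" by (auto simp: Hc_eq)
  then show ?thesis using that by (elim fock_idxE) (auto simp: x kt_single)
qed

lemma linear_lin_comb_UNIV: "lin_end scale UNIV T \<Longrightarrow> T v = lin_comb scale (\<lambda>x. T (Poly_Mapping.single x 1)) v"
proof -
  assume T: "lin_end scale UNIV T"
  interpret subspace_of scale "UNIV :: ('a \<Rightarrow>\<^sub>0 complex) set"
    by unfold_locales auto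
  have "T (lin_comb scale (\<lambda>x. Poly_Mapping.single x 1) v) = lin_comb scale (\<lambda>x. T (Poly_Mapping.single x 1)) v"
    by (rule linear_lin_comb[OF hv.vector_space_axioms]) (simp_all add: lin_UNIV[OF T])
  then show ?thesis by (simp add: lin_comb_id)
qed

text \<open>Identities between operators are checked on basis vectors.\<close>

lemma Hc_ext:
  assumes T: "lin_end scale UNIV T" "lin_end scale UNIV T'"
    and eq: "\<And>m n m' n'. m < h \<Longrightarrow> n < h \<Longrightarrow> m' < h \<Longrightarrow> n' < h \<Longrightarrow> T (kt m n m' n') = T' (kt m n m' n')"
    and v: "v \<in> Hc"
  shows "T v = T' v"
proof -
  have "T (Poly_Mapping.single x 1) = T' (Poly_Mapping.single x 1)" if "x \<in> Poly_Mapping.keys v" for x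
    using basis_kt[OF v that] eq by metis
  then show ?thesis
    unfolding linear_lin_comb_UNIV[OF T(1), of v] linear_lin_comb_UNIV[OF T(2), of v]
    by (rule lin_comb_cong)
qed

lemma Hc_closed:
  assumes T: "lin_end scale UNIV T" and closed: "\<And>m n m' n'. T (kt m n m' n') \<in> Hc"
  shows "lin_end scale Hc T"
proof (rule lin_endI)
  fix v assume v: "v \<in> Hc"
  have "T (Poly_Mapping.single x 1) \<in> Hc" if "x \<in> Poly_Mapping.keys v" for x
    using basis_kt[OF v that] closed by metis
  then show "T v \<in> Hc"
    unfolding linear_lin_comb_UNIV[OF T, of v] by (rule Hc.lin_comb_closed)
qed (simp_all add: lin_UNIV[OF T])

lemma Hc_diff: "u \<in> Hc \<Longrightarrow> v \<in> Hc \<Longrightarrow> u - v \<in> Hc"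
  using Hc.S_add[of u "scale (-1) v"] Hc.S_scale[of v "-1"] by simp

lemma opA_Hc: "lin_end scale Hc (opA h)"
  by (rule Hc_closed[OF opA_lin]) (simp add: A_kt Hc.S_add Hc.S_scale kt_in_Hc)

lemma gen_Delta_Hc: "lin_end scale Hc (gen_Delta h x)"
  by (rule Hc_closed[OF gen_Delta_lin])
     (cases x; simp add: E_kt F_kt K_Delta_kt Hc_diff Hc.S_scale kt_in_Hc)

lemma gen_B_Hc: "lin_end scale Hc (gen_B h x)"
  by (rule Hc_closed[OF gen_B_lin])
     (cases x; simp add: B_kt B'_kt K_B_kt Hc_diff Hc.S_scale kt_in_Hc)

end

section \<open>The two actions of the quantum algebra\<close>

context root_order
begin
definition "w = inverse (q - inverse q)"
lemma qn_w: "qn n = w * (q ^ n - inverse (q ^ n))"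
  by (simp add: qn_eq w_def divide_inverse mult.commute)
lemma r_inv: "inverse r = r * inverse q" using r_sq by (simp add: field_simps)

lemma B_kt': "gen_B h GE (kt m n m' n') = scale (r * qn n') (kt (Suc m) n m' (n' - 1))
    + scale (- (r * q ^ m * inverse (q ^ n' * q) * qn m')) (kt m (Suc n) (m' - 1) n')"
  and B'_kt': "gen_B h GF (kt m n m' n') = scale (r * q ^ m' * inverse (q ^ n * q) * qn m) (kt (m - 1) n m' (Suc n'))
    + scale (- (r * qn n)) (kt m (n - 1) (Suc m') n')"
  and E_kt': "gen_Delta h GE (kt m n m' n') = scale (qn n) (kt (Suc m) (n - 1) m' n')
    + scale (- (q ^ m * inverse (q ^ n * q) * qn m')) (kt m n (m' - 1) (Suc n'))"
  and F_kt': "gen_Delta h GF (kt m n m' n') = scale (q ^ m' * inverse (q ^ n') * qn m) (kt (m - 1) (Suc n) m' n')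
    + scale (- (q * qn n')) (kt m n (Suc m') (n' - 1))"
  by (simp_all add: B_kt B'_kt E_kt F_kt r_inv mult_ac)

text \<open>The commutation relations compare two sums of four multiples of basis vectors. The next lemmas
  match the terms for the patterns that occur: the coefficients of a repeated basis vector are
  added, and the other terms agree in pairs. A premise such as \<open>scale b kb = scale b
  K\<close> covers the boundary of the Fock space, where \<open>kb\<close> and \<open>K\<close>
  may differ but the coefficient is 0.\<close>

lemma four_terms_eq_inner:
  assumes "scale b kb = scale b K" "scale c kc = scale c K" "scale b' kb' = scale b' K" "scale c' kc' = scale c' K"
    "scale a ka = scale a' ka'" "scale d kd = scale d' kd'" "b + c = b' + c'"
  shows "scale a ka + scale b kb + (scale c kc + scale d kd) = scale a' ka' + scale b' kb' + (scale c' kc' + scale d' kd')"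
proof -
  have "scale b kb + scale c kc = scale b' kb' + scale c' kc'"
    unfolding assms(1-4) hv.scale_left_distrib[symmetric] assms(7) ..
  then show ?thesis unfolding assms(5,6) by (simp add: add.assoc)
qed

lemma four_terms_eq_outer:
  assumes "scale a ka = scale a K" "scale d kd = scale d K" "scale a' ka' = scale a' K" "scale d' kd' = scale d' K"
    "scale b kb = scale c' kc'" "scale c kc = scale b' kb'" "a + d = a' + d'"
  shows "scale a ka + scale b kb + (scale c kc + scale d kd) = scale a' ka' + scale b' kb' + (scale c' kc' + scale d' kd')"
proof -
  have "scale a ka + scale d kd = scale a' ka' + scale d' kd'"
    unfolding assms(1-4) hv.scale_left_distrib[symmetric] assms(7) ..
  then show ?thesis unfolding assms(5,6) by (simp add: algebra_simps)
qed

lemmas kt_expand = A_kt E_kt' B_kt' B'_kt' F_kt' gen_Delta_simps gen_B_simps opA_simps hv.scale_right_distrib hv.scale_scale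

lemma E_B_comm_kt: "gen_Delta h GE (gen_B h GE (kt m n m' n')) = gen_B h GE (gen_Delta h GE (kt m n m' n'))"
  by (simp only: kt_expand, rule four_terms_eq_inner[where K = "kt (Suc m) n (m' - 1) n'"];
      (cases m; cases n; cases m'; cases n'; simp add: mult_ac; fail)?;
      (simp add: qn_w field_simps)?)

lemma E_B'_comm_kt: "gen_Delta h GE (gen_B h GF (kt m n m' n')) = gen_B h GF (gen_Delta h GE (kt m n m' n'))"
  by (simp only: kt_expand, rule four_terms_eq_outer[where K = "kt m (n - 1) m' (Suc n')"];
      (cases m; cases n; cases m'; cases n'; simp add: mult_ac; fail)?;
      (cases n; cases m'; simp add: qn_w field_simps)?)

lemma F_B_comm_kt: "gen_Delta h GF (gen_B h GE (kt m n m' n')) = gen_B h GE (gen_Delta h GF (kt m n m' n'))"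
  by (simp only: kt_expand, rule four_terms_eq_outer[where K = "kt m (Suc n) m' (n' - 1)"];
      (cases m; cases n; cases m'; cases n'; simp add: mult_ac; fail)?;
      (cases n'; cases m; simp add: qn_w field_simps)?)

lemma F_B'_comm_kt: "gen_Delta h GF (gen_B h GF (kt m n m' n')) = gen_B h GF (gen_Delta h GF (kt m n m' n'))"
  by (simp only: kt_expand, rule four_terms_eq_inner[where K = "kt (m - 1) n (Suc m') n'"];
      (cases m; cases n; cases m'; cases n'; simp add: mult_ac; fail)?;
      (simp add: qn_w field_simps)?)

lemma E_A_comm_kt: "gen_Delta h GE (opA h (kt m n m' n')) = opA h (gen_Delta h GE (kt m n m' n'))"
  by (simp only: kt_expand, rule four_terms_eq_inner[where K = "kt m (n - 1) (m' - 1) n'"];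
      (cases m; cases n; cases m'; cases n'; simp add: mult_ac; fail)?;
      (cases n; simp add: qn_w field_simps)?)

lemma F_A_comm_kt: "gen_Delta h GF (opA h (kt m n m' n')) = opA h (gen_Delta h GF (kt m n m' n'))"
  by (simp only: kt_expand, rule four_terms_eq_outer[where K = "kt (m - 1) n m' (n' - 1)"];
      (cases m; cases n; cases m'; cases n'; simp add: mult_ac; fail)?;
      (cases n'; cases m'; simp add: qn_w field_simps)?)

lemma B_A_comm_kt: "gen_B h GE (opA h (kt m n m' n')) = opA h (gen_B h GE (kt m n m' n'))"
  by (simp only: kt_expand, rule four_terms_eq_inner[where K = "kt m n (m' - 1) (n' - 1)"];
      (cases m; cases n; cases m'; cases n'; simp add: mult_ac; fail)?;
      (cases m; cases n'; cases m'; simp add: qn_w field_simps)?)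

lemma B'_A_comm_kt: "gen_B h GF (opA h (kt m n m' n')) = opA h (gen_B h GF (kt m n m' n'))"
  by (simp only: kt_expand, rule four_terms_eq_outer[where K = "kt (m - 1) (n - 1) m' n'"];
      (cases m; cases n; cases m'; cases n'; simp add: mult_ac; fail)?;
      (cases n; cases m'; cases m; simp add: qn_w field_simps)?)


text \<open>The pattern of the relation \<open>[E, F] = (K - K\<^bsup>-1\<^esup>)/(q -
  q\<^bsup>-1\<^esup>)\<close>, with the Cartan term \<open>e\<close>.\<close>

lemma four_terms_eq_cartan:
  assumes "scale a ka = scale a K" "scale d kd = scale d K" "scale a' ka' = scale a' K" "scale d' kd' = scale d' K"
    "scale b kb = scale c' kc'" "scale c kc = scale b' kb'" "a + d = a' + d' + e"
  shows "scale a ka + scale b kb + (scale c kc + scale d kd)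
    = scale a' ka' + scale b' kb' + (scale c' kc' + scale d' kd') + scale e K"
proof -
  have "scale a ka + scale d kd = scale a' ka' + scale d' kd' + scale e K"
    unfolding assms(1-4) hv.scale_left_distrib[symmetric] assms(7) ..
  then show ?thesis unfolding assms(5,6) by (simp add: algebra_simps)
qed

lemma w_sq: "w * w * (q - inverse q) = w"
  using q_sq_ne by (simp add: w_def)

lemma EF_kt: "gen_Delta h GE (gen_Delta h GF (kt m n m' n')) = gen_Delta h GF (gen_Delta h GE (kt m n m' n'))
    + scale (w * w * (q - inverse q) * (q ^ m * q ^ n' / (q ^ n * q ^ m') - q ^ n * q ^ m' / (q ^ m * q ^ n'))) (kt m n m' n')"
  by (simp only: kt_expand, rule four_terms_eq_cartan[where K = "kt m n m' n'"];
      (cases m; cases n; cases m'; cases n'; simp add: mult_ac; fail)?;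
      (simp add: qn_w field_simps)?)

lemma r_sq': "r * (r * x) = q * x"
  using r_sq by (simp add: mult.assoc[symmetric])

lemma BB'_kt: "gen_B h GE (gen_B h GF (kt m n m' n')) = gen_B h GF (gen_B h GE (kt m n m' n'))
    + scale (w * w * (q - inverse q) * (q ^ m * q ^ n / (q ^ m' * q ^ n') - q ^ m' * q ^ n' / (q ^ m * q ^ n))) (kt m n m' n')"
  by (simp only: kt_expand, rule four_terms_eq_cartan[where K = "kt m n m' n'"];
      (cases m; cases n; cases m'; cases n'; simp add: mult_ac; fail)?;
      (simp add: qn_w field_simps r_sq r_sq')?)

subsection \<open>Nilpotency\<close>

text \<open>Each of the operators \<open>E\<close>, \<open>F\<close>, \<open>B\<close>, \<open>B'\<close>, \<open>A\<close> is a sum of two \<open>q\<^sup>2\<close>-commuting weighted shifts,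
  each of which lowers one of the four exponents.\<close>

abbreviation "Kt \<equiv> \<lambda>(m, n, m', n'). kt m n m' n'"

lemma shift_nilpotent:
  assumes X: "lin_end scale UNIV X" and shift: "\<And>x. X (Kt x) = scale (c x) (Kt (s x))"
    and z: "\<And>x. z x = 0 \<Longrightarrow> c x = 0" "\<And>x. z x \<noteq> 0 \<Longrightarrow> z (s x) < (z x :: nat)"
  shows "z x < j \<Longrightarrow> (X ^^ j) (Kt x) = 0"
proof (induction j arbitrary: x)
  case (Suc j)
  have 0: "(X ^^ j) 0 = 0" by (rule lin_UNIV(3)[OF lin_UNIV_funpow[OF X]])
  have "(X ^^ Suc j) (Kt x) = scale (c x) ((X ^^ j) (Kt (s x)))"
    by (simp only: funpow_Suc_right o_apply shift lin_UNIV(2)[OF lin_UNIV_funpow[OF X]])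
  also have "\<dots> = 0"
    using z[of x] Suc by (cases "z x = 0") auto
  finally show ?case .
qed simp

lemma shift_Hc:
  assumes "lin_end scale UNIV X" and shift: "\<And>x. X (Kt x) = scale (c x) (Kt (s x))"
  shows "lin_end scale Hc X"
proof (rule Hc_closed[OF assms(1)])
  fix m n m' n'
  show "X (kt m n m' n') \<in> Hc"
    using shift[of "(m, n, m', n')"] by (cases "s (m, n, m', n')") (simp add: Hc.S_scale kt_in_Hc)
qed

text \<open>By the \<open>q\<close>-binomial theorem the power is \<open>X\<^sup>h + Y\<^sup>h\<close>, and
  each summand lowers a number below \<open>h\<close> in every step.\<close>

lemma sum_of_shifts_nilpotent:
  assumes X: "lin_end scale UNIV X" and Y: "lin_end scale UNIV Y"
    and TXY: "\<And>v. T v = X v + Y v"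
    and shift: "\<And>x. X (Kt x) = scale (c x) (Kt (s x))" "\<And>x. Y (Kt x) = scale (d x) (Kt (t x))"
    and z: "\<And>x. z x = 0 \<Longrightarrow> c x = 0" "\<And>x. z x \<noteq> 0 \<Longrightarrow> z (s x) < (z x :: nat)"
    and y: "\<And>x. y x = 0 \<Longrightarrow> d x = 0" "\<And>x. y x \<noteq> 0 \<Longrightarrow> y (t x) < (y x :: nat)"
    and zy: "\<And>m n m' n'. m < h \<Longrightarrow> n < h \<Longrightarrow> m' < h \<Longrightarrow> n' < h \<Longrightarrow> z (m, n, m', n') < h \<and> y (m, n, m', n') < h"
    and st: "\<And>x. s (t x) = t (s x)" and cd: "\<And>x. d x * c (t x) = q ^ 2 * (c x * d (s x))"
    and v: "v \<in> Hc"
  shows "(T ^^ h) v = 0"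
proof -
  have T: "T = (\<lambda>v. X v + Y v)" using TXY by blast
  note X = X shift_Hc[OF X shift(1)] and Y = Y shift_Hc[OF Y shift(2)]
  have comm: "X (Y (Kt x)) = scale (q ^ 2) (Y (X (Kt x)))" for x
    by (simp only: shift lin_UNIV(2)[OF X(1)] lin_UNIV(2)[OF Y(1)] hv.scale_scale st cd)
  have "X (Y v) = scale (q ^ 2) (Y (X v))" if "v \<in> Hc" for v
    by (rule Hc_ext[OF lin_UNIV_comp[OF X(1) Y(1)] lin_UNIV_scale[OF lin_UNIV_comp[OF Y(1) X(1)]] _ that])
       (use comm[of "(_, _, _, _)"] in simp)
  then have "(T ^^ h) v = (X ^^ h) v + (Y ^^ h) v"
    unfolding T by (rule q_binomial_root[OF subspace_Hc X(2) Y(2) _ v])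
  also have "(X ^^ h) v = 0"
    by (rule Hc_ext[OF lin_UNIV_funpow[OF X(1)] _ _ v, where T' = "\<lambda>_. 0"])
       (use shift_nilpotent[where X = X and c = c and s = s and z = z, OF X(1) shift(1) z, of "(_, _, _, _)" h] zy in \<open>auto simp: lin_end_def\<close>)
  also have "(Y ^^ h) v = 0"
    by (rule Hc_ext[OF lin_UNIV_funpow[OF Y(1)] _ _ v, where T' = "\<lambda>_. 0"])
       (use shift_nilpotent[where X = Y and c = d and s = t and z = y, OF Y(1) shift(2) y, of "(_, _, _, _)" h] zy in \<open>auto simp: lin_end_def\<close>)
  finally show ?thesis by simp
qed


lemma exponents: "qpow h (real m - real n) = q ^ m * inverse (q ^ n)"
  "qpow h (1 * (real m - real n)) = q ^ m * inverse (q ^ n)"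
  "qpow h (- 1 * (real n - real m)) = q ^ m * inverse (q ^ n)"
  by (simp_all add: qpow_diff qpow_nat divide_inverse)

lemma opA_nilpotent: "v \<in> Hc \<Longrightarrow> (opA h ^^ h) v = 0"
proof -
  let ?X = "\<lambda>v. op_tensor (zm h 2 2) (zmbar h 2 2) v" and ?Y = "\<lambda>v. op_tensor (zm h 2 1) (zmbar h 1 2) v"
  let ?c = "\<lambda>(m, n, m', n'). inverse (q * q ^ n * q ^ n') * (qn m * qn m')"
  let ?d = "\<lambda>(m, n, m', n'). q * (qn n * qn n')"
  let ?s = "\<lambda>(m, n, m', n'). (m - 1, n, m' - 1, n')" and ?t = "\<lambda>(m, n, m', n'). (m, n - 1, m', n' - 1)"
  have X: "?X (Kt x) = scale (?c x) (Kt (?s x))" and Y: "?Y (Kt x) = scale (?d x) (Kt (?t x))" for x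
    by (cases x; simp only: prod.case kt_expand_factors; simp add: kt_def exponents r_inv r_sq r_sq' mult_ac)+
  have cd: "?d x * ?c (?t x) = q ^ 2 * (?c x * ?d (?s x))" for x
  proof -
    obtain m n m' n' where x: "x = (m, n, m', n')" by (cases x rule: prod_cases4)
    show ?thesis unfolding x prod.case
      by (cases n; cases n'; simp add: power2_eq_square field_simps)
  qed
  assume v: "v \<in> Hc"
  show ?thesis
    by (rule sum_of_shifts_nilpotent[where X = ?X and Y = ?Y and c = ?c and d = ?d and s = ?s and t = ?t
          and z = "\<lambda>(m, n, m', n'). m" and y = "\<lambda>(m, n, m', n'). n", OF _ _ _ X Y _ _ _ _ _ _ cd v])
       (auto simp: opA_def add.commute intro!: lin_UNIV_minus op_tensor_lin)
qed

lemma E_nilpotent: "v \<in> Hc \<Longrightarrow> (gen_Delta h GE ^^ h) v = 0"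
proof -
  let ?X = "\<lambda>v. op_tensor (qH h 1) (opEbar h) v" and ?Y = "\<lambda>v. op_tensor (opE h) (id) v"
  let ?c = "\<lambda>(m, n, m', n'). - (q ^ m * inverse (q ^ n * q) * qn m')"
  let ?d = "\<lambda>(m, n, m', n'). qn n"
  let ?s = "\<lambda>(m, n, m', n'). (m, n, m' - 1, Suc n')" and ?t = "\<lambda>(m, n, m', n'). (Suc m, n - 1, m', n')"
  have X: "?X (Kt x) = scale (?c x) (Kt (?s x))" and Y: "?Y (Kt x) = scale (?d x) (Kt (?t x))" for x
    by (cases x; simp only: prod.case kt_expand_factors; simp add: kt_def exponents r_inv r_sq r_sq' mult_ac)+
  have cd: "?d x * ?c (?t x) = q ^ 2 * (?c x * ?d (?s x))" for x
  proof -
    obtain m n m' n' where x: "x = (m, n, m', n')" by (cases x rule: prod_cases4)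
    show ?thesis unfolding x prod.case
      by (cases n; cases n'; simp add: power2_eq_square field_simps)
  qed
  assume v: "v \<in> Hc"
  show ?thesis
    by (rule sum_of_shifts_nilpotent[where X = ?X and Y = ?Y and c = ?c and d = ?d and s = ?s and t = ?t
          and z = "\<lambda>(m, n, m', n'). m'" and y = "\<lambda>(m, n, m', n'). n", OF _ _ _ X Y _ _ _ _ _ _ cd v])
       (auto simp: gen_Delta.simps add.commute intro!: lin_UNIV_minus op_tensor_lin)
qed

lemma F_nilpotent: "v \<in> Hc \<Longrightarrow> (gen_Delta h GF ^^ h) v = 0"
proof -
  let ?X = "\<lambda>v. op_tensor (opF h) (qHbar h (- 1)) v" and ?Y = "\<lambda>v. op_tensor (id) (opFbar h) v"
  let ?c = "\<lambda>(m, n, m', n'). q ^ m' * inverse (q ^ n') * qn m"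
  let ?d = "\<lambda>(m, n, m', n'). - (q * qn n')"
  let ?s = "\<lambda>(m, n, m', n'). (m - 1, Suc n, m', n')" and ?t = "\<lambda>(m, n, m', n'). (m, n, Suc m', n' - 1)"
  have X: "?X (Kt x) = scale (?c x) (Kt (?s x))" and Y: "?Y (Kt x) = scale (?d x) (Kt (?t x))" for x
    by (cases x; simp only: prod.case kt_expand_factors; simp add: kt_def exponents r_inv r_sq r_sq' mult_ac)+
  have cd: "?d x * ?c (?t x) = q ^ 2 * (?c x * ?d (?s x))" for x
  proof -
    obtain m n m' n' where x: "x = (m, n, m', n')" by (cases x rule: prod_cases4)
    show ?thesis unfolding x prod.case
      by (cases n; cases n'; simp add: power2_eq_square field_simps)
  qed
  assume v: "v \<in> Hc"
  show ?thesis
    by (rule sum_of_shifts_nilpotent[where X = ?X and Y = ?Y and c = ?c and d = ?d and s = ?s and t = ?t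
          and z = "\<lambda>(m, n, m', n'). m" and y = "\<lambda>(m, n, m', n'). n'", OF _ _ _ X Y _ _ _ _ _ _ cd v])
       (auto simp: gen_Delta.simps add.commute intro!: lin_UNIV_minus op_tensor_lin)
qed

lemma B_nilpotent: "v \<in> Hc \<Longrightarrow> (gen_B h GE ^^ h) v = 0"
proof -
  let ?X = "\<lambda>v. op_tensor (zm h 1 2) (zmbar h 2 2) v" and ?Y = "\<lambda>v. op_tensor (zm h 1 1) (zmbar h 1 2) v"
  let ?c = "\<lambda>(m, n, m', n'). - (r * q ^ m * inverse (q ^ n' * q) * qn m')"
  let ?d = "\<lambda>(m, n, m', n'). r * qn n'"
  let ?s = "\<lambda>(m, n, m', n'). (m, Suc n, m' - 1, n')" and ?t = "\<lambda>(m, n, m', n'). (Suc m, n, m', n' - 1)"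
  have X: "?X (Kt x) = scale (?c x) (Kt (?s x))" and Y: "?Y (Kt x) = scale (?d x) (Kt (?t x))" for x
    by (cases x; simp only: prod.case kt_expand_factors; simp add: kt_def exponents r_inv r_sq r_sq' mult_ac)+
  have cd: "?d x * ?c (?t x) = q ^ 2 * (?c x * ?d (?s x))" for x
  proof -
    obtain m n m' n' where x: "x = (m, n, m', n')" by (cases x rule: prod_cases4)
    show ?thesis unfolding x prod.case
      by (cases n; cases n'; simp add: power2_eq_square field_simps)
  qed
  assume v: "v \<in> Hc"
  show ?thesis
    by (rule sum_of_shifts_nilpotent[where X = ?X and Y = ?Y and c = ?c and d = ?d and s = ?s and t = ?t
          and z = "\<lambda>(m, n, m', n'). m'" and y = "\<lambda>(m, n, m', n'). n'", OF _ _ _ X Y _ _ _ _ _ _ cd v])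
       (auto simp: gen_B.simps opB_def add.commute intro!: lin_UNIV_minus op_tensor_lin)
qed

lemma B'_nilpotent: "v \<in> Hc \<Longrightarrow> (gen_B h GF ^^ h) v = 0"
proof -
  let ?X = "\<lambda>v. - op_tensor (zm h 2 2) (zmbar h 2 1) v" and ?Y = "\<lambda>v. - op_tensor (zm h 2 1) (zmbar h 1 1) v"
  let ?c = "\<lambda>(m, n, m', n'). r * q ^ m' * inverse (q ^ n * q) * qn m"
  let ?d = "\<lambda>(m, n, m', n'). - (r * qn n)"
  let ?s = "\<lambda>(m, n, m', n'). (m - 1, n, m', Suc n')" and ?t = "\<lambda>(m, n, m', n'). (m, n - 1, Suc m', n')"
  have X: "?X (Kt x) = scale (?c x) (Kt (?s x))" and Y: "?Y (Kt x) = scale (?d x) (Kt (?t x))" for x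
    by (cases x; simp only: prod.case kt_expand_factors; simp add: kt_def exponents r_inv r_sq r_sq' mult_ac)+
  have cd: "?d x * ?c (?t x) = q ^ 2 * (?c x * ?d (?s x))" for x
  proof -
    obtain m n m' n' where x: "x = (m, n, m', n')" by (cases x rule: prod_cases4)
    show ?thesis unfolding x prod.case
      by (cases n; cases n'; simp add: power2_eq_square field_simps)
  qed
  assume v: "v \<in> Hc"
  show ?thesis
    by (rule sum_of_shifts_nilpotent[where X = ?X and Y = ?Y and c = ?c and d = ?d and s = ?s and t = ?t
          and z = "\<lambda>(m, n, m', n'). m" and y = "\<lambda>(m, n, m', n'). n", OF _ _ _ X Y _ _ _ _ _ _ cd v])
       (auto simp: gen_B.simps opB'_def add.commute intro!: lin_UNIV_minus op_tensor_lin)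
qed


lemma two_terms_eq: "scale a k = scale a' k' \<Longrightarrow> scale b l = scale b' l' \<Longrightarrow> scale a k + scale b l = scale a' k' + scale b' l'"
  by simp

text \<open>As \<open>r\<^sup>2 = q\<close> and \<open>q\<^sup>h = -1\<close>, the number \<open>r\<close> is
  a root of unity of order \<open>4h\<close>; this is the relation for
  \<open>K\<^bsup>1/2\<^esup>\<close>.\<close>

lemma r_pow: "r ^ (4 * h) = 1"
proof -
  have "r ^ (4 * h) = (r ^ 2) ^ (h * 2)" by (simp flip: power_mult)
  also have "\<dots> = (q ^ h) ^ 2" by (simp only: power_mult power2_eq_square r_sq)
  finally have "r ^ (4 * h) = (q ^ h) ^ 2" .
  then show ?thesis by (simp add: q_h)
qed

lemma pow_root: "(r ^ m) ^ (4 * h) = 1"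
  using r_pow by (metis power_mult mult.commute power_one)

lemma diag_funpow: "lin_end scale UNIV T \<Longrightarrow> T k = scale c k \<Longrightarrow> (T ^^ j) k = scale (c ^ j) k"
proof (induction j)
  case (Suc j)
  then show ?case by (simp add: lin_UNIV mult.commute)
qed simp

lemmas Delta2_lin = lin_UNIV_comp[OF gen_Delta_lin gen_Delta_lin]
lemmas Delta3_lin = lin_UNIV_comp[OF gen_Delta_lin Delta2_lin]
lemmas B2_lin = lin_UNIV_comp[OF gen_B_lin gen_B_lin]
lemmas B3_lin = lin_UNIV_comp[OF gen_B_lin B2_lin]

lemma K_twice:
  "gen_Delta h Khalf (gen_Delta h Khalf (kt m n m' n')) = scale (q ^ m * q ^ n' / (q ^ n * q ^ m')) (kt m n m' n')"
  "gen_Delta h Kinvhalf (gen_Delta h Kinvhalf (kt m n m' n')) = scale (q ^ n * q ^ m' / (q ^ m * q ^ n')) (kt m n m' n')"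
  "gen_B h Khalf (gen_B h Khalf (kt m n m' n')) = scale (q ^ m * q ^ n / (q ^ m' * q ^ n')) (kt m n m' n')"
  "gen_B h Kinvhalf (gen_B h Kinvhalf (kt m n m' n')) = scale (q ^ m' * q ^ n' / (q ^ m * q ^ n)) (kt m n m' n')"
  by (simp_all add: K_Delta_kt K_B_kt gen_Delta_simps gen_B_simps r_sq[symmetric] power_mult_distrib mult_ac)

lemma w_eq: "w = 1 / (qpow h 1 - qpow h (- 1))"
  by (simp add: w_def qpow_1 inverse_eq_divide)

lemma Delta_module: "usl2_module scale Hc h (gen_Delta h)"
proof (intro usl2_module.intro usl2_module_axioms.intro subspace_Hc)
  fix v assume v: "v \<in> Hc"
  show "gen_Delta h Khalf (gen_Delta h Kinvhalf v) = v" "gen_Delta h Kinvhalf (gen_Delta h Khalf v) = v"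
    by (rule Hc_ext[OF Delta2_lin lin_UNIV_id _ v], simp add: K_Delta_kt gen_Delta_simps)+
  show "gen_Delta h Khalf (gen_Delta h GE (gen_Delta h Kinvhalf v)) = scale (qpow h 1) (gen_Delta h GE v)"
  proof (rule Hc_ext[OF Delta3_lin lin_UNIV_scale[OF gen_Delta_lin] _ v])
    fix m n m' n'
    show "gen_Delta h Khalf (gen_Delta h GE (gen_Delta h Kinvhalf (kt m n m' n'))) = scale (qpow h 1) (gen_Delta h GE (kt m n m' n'))"
      by (simp only: kt_expand K_Delta_kt qpow_1, rule two_terms_eq; cases n; cases m'; simp add: field_simps r_sq r_sq')
  qed
  show "gen_Delta h Khalf (gen_Delta h GF (gen_Delta h Kinvhalf v)) = scale (qpow h (- 1)) (gen_Delta h GF v)"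
  proof (rule Hc_ext[OF Delta3_lin lin_UNIV_scale[OF gen_Delta_lin] _ v])
    fix m n m' n'
    show "gen_Delta h Khalf (gen_Delta h GF (gen_Delta h Kinvhalf (kt m n m' n'))) = scale (qpow h (- 1)) (gen_Delta h GF (kt m n m' n'))"
      by (simp only: kt_expand K_Delta_kt qpow_1, rule two_terms_eq; cases m; cases n'; simp add: field_simps r_sq r_sq')
  qed
  show "gen_Delta h GE (gen_Delta h GF v) - gen_Delta h GF (gen_Delta h GE v) = scale (1 / (qpow h 1 - qpow h (- 1)))
      (gen_Delta h Khalf (gen_Delta h Khalf v) - gen_Delta h Kinvhalf (gen_Delta h Kinvhalf v))"
    by (rule Hc_ext[OF lin_UNIV_diff[OF Delta2_lin Delta2_lin] lin_UNIV_scale[OF lin_UNIV_diff[OF Delta2_lin Delta2_lin]] _ v])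
       (simp add: EF_kt K_twice w_sq w_eq[symmetric] flip: hv.scale_left_diff_distrib)
  show "(gen_Delta h GE ^^ h) v = 0" "(gen_Delta h GF ^^ h) v = 0"
    using v by (simp_all add: E_nilpotent F_nilpotent)
  show "(gen_Delta h Khalf ^^ (4 * h)) v = v"
    by (rule Hc_ext[OF lin_UNIV_funpow[OF gen_Delta_lin] lin_UNIV_id _ v])
       (simp add: diag_funpow[OF gen_Delta_lin K_Delta_kt(1)] power_divide power_mult_distrib pow_root)
qed (rule gen_Delta_Hc)

lemma B_module: "usl2_module scale Hc h (gen_B h)"
proof (intro usl2_module.intro usl2_module_axioms.intro subspace_Hc)
  fix v assume v: "v \<in> Hc"
  show "gen_B h Khalf (gen_B h Kinvhalf v) = v" "gen_B h Kinvhalf (gen_B h Khalf v) = v"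
    by (rule Hc_ext[OF B2_lin lin_UNIV_id _ v], simp add: K_B_kt gen_B_simps)+
  show "gen_B h Khalf (gen_B h GE (gen_B h Kinvhalf v)) = scale (qpow h 1) (gen_B h GE v)"
  proof (rule Hc_ext[OF B3_lin lin_UNIV_scale[OF gen_B_lin] _ v])
    fix m n m' n'
    show "gen_B h Khalf (gen_B h GE (gen_B h Kinvhalf (kt m n m' n'))) = scale (qpow h 1) (gen_B h GE (kt m n m' n'))"
      by (simp only: kt_expand K_B_kt qpow_1, rule two_terms_eq; cases n'; cases m'; simp add: field_simps r_sq r_sq')
  qed
  show "gen_B h Khalf (gen_B h GF (gen_B h Kinvhalf v)) = scale (qpow h (- 1)) (gen_B h GF v)"
  proof (rule Hc_ext[OF B3_lin lin_UNIV_scale[OF gen_B_lin] _ v])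
    fix m n m' n'
    show "gen_B h Khalf (gen_B h GF (gen_B h Kinvhalf (kt m n m' n'))) = scale (qpow h (- 1)) (gen_B h GF (kt m n m' n'))"
      by (simp only: kt_expand K_B_kt qpow_1, rule two_terms_eq; cases m; cases n; simp add: field_simps r_sq r_sq')
  qed
  show "gen_B h GE (gen_B h GF v) - gen_B h GF (gen_B h GE v) = scale (1 / (qpow h 1 - qpow h (- 1)))
      (gen_B h Khalf (gen_B h Khalf v) - gen_B h Kinvhalf (gen_B h Kinvhalf v))"
    by (rule Hc_ext[OF lin_UNIV_diff[OF B2_lin B2_lin] lin_UNIV_scale[OF lin_UNIV_diff[OF B2_lin B2_lin]] _ v])
       (simp add: BB'_kt K_twice w_sq w_eq[symmetric] flip: hv.scale_left_diff_distrib)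
  show "(gen_B h GE ^^ h) v = 0" "(gen_B h GF ^^ h) v = 0"
    using v by (simp_all add: B_nilpotent B'_nilpotent)
  show "(gen_B h Khalf ^^ (4 * h)) v = v"
    by (rule Hc_ext[OF lin_UNIV_funpow[OF gen_B_lin] lin_UNIV_id _ v])
       (simp add: diag_funpow[OF gen_B_lin K_B_kt(1)] power_divide power_mult_distrib pow_root)
qed (rule gen_B_Hc)

lemma K_comm:
  "gen_Delta h Khalf (gen_B h x (kt m n m' n')) = gen_B h x (gen_Delta h Khalf (kt m n m' n'))"
  "gen_Delta h Kinvhalf (gen_B h x (kt m n m' n')) = gen_B h x (gen_Delta h Kinvhalf (kt m n m' n'))"
  "gen_Delta h x (gen_B h Khalf (kt m n m' n')) = gen_B h Khalf (gen_Delta h x (kt m n m' n'))"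
  "gen_Delta h x (gen_B h Kinvhalf (kt m n m' n')) = gen_B h Kinvhalf (gen_Delta h x (kt m n m' n'))"
  "gen_Delta h Khalf (opA h (kt m n m' n')) = opA h (gen_Delta h Khalf (kt m n m' n'))"
  "gen_Delta h Kinvhalf (opA h (kt m n m' n')) = opA h (gen_Delta h Kinvhalf (kt m n m' n'))"
  "gen_B h Khalf (opA h (kt m n m' n')) = opA h (gen_B h Khalf (kt m n m' n'))"
  "gen_B h Kinvhalf (opA h (kt m n m' n')) = opA h (gen_B h Kinvhalf (kt m n m' n'))"
proof -
  have D: "scale a k = scale b k" if "a = b" for a b and k :: hvec using that by simp
  show "gen_Delta h Khalf (gen_B h x (kt m n m' n')) = gen_B h x (gen_Delta h Khalf (kt m n m' n'))"
    "gen_Delta h Kinvhalf (gen_B h x (kt m n m' n')) = gen_B h x (gen_Delta h Kinvhalf (kt m n m' n'))"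
    by (cases x; simp only: kt_expand K_Delta_kt K_B_kt; (rule two_terms_eq)?; cases m; cases n; cases m'; cases n'; simp add: field_simps)+
  show "gen_Delta h x (gen_B h Khalf (kt m n m' n')) = gen_B h Khalf (gen_Delta h x (kt m n m' n'))"
    "gen_Delta h x (gen_B h Kinvhalf (kt m n m' n')) = gen_B h Kinvhalf (gen_Delta h x (kt m n m' n'))"
    by (cases x; simp only: kt_expand K_Delta_kt K_B_kt; (rule two_terms_eq)?; cases m; cases n; cases m'; cases n'; simp add: field_simps)+
  show "gen_Delta h Khalf (opA h (kt m n m' n')) = opA h (gen_Delta h Khalf (kt m n m' n'))"
    "gen_Delta h Kinvhalf (opA h (kt m n m' n')) = opA h (gen_Delta h Kinvhalf (kt m n m' n'))"
    "gen_B h Khalf (opA h (kt m n m' n')) = opA h (gen_B h Khalf (kt m n m' n'))"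
    "gen_B h Kinvhalf (opA h (kt m n m' n')) = opA h (gen_B h Kinvhalf (kt m n m' n'))"
    by (simp only: kt_expand K_Delta_kt K_B_kt; rule two_terms_eq; cases m; cases n; cases m'; cases n'; simp add: field_simps)+
qed

lemma Delta_B_comm: "v \<in> Hc \<Longrightarrow> gen_Delta h x (gen_B h y v) = gen_B h y (gen_Delta h x v)"
  by (rule Hc_ext[OF lin_UNIV_comp[OF gen_Delta_lin gen_B_lin] lin_UNIV_comp[OF gen_B_lin gen_Delta_lin]])
     (cases x; cases y; simp only: K_comm E_B_comm_kt E_B'_comm_kt F_B_comm_kt F_B'_comm_kt)+

lemma A_comm: "v \<in> Hc \<Longrightarrow> opA h (gen_Delta h x v) = gen_Delta h x (opA h v)"
  "v \<in> Hc \<Longrightarrow> opA h (gen_B h x v) = gen_B h x (opA h v)"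
  by (rule Hc_ext[OF lin_UNIV_comp[OF opA_lin gen_Delta_lin] lin_UNIV_comp[OF gen_Delta_lin opA_lin]],
      (cases x; simp only: K_comm E_A_comm_kt F_A_comm_kt),
      assumption, rule Hc_ext[OF lin_UNIV_comp[OF opA_lin gen_B_lin] lin_UNIV_comp[OF gen_B_lin opA_lin]],
      (cases x; simp only: K_comm B_A_comm_kt B'_A_comm_kt))

lemma H_module: "uq_module scale Hc h (gen_Delta h) (gen_B h)"
  by (intro uq_module.intro uq_module_axioms.intro Delta_module B_module Delta_B_comm)

sublocale U: uq_module scale Hc h "gen_Delta h" "gen_B h"
  by (rule H_module)

lemma Uq_act_eq: "Uq_act h X v = U.uact X v"
proof -
  have "(\<lambda>(a, b). usl2_act (gen_Delta h) a (usl2_act (gen_B h) b v)) = (\<lambda>p. U.rep p v)"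
    by (auto simp: fun_eq_iff U.rep_def usl2_act_def class_act_def lin_ext_eq)
  then show ?thesis by (simp add: Uq_act_def class_act_def lin_ext_eq)
qed

end

section \<open>The invariant vectors\<close>

context root_order
begin

text \<open>The number \<open>[i]\<close> vanishes exactly at the multiples of \<open>h\<close>.\<close>

lemma qn_nonzero': "h < i \<Longrightarrow> i < 2 * h \<Longrightarrow> qn i \<noteq> 0"
proof -
  assume i: "h < i" "i < 2 * h"
  then have "i = h + (i - h)" by simp
  then have "q ^ i = - (q ^ (i - h))" by (metis power_add q_h mult_minus1)
  then have "qn i = - qn (i - h)" by (simp add: qn_eq minus_divide_left)
  then show ?thesis using qn_nonzero[of "i - h"] i by simp
qed

lemma q_power_inj: "m < h \<Longrightarrow> m' < h \<Longrightarrow> q ^ m = q ^ m' \<Longrightarrow> m = m'"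
proof (induction m m' rule: linorder_wlog)
  case (le m m')
  then have "q ^ m' = q ^ m * q ^ (m' - m)" by (subst power_add[symmetric]) simp
  then have "q ^ (m' - m) = 1" using le by simp
  then have "qn (m' - m) = 0" by (simp add: qn_eq)
  then show ?case using qn_nonzero[of "m' - m"] le by (cases "m = m'") auto
qed auto

text \<open>Invariance under the generators suffices because both sides are actions of the algebra, the second
  one through the counit.\<close>

lemma H_inv_iff: "\<Psi> \<in> H_inv h \<longleftrightarrow> \<Psi> \<in> Hc \<and>
    (\<forall>x. gen_Delta h x \<Psi> = scale (counit_gen x) \<Psi> \<and> gen_B h x \<Psi> = scale (counit_gen x) \<Psi>)"
proof -
  interpret C: uq_module "(*)" "UNIV :: complex set" h "\<lambda>x v. counit_gen x * v" "\<lambda>x v. counit_gen x * v"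
    by (rule counit_uq_module[OF h])
  show ?thesis
  proof safe
    assume inv: "\<Psi> \<in> H_inv h"
    then show \<Psi>: "\<Psi> \<in> Hc" by (simp add: H_inv_def)
    fix x
    have counit: "Uq_counit (gen_left h x) = counit_gen x" "Uq_counit (gen_right h x) = counit_gen x"
      by (simp_all add: Uq_counit_eq[OF h] C.uact_gen_left C.uact_gen_right U.gen_left_closed U.gen_right_closed)
    have "Uq_act h X \<Psi> = scale (Uq_counit X) \<Psi>" if "X \<in> carrier (Uq h)" for X
      using inv that by (simp add: H_inv_def)
    from this[OF U.gen_left_closed[of x]] this[OF U.gen_right_closed[of x]]
    show "gen_Delta h x \<Psi> = scale (counit_gen x) \<Psi>" "gen_B h x \<Psi> = scale (counit_gen x) \<Psi>"
      by (simp_all add: Uq_act_eq U.uact_gen_left U.uact_gen_right \<Psi> counit)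
  next
    assume \<Psi>: "\<Psi> \<in> Hc"
      and gen: "\<forall>x. gen_Delta h x \<Psi> = scale (counit_gen x) \<Psi> \<and> gen_B h x \<Psi> = scale (counit_gen x) \<Psi>"
    have "scale (Uq_counit X) \<Psi> = Uq_act h X \<Psi>" if X: "X \<in> carrier (Uq h)" for X
    proof -
      have "scale (C.uact X 1) \<Psi> = U.uact X (scale 1 \<Psi>)"
        using \<Psi> gen X
        by (intro uact_intertwine[OF C.uq_module_axioms H_module, where T = "\<lambda>c. scale c \<Psi>"])
           (simp_all add: Hc.S_scale hv.scale_left_distrib gen_Delta_simps gen_B_simps mult.commute)
      then show ?thesis by (simp add: Uq_counit_eq[OF h X] Uq_act_eq)
    qed
    then show "\<Psi> \<in> H_inv h" using \<Psi> by (simp add: H_inv_def)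
  qed
qed

lemma H_inv_Hc: "v \<in> H_inv h \<Longrightarrow> v \<in> Hc"
  by (simp add: H_inv_iff)

lemma H_inv_subspace: "subspace_of scale (H_inv h)"
  by unfold_locales
     (auto simp: H_inv_iff Hc.S_zero Hc.S_add Hc.S_scale gen_Delta_simps gen_B_simps hv.scale_right_distrib mult.commute)

sublocale HI: subspace_of scale "H_inv h" by (rule H_inv_subspace)

lemma opA_H_inv: "v \<in> H_inv h \<Longrightarrow> opA h v \<in> H_inv h"
  using lin_endD(1)[OF opA_Hc] by (simp add: H_inv_iff flip: A_comm) (simp add: opA_simps)

lemma opA_pow_H_inv: "v \<in> H_inv h \<Longrightarrow> (opA h ^^ n) v \<in> H_inv h"
  by (induction n) (simp_all add: opA_H_inv)

lemmas opA_pow_simps = lin_UNIV[OF lin_UNIV_funpow[OF opA_lin]]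

definition qnf :: "nat \<Rightarrow> complex" where "qnf n = (\<Prod>i=1..n. qn i)"

lemma qnf_0 [simp]: "qnf 0 = 1" and qnf_Suc: "qnf (Suc n) = qn (Suc n) * qnf n"
  by (simp_all add: qnf_def)

lemma qnf_nonzero: "n < h \<Longrightarrow> qnf n \<noteq> 0"
  by (auto simp: qnf_def qn_nonzero)

definition inv_coeff :: "nat \<Rightarrow> nat \<Rightarrow> complex" where "inv_coeff m n = q ^ (m * n) / (qnf m * qnf n)"

text \<open>This recursion along an antidiagonal is the condition that the two terms of \<open>E
  \<Psi>\<^sub>j\<close> cancel.\<close>

lemma inv_coeff_rec:
  assumes "Suc m < h" "Suc n < h"
  shows "qn (Suc n) * inv_coeff m (Suc n) = q ^ m * (inverse (q ^ n) * (qn (Suc m) * inv_coeff (Suc m) n))"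
  using assms qn_nonzero[of "Suc m"] qn_nonzero[of "Suc n"]
  by (simp add: inv_coeff_def qnf_Suc qnf_nonzero power_add mult_ac)

text \<open>The basis of the invariants, indexed by the level \<open>j = p - 1\<close>.\<close>

definition Psi :: "nat \<Rightarrow> hvec" where
  "Psi j = (\<Sum>m\<le>j. scale (inv_coeff m (j - m)) (kt m (j - m) m (j - m)))"

lemma sum_hvec: "lin_end scale UNIV T \<Longrightarrow> T (sum f A) = (\<Sum>a\<in>A. T (f a))"
  by (induction A rule: infinite_finite_induct) (simp_all add: lin_UNIV)

text \<open>An operator applied to \<open>\<Psi>\<close> gives, for each point of an antidiagonal, two terms
  at neighbouring points of the next lower one; regrouping them by target point lets the terms be
  compared.\<close>

lemma antidiagonal_sum:
  fixes f1 f2 :: "nat \<Rightarrow> nat \<Rightarrow> 'v::comm_monoid_add"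
  assumes "f1 (Suc j) 0 = 0" "f2 0 (Suc j) = 0"
  shows "(\<Sum>m\<le>Suc j. f1 m (Suc j - m) + f2 m (Suc j - m)) = (\<Sum>m\<le>j. f1 m (Suc (j - m)) + f2 (Suc m) (j - m))"
proof -
  have "(\<Sum>m\<le>Suc j. f1 m (Suc j - m)) = (\<Sum>m\<le>j. f1 m (Suc (j - m)))"
    using assms by (simp add: Suc_diff_le)
  moreover have "(\<Sum>m\<le>Suc j. f2 m (Suc j - m)) = (\<Sum>m\<le>j. f2 (Suc m) (j - m))"
    using assms by (subst sum.atMost_Suc_shift) simp
  ultimately show ?thesis by (simp add: sum.distrib)
qed

lemma T_Psi:
  assumes T: "lin_end scale UNIV T"
    and kt: "\<And>m n. scale (inv_coeff m n) (T (kt m n m n)) = f1 m n + f2 m n"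
    and f: "\<And>m. f1 m 0 = 0" "\<And>n. f2 0 n = 0"
  shows "T (Psi (Suc j)) = (\<Sum>m\<le>j. f1 m (Suc (j - m)) + f2 (Suc m) (j - m))" "T (Psi 0) = 0"
proof -
  have *: "T (Psi i) = (\<Sum>m\<le>i. f1 m (i - m) + f2 m (i - m))" for i
    by (simp add: Psi_def sum_hvec[OF T] lin_UNIV[OF T] kt)
  show "T (Psi (Suc j)) = (\<Sum>m\<le>j. f1 m (Suc (j - m)) + f2 (Suc m) (j - m))"
    unfolding * by (rule antidiagonal_sum) (use f in auto)
  show "T (Psi 0) = 0" unfolding * by (simp add: f)
qed

lemma T_Psi_0:
  assumes T: "lin_end scale UNIV T"
    and kt: "\<And>m n. scale (inv_coeff m n) (T (kt m n m n)) = f1 m n + f2 m n"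
    and f: "\<And>m. f1 m 0 = 0" "\<And>n. f2 0 n = 0"
    and cancel: "\<And>m n. f1 m (Suc n) + f2 (Suc m) n = 0"
  shows "T (Psi j) = 0"
  using T_Psi[OF T kt f] by (cases j) (simp_all add: cancel)

lemma scale_kt_cancel:
  assumes "\<lbrakk>m < h; n < h; m' < h; n' < h\<rbrakk> \<Longrightarrow> a + b = 0"
  shows "scale a (kt m n m' n') + scale b (kt m n m' n') = 0"
  using assms by (cases "m < h \<and> n < h \<and> m' < h \<and> n' < h")
    (auto simp: kt_zero simp flip: hv.scale_left_distrib)

lemma Psi_Hc: "Psi j \<in> Hc"
proof -
  have "(\<Sum>m\<in>A. scale (inv_coeff m (j - m)) (kt m (j - m) m (j - m))) \<in> Hc" if "finite A" for A
    using that by (induction A) (auto intro: Hc.S_zero Hc.S_add Hc.S_scale kt_in_Hc)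
  then show ?thesis by (simp add: Psi_def)
qed

lemma Psi_K: "gen_Delta h Khalf (Psi j) = Psi j" "gen_Delta h Kinvhalf (Psi j) = Psi j"
    "gen_B h Khalf (Psi j) = Psi j" "gen_B h Kinvhalf (Psi j) = Psi j"
  by (simp_all add: Psi_def sum_hvec[OF gen_Delta_lin] sum_hvec[OF gen_B_lin] gen_Delta_simps gen_B_simps K_Delta_kt K_B_kt)

lemma Psi_E: "gen_Delta h GE (Psi j) = 0"
proof (rule T_Psi_0[OF gen_Delta_lin,
      where ?f1.0 = "\<lambda>m n. scale (qn n * inv_coeff m n) (kt (Suc m) (n - 1) m n)"
        and ?f2.0 = "\<lambda>m n. scale (- (q ^ m * inverse (q ^ n * q) * qn m * inv_coeff m n)) (kt m n (m - 1) (Suc n))"], goal_cases)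
  case (4 m n)
  show ?case
    unfolding diff_Suc_1
  proof (rule scale_kt_cancel, goal_cases)
    case 1
    then show ?case
      using inv_coeff_rec[of m n] by (simp only: mult.assoc) (simp add: mult_ac)
  qed
qed (simp_all add: E_kt' hv.scale_right_distrib hv.scale_right_diff_distrib mult_ac)

lemma Psi_F: "gen_Delta h GF (Psi j) = 0"
proof (rule T_Psi_0[OF gen_Delta_lin,
      where ?f1.0 = "\<lambda>m n. scale (- (q * qn n * inv_coeff m n)) (kt m n (Suc m) (n - 1))"
        and ?f2.0 = "\<lambda>m n. scale (q ^ m * inverse (q ^ n) * qn m * inv_coeff m n) (kt (m - 1) (Suc n) m n)"], goal_cases)
  case (4 m n)
  show ?case
    unfolding diff_Suc_1
  proof (rule scale_kt_cancel, goal_cases)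
    case 1
    then show ?case
      using inv_coeff_rec[of m n] by (simp only: mult.assoc) (simp add: mult_ac)
  qed
qed (simp_all add: F_kt' hv.scale_right_distrib hv.scale_right_diff_distrib mult_ac add.commute)

lemma Psi_B: "gen_B h GE (Psi j) = 0"
proof (rule T_Psi_0[OF gen_B_lin,
      where ?f1.0 = "\<lambda>m n. scale (r * qn n * inv_coeff m n) (kt (Suc m) n m (n - 1))"
        and ?f2.0 = "\<lambda>m n. scale (- (r * q ^ m * inverse (q ^ n * q) * qn m * inv_coeff m n)) (kt m (Suc n) (m - 1) n)"], goal_cases)
  case (4 m n)
  show ?case
    unfolding diff_Suc_1
  proof (rule scale_kt_cancel, goal_cases)
    case 1
    then show ?case
      using inv_coeff_rec[of m n] by (simp only: mult.assoc) (simp add: mult_ac)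
  qed
qed (simp_all add: B_kt' hv.scale_right_distrib hv.scale_right_diff_distrib mult_ac)

lemma Psi_B': "gen_B h GF (Psi j) = 0"
proof (rule T_Psi_0[OF gen_B_lin,
      where ?f1.0 = "\<lambda>m n. scale (- (r * qn n * inv_coeff m n)) (kt m (n - 1) (Suc m) n)"
        and ?f2.0 = "\<lambda>m n. scale (r * q ^ m * inverse (q ^ n * q) * qn m * inv_coeff m n) (kt (m - 1) n m (Suc n))"], goal_cases)
  case (4 m n)
  show ?case
    unfolding diff_Suc_1
  proof (rule scale_kt_cancel, goal_cases)
    case 1
    then show ?case
      using inv_coeff_rec[of m n] by (simp only: mult.assoc) (simp add: mult_ac)
  qed
qed (simp_all add: B'_kt' hv.scale_right_distrib hv.scale_right_diff_distrib mult_ac add.commute)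

lemma Psi_H_inv: "Psi j \<in> H_inv h"
  unfolding H_inv_iff
proof (intro conjI allI Psi_Hc)
  fix x show "gen_Delta h x (Psi j) = scale (counit_gen x) (Psi j)" "gen_B h x (Psi j) = scale (counit_gen x) (Psi j)"
    by (cases x; simp add: Psi_K Psi_E Psi_F Psi_B Psi_B')+
qed

lemma inv_coeff_step:
  assumes "m < h" "n < h"
  shows "inv_coeff m (Suc n) * (qn (Suc n) * qn (Suc n)) = q ^ m * qn (Suc n) * inv_coeff m n"
    "inv_coeff (Suc m) n * (qn (Suc m) * qn (Suc m)) = q ^ n * qn (Suc m) * inv_coeff m n"
  using assms by (cases "qn (Suc n) = 0"; cases "qn (Suc m) = 0"; simp add: inv_coeff_def qnf_Suc power_add mult_ac)+

text \<open>By \<open>inv_coeff_step\<close> the contribution of the neighbours of \<open>(m, n)\<close> is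
  \<open>[m + 1]\<close> and \<open>[n + 1]\<close> times powers of \<open>q\<close>, which add up
  to \<open>[m + n + 2]\<close>.\<close>

lemma opA_Psi: "opA h (Psi (Suc j)) = scale (qn (Suc (Suc j))) (Psi j)" "opA h (Psi 0) = 0"
proof -
  let ?f1 = "\<lambda>m n. scale (q * (qn n * qn n) * inv_coeff m n) (kt m (n - 1) m (n - 1))"
  let ?f2 = "\<lambda>m n. scale (inverse (q * q ^ n * q ^ n) * (qn m * qn m) * inv_coeff m n) (kt (m - 1) n (m - 1) n)"
  have kt: "scale (inv_coeff m n) (opA h (kt m n m n)) = ?f1 m n + ?f2 m n" for m n
    by (simp add: A_kt hv.scale_right_distrib hv.scale_right_diff_distrib mult_ac)
  note * = T_Psi[OF opA_lin kt]
  show "opA h (Psi 0) = 0" by (rule *) simp_all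
  have step: "?f1 m (Suc n) + ?f2 (Suc m) n = scale (qn (Suc (Suc (m + n))) * inv_coeff m n) (kt m n m n)" for m n
  proof (cases "m < h \<and> n < h")
    case True
    have "q * (qn (Suc n) * qn (Suc n)) * inv_coeff m (Suc n)
        + inverse (q * q ^ n * q ^ n) * (qn (Suc m) * qn (Suc m)) * inv_coeff (Suc m) n
        = q * (inv_coeff m (Suc n) * (qn (Suc n) * qn (Suc n)))
        + inverse (q * q ^ n * q ^ n) * (inv_coeff (Suc m) n * (qn (Suc m) * qn (Suc m)))"
      by simp
    also have "\<dots> = (q * (q ^ m * qn (Suc n)) + inverse (q * q ^ n) * qn (Suc m)) * inv_coeff m n"
      using True by (simp only: inv_coeff_step) (simp add: field_simps)
    also have "q * (q ^ m * qn (Suc n)) + inverse (q * q ^ n) * qn (Suc m) = qn (Suc (Suc (m + n)))"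
      by (simp add: qn_w power_add field_simps)
    finally show ?thesis by (simp flip: hv.scale_left_distrib)
  qed (auto simp: kt_zero)
  have "opA h (Psi (Suc j)) = (\<Sum>m\<le>j. ?f1 m (Suc (j - m)) + ?f2 (Suc m) (j - m))"
    by (rule *) simp_all
  also have "\<dots> = (\<Sum>m\<le>j. scale (qn (Suc (Suc j)) * inv_coeff m (j - m)) (kt m (j - m) m (j - m)))"
    by (intro sum.cong refl) (simp only: step, simp)
  finally show "opA h (Psi (Suc j)) = scale (qn (Suc (Suc j))) (Psi j)"
    by (simp add: Psi_def hv.scale_sum_right)
qed

lemma opA_pow_Psi: "(opA h ^^ k) (Psi (j + k)) = scale (\<Prod>i<k. qn (j + 2 + i)) (Psi j)"
proof (induction k)
  case (Suc k)
  have "(opA h ^^ Suc k) (Psi (j + Suc k)) = (opA h ^^ k) (opA h (Psi (Suc (j + k))))"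
    by (simp add: funpow_swap1)
  then show ?case using Suc by (simp add: opA_Psi opA_pow_simps mult.commute)
qed simp

lemma opA_pow_Psi_0: "j < k \<Longrightarrow> (opA h ^^ k) (Psi j) = 0"
proof (induction k arbitrary: j)
  case (Suc k)
  have "(opA h ^^ Suc k) (Psi j) = (opA h ^^ k) (opA h (Psi j))" by (simp add: funpow_swap1)
  then show ?case using Suc by (cases j) (simp_all add: opA_Psi opA_pow_simps)
qed simp

end

section \<open>Linear functionals\<close>

definition lin_fun :: "(('a \<Rightarrow>\<^sub>0 complex) \<Rightarrow> complex) \<Rightarrow> bool" where
  "lin_fun F \<longleftrightarrow> (\<forall>u v. F (u + v) = F u + F v) \<and> (\<forall>c v. F (scale c v) = c * F v)"

lemma lin_fun_simps:
  assumes "lin_fun F"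
  shows "F (u + v) = F u + F v" "F (scale c v) = c * F v" "F 0 = 0" "F (u - v) = F u - F v"
    "F (- v) = - F v"
proof -
  show *: "F (u + v) = F u + F v" "F (scale c v) = c * F v" for u v c
    using assms by (simp_all add: lin_fun_def)
  show "F 0 = 0" using *(2)[of 0 0] by simp
  show "F (u - v) = F u - F v" using *(1)[of "u - v" v] by simp
  show "F (- v) = - F v" using *(2)[of "-1" v] by simp
qed

lemma lin_fun_sum: "lin_fun F \<Longrightarrow> F (sum f A) = (\<Sum>a\<in>A. F (f a))"
  by (induction A rule: infinite_finite_induct) (simp_all add: lin_fun_simps)

lemma lin_fun_comp: "lin_fun F \<Longrightarrow> lin_end scale UNIV T \<Longrightarrow> lin_fun (\<lambda>v. F (T v))"
  by (simp add: lin_fun_def lin_end_def)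

lemma lin_fun_scale: "lin_fun F \<Longrightarrow> lin_fun (\<lambda>v. c * F v)"
  by (simp add: lin_fun_def algebra_simps)

lemma lin_fun_diff: "lin_fun F \<Longrightarrow> lin_fun G \<Longrightarrow> lin_fun (\<lambda>v. F v - G v)"
  by (simp add: lin_fun_def algebra_simps)

lemma lin_fun_lookup: "lin_fun (\<lambda>v. Poly_Mapping.lookup v x)"
  by (simp add: lin_fun_def lookup_add)

lemma lin_fun_ext:
  assumes F: "lin_fun F" and G: "lin_fun G"
    and eq: "\<And>x. x \<in> Poly_Mapping.keys v \<Longrightarrow> F (Poly_Mapping.single x 1) = G (Poly_Mapping.single x 1)"
  shows "F v = G v"
proof -
  have *: "H v = (\<Sum>x\<in>Poly_Mapping.keys v. Poly_Mapping.lookup v x * H (Poly_Mapping.single x 1))" if "lin_fun H" for H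
    using lin_fun_sum[OF that, of "\<lambda>x. scale (Poly_Mapping.lookup v x) (Poly_Mapping.single x 1)" "Poly_Mapping.keys v"]
      lin_comb_id[of v] by (simp only: lin_comb_def lin_fun_simps(2)[OF that])
  show ?thesis unfolding *[OF F] *[OF G] using eq by simp
qed

context root_order
begin

lemma Hc_fun_ext:
  assumes F: "lin_fun F" and G: "lin_fun G" and v: "v \<in> Hc"
    and eq: "\<And>m n m' n'. m < h \<Longrightarrow> n < h \<Longrightarrow> m' < h \<Longrightarrow> n' < h \<Longrightarrow> F (kt m n m' n') = G (kt m n m' n')"
  shows "F v = G v"
proof (rule lin_fun_ext[OF F G])
  fix x assume "x \<in> Poly_Mapping.keys v"
  from basis_kt[OF v this] show "F (Poly_Mapping.single x 1) = G (Poly_Mapping.single x 1)" using eq by metis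
qed

definition idx :: "nat \<Rightarrow> nat \<Rightarrow> nat \<Rightarrow> nat \<Rightarrow> (int \<times> int) \<times> (int \<times> int)" where
  "idx m n m' n' = ((int (m + n + 1), int m), (int (m' + n' + 1), int m'))"

lemma lookup_kt: "Poly_Mapping.lookup (kt a b a' b') (idx m n m' n') =
    (if a = m \<and> b = n \<and> a' = m' \<and> b' = n' \<and> m < h \<and> n < h \<and> m' < h \<and> n' < h then 1 else 0)"
proof (cases "a < h \<and> b < h \<and> a' < h \<and> b' < h")
  case True
  then show ?thesis by (auto simp: kt_single idx_def lookup_single when_def)
next
  case False
  then show ?thesis by (auto simp: kt_zero)
qed

definition diag_fun :: "(nat \<Rightarrow> nat \<Rightarrow> complex) \<Rightarrow> hvec \<Rightarrow> complex" where
  "diag_fun c v = (\<Sum>m<h. \<Sum>n<h. c m n * Poly_Mapping.lookup v (idx m n m n))"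

lemma diag_fun_lin: "lin_fun (diag_fun c)"
  by (simp add: lin_fun_def diag_fun_def lookup_add distrib_left sum.distrib sum_distrib_left mult_ac)

lemmas diag_fun_simps = lin_fun_simps[OF diag_fun_lin]

lemma diag_fun_kt: "diag_fun c (kt m n m' n') = (if m = m' \<and> n = n' \<and> m < h \<and> n < h then c m n else 0)"
proof -
  have "diag_fun c (kt m n m' n') = (\<Sum>a<h. \<Sum>b<h. if a = m then if b = n then
      if m = m' \<and> n = n' then c m n else 0 else 0 else 0)"
    unfolding diag_fun_def by (intro sum.cong refl) (auto simp: lookup_kt)
  also have "\<dots> = (\<Sum>a<h. if a = m then (\<Sum>b<h. if b = n then
      if m = m' \<and> n = n' then c m n else 0 else 0) else 0)"
    by (intro sum.cong refl) simp
  also have "\<dots> = (if m = m' \<and> n = n' \<and> m < h \<and> n < h then c m n else 0)"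
    by simp
  finally show ?thesis .
qed

text \<open>The coefficients dual to \<open>inv_coeff\<close>, up to the factor
  \<open>q\<^bsup>-2m\<^esup>\<close> that makes the functionals below invariant.\<close>

definition dual_coeff :: "nat \<Rightarrow> nat \<Rightarrow> complex" where
  "dual_coeff m n = qnf m * qnf n / (q ^ (m * n) * q ^ (2 * m))"

lemma dual_coeff_rec: "qn (Suc n) * dual_coeff m n = q ^ m * dual_coeff m (Suc n)"
  "qn (Suc m) * dual_coeff m n = q ^ n * (q * q) * dual_coeff (Suc m) n"
  by (simp_all add: dual_coeff_def qnf_Suc power_add mult_ac)

text \<open>In the notation of the introduction, \<open>glevel j\<close> is \<open>g\<^sub>j\<close>.\<close>

definition "glevel j = diag_fun (\<lambda>m n. if m + n = j then dual_coeff m n else 0)"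

lemma glevel_lin: "lin_fun (glevel j)" by (simp add: glevel_def diag_fun_lin)

lemma A_dual_sum: "q * (qn n * qn n) * (if n = 0 then 0 else dual_coeff m (n - 1))
      + inverse (q * q ^ n * q ^ n) * (qn m * qn m) * (if m = 0 then 0 else dual_coeff (m - 1) n)
    = q * qn (m + n) * dual_coeff m n"
proof -
  have 1: "q * (qn n * qn n) * (if n = 0 then 0 else dual_coeff m (n - 1)) = q * q ^ m * qn n * dual_coeff m n"
  proof (cases n)
    case (Suc b)
    have "q * (qn n * qn n) * dual_coeff m b = q * qn n * (qn (Suc b) * dual_coeff m b)"
      by (simp add: Suc)
    also have "\<dots> = q * q ^ m * qn n * dual_coeff m n"
      unfolding dual_coeff_rec by (simp add: Suc)
    finally show ?thesis by (simp add: Suc)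
  qed simp
  have 2: "inverse (q * q ^ n * q ^ n) * (qn m * qn m) * (if m = 0 then 0 else dual_coeff (m - 1) n)
      = q * inverse (q ^ n) * qn m * dual_coeff m n"
  proof (cases m)
    case (Suc a)
    have "inverse (q * q ^ n * q ^ n) * (qn m * qn m) * dual_coeff a n
        = inverse (q * q ^ n * q ^ n) * qn m * (qn (Suc a) * dual_coeff a n)"
      by (simp add: Suc)
    also have "\<dots> = q * inverse (q ^ n) * qn m * dual_coeff m n"
      unfolding dual_coeff_rec by (simp add: Suc field_simps)
    finally show ?thesis by (simp add: Suc)
  qed simp
  show ?thesis unfolding 1 2 by (simp add: qn_w power_add field_simps)
qed

text \<open>The two predecessors of a diagonal basis vector are weighted so that their contributions add up to
  \<open>q [m + n]\<close>, by \<open>A_dual_sum\<close>.\<close>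

lemma glevel_A: "v \<in> Hc \<Longrightarrow> glevel j (opA h v) = q * qn (Suc j) * glevel (Suc j) v"
proof (rule Hc_fun_ext[OF lin_fun_comp[OF glevel_lin opA_lin] lin_fun_scale[OF glevel_lin]])
  fix m n m' n' assume lt: "m < h" "n < h" "m' < h" "n' < h"
  show "glevel j (opA h (kt m n m' n')) = q * qn (Suc j) * glevel (Suc j) (kt m n m' n')"
  proof (cases "m = m' \<and> n = n' \<and> m + n = Suc j")
    case True
    then have [simp]: "m' = m" "n' = n" and j: "m + n = Suc j" by auto
    have "glevel j (opA h (kt m n m n)) = q * (qn n * qn n) * (if n = 0 then 0 else dual_coeff m (n - 1))
      + inverse (q * q ^ n * q ^ n) * (qn m * qn m) * (if m = 0 then 0 else dual_coeff (m - 1) n)"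
      using lt j by (cases m; cases n; simp add: A_kt glevel_def diag_fun_simps diag_fun_kt)
    then show ?thesis
      unfolding A_dual_sum j using j lt by (simp add: glevel_def diag_fun_kt)
  next
    case False
    then show ?thesis
      using lt by (cases m; cases n; cases m'; cases n'; auto simp: A_kt glevel_def diag_fun_simps diag_fun_kt)
  qed
qed assumption

lemma glevel_F: "v \<in> Hc \<Longrightarrow> glevel j (gen_Delta h GF v) = 0"
proof (rule Hc_fun_ext[OF lin_fun_comp[OF glevel_lin gen_Delta_lin], where G = "\<lambda>_. 0"])
  fix m n m' n' assume lt: "m < h" "n < h" "m' < h" "n' < h"
  have id: "q ^ a * (inverse q * inverse (q ^ b)) * qn (Suc a) * dual_coeff a (Suc b)
      = q * qn (Suc b) * dual_coeff (Suc a) b" for a b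
  proof -
    have "q ^ a * (inverse q * inverse (q ^ b)) * (qn (Suc a) * dual_coeff a (Suc b))
        = q * (qn (Suc b) * dual_coeff (Suc a) b)"
      unfolding dual_coeff_rec by (simp add: field_simps)
    then show ?thesis by (simp only: mult.assoc)
  qed
  show "glevel j (gen_Delta h GF (kt m n m' n')) = 0"
    using lt
    by (cases m; cases n'; auto simp: F_kt glevel_def diag_fun_simps diag_fun_kt id)
qed (simp_all add: lin_fun_def)

text \<open>The functional \<open>l\<close> of the introduction. It weights the terms of the invariant functional of level
  \<open>h - 1\<close> with partial sums \<open>tsum m\<close> whose increments are chosen to give \<open>l A = g\<^sub>h\<close>.\<close>

definition "tsum m = (\<Sum>i=1..m. inverse (q ^ (i + 1) * qn i))"
definition "lift = diag_fun (\<lambda>m n. if m + n = h - 1 then dual_coeff m n * tsum m else 0)"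

lemma lift_lin: "lin_fun lift" by (simp add: lift_def diag_fun_lin)

lemma tsum_Suc: "tsum (Suc m) = tsum m + inverse (q ^ (m + 2) * qn (Suc m))"
  by (simp add: tsum_def)

text \<open>Both hold because \<open>q\<^sup>h = -1\<close>.\<close>

lemma qn_reflect: "m + n = h \<Longrightarrow> qn n = qn m" "m + n = h \<Longrightarrow> inverse (q ^ n) = - (q ^ m)"
proof -
  assume mn: "m + n = h"
  have "q ^ m * q ^ n = -1" using q_h by (simp flip: mn add: power_add)
  then have *: "q ^ n = - inverse (q ^ m)" by (simp add: field_simps eq_neg_iff_add_eq_0)
  show "qn n = qn m" by (simp add: qn_eq *)
  show "inverse (q ^ n) = - (q ^ m)" by (simp add: *)
qed

text \<open>On level \<open>h\<close> the reflection \<open>[h - m] = [m]\<close> leaves only the difference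
  of two consecutive partial sums \<open>tsum\<close>, which are chosen to make it 1.\<close>

lemma lift_A: "v \<in> Hc \<Longrightarrow> lift (opA h v) = glevel h v"
proof (rule Hc_fun_ext[OF lin_fun_comp[OF lift_lin opA_lin] glevel_lin])
  fix m n m' n' assume lt: "m < h" "n < h" "m' < h" "n' < h"
  show "lift (opA h (kt m n m' n')) = glevel h (kt m n m' n')"
  proof (cases "m = m' \<and> n = n' \<and> m + n = h")
    case True
    then have [simp]: "m' = m" "n' = n" and mn: "m + n = h" by auto
    from mn obtain a b where ab: "m = Suc a" "n = Suc b" using lt by (cases m; cases n; auto)
    have [simp]: "qn (Suc a) \<noteq> 0" using qn_nonzero[of m] lt ab by simp
    have level: "h - Suc 0 = Suc (a + b)" using mn ab by simp
    note refl = qn_reflect[of m n]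
    have "lift (opA h (kt m n m n)) = q * (qn n * qn n) * (dual_coeff m b * tsum m)
        + inverse (q * q ^ n * q ^ n) * (qn m * qn m) * (dual_coeff a n * tsum a)"
      using lt mn level by (simp add: A_kt lift_def diag_fun_simps diag_fun_kt ab)
    also have "\<dots> = q * qn n * tsum m * (qn (Suc b) * dual_coeff m b)
        + inverse (q * q ^ n * q ^ n) * qn m * tsum a * (qn (Suc a) * dual_coeff a n)"
      by (simp add: ab mult_ac)
    also have "\<dots> = q * dual_coeff m n * (q ^ m * qn n * tsum m + inverse (q ^ n) * qn m * tsum a)"
      unfolding dual_coeff_rec unfolding ab[symmetric] by (simp add: field_simps)
    also have "\<dots> = q * dual_coeff m n * (q ^ m * qn m * (tsum m - tsum a))"
      using mn refl by (simp add: algebra_simps)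
    also have "\<dots> = dual_coeff m n"
      by (simp add: ab tsum_Suc field_simps)
    finally show ?thesis using mn lt by (simp add: glevel_def diag_fun_kt)
  next
    case False
    then show ?thesis
      using lt by (cases m; cases n; cases m'; cases n'; auto simp: A_kt lift_def glevel_def diag_fun_simps diag_fun_kt)
  qed
qed assumption

text \<open>Up to multiples of the invariant functional, which \<open>F E\<close> annihilates, only the
  differences of consecutive values of \<open>tsum\<close> survive. They cancel the factors
  \<open>[m + 1]\<close> and \<open>[m]\<close>, so the result has no dependence on
  \<open>tsum\<close>.\<close>

lemma lift_FE: "v \<in> Hc \<Longrightarrow> lift (gen_Delta h GF (gen_Delta h GE v)) = inverse q * glevel (h - 1) v"
proof (rule Hc_fun_ext[OF lin_fun_comp[OF lift_lin Delta2_lin] lin_fun_scale[OF glevel_lin]])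
  fix m n m' n' assume lt: "m < h" "n < h" "m' < h" "n' < h"
  show "lift (gen_Delta h GF (gen_Delta h GE (kt m n m' n'))) = inverse q * glevel (h - 1) (kt m n m' n')"
  proof (cases "m = m' \<and> n = n' \<and> m + n = h - 1")
    case True
    then have [simp]: "m' = m" "n' = n" and mn: "m + n = h - 1" by auto
    have room: "n \<noteq> 0 \<Longrightarrow> Suc m < h" "m \<noteq> 0 \<Longrightarrow> Suc n < h" using mn h by auto
    \<comment> \<open>The contributions of the two terms of \<open>E\<close>; each of \<open>X\<close> and \<open>Y\<close> has a term at \<open>(m, n)\<close> and one at a neighbour.\<close>
    define X where "X = qn n * (q ^ m * inverse (q ^ n) * qn (Suc m) * (dual_coeff m n * tsum m)
      - q * qn n * (if n = 0 then 0 else dual_coeff (Suc m) (n - 1) * tsum (Suc m)))"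
    define Y where "Y = q ^ m * inverse (q ^ n * q) * qn m *
      ((if m = 0 then 0 else q ^ (m - 1) * inverse (q ^ Suc n) * qn m * (dual_coeff (m - 1) (Suc n) * tsum (m - 1)))
       - q * qn (Suc n) * (dual_coeff m n * tsum m))"
    have "lift (gen_Delta h GF (gen_Delta h GE (kt m n m n))) = X - Y"
      using lt mn room
      by (cases m; cases n; simp add: E_kt F_kt gen_Delta_simps lift_def diag_fun_simps diag_fun_kt X_def Y_def)
    moreover have "X = - (q ^ m * inverse (q ^ n) * qn n * dual_coeff m n * inverse (q ^ (m + 2)))"
    proof (cases n)
      case (Suc b)
      have nz: "qn (Suc m) \<noteq> 0" using mn Suc lt h by (intro qn_nonzero) auto
      have "qn n * (q * qn n * (dual_coeff (Suc m) b * tsum (Suc m)))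
          = q * qn n * tsum (Suc m) * (q ^ Suc m * dual_coeff (Suc m) n)"
        using dual_coeff_rec(1)[of b "Suc m"] Suc by (simp add: mult_ac)
      also have "\<dots> = qn n * tsum (Suc m) * q ^ m * inverse (q ^ n) * (q ^ n * (q * q) * dual_coeff (Suc m) n)"
        by (simp add: mult_ac)
      also have "\<dots> = qn n * tsum (Suc m) * q ^ m * inverse (q ^ n) * (qn (Suc m) * dual_coeff m n)"
        by (simp only: dual_coeff_rec)
      finally have fin: "qn n * (q * qn n * (dual_coeff (Suc m) b * tsum (Suc m)))
          = qn n * tsum (Suc m) * q ^ m * inverse (q ^ n) * (qn (Suc m) * dual_coeff m n)" .
      have "X = qn n * (q ^ m * inverse (q ^ n) * qn (Suc m) * (dual_coeff m n * tsum m))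
          - qn n * (q * qn n * (dual_coeff (Suc m) b * tsum (Suc m)))"
        by (simp add: X_def Suc right_diff_distrib)
      then have "X = q ^ m * inverse (q ^ n) * qn n * dual_coeff m n * (qn (Suc m) * (tsum m - tsum (Suc m)))"
        unfolding fin by (simp add: algebra_simps)
      also have "qn (Suc m) * (tsum m - tsum (Suc m)) = - inverse (q ^ (m + 2))"
        using nz by (simp add: tsum_Suc)
      finally show ?thesis by simp
    qed (simp add: X_def)
    moreover have "Y = - (q ^ m * inverse (q ^ n) * qn (Suc n) * dual_coeff m n * inverse (q ^ (m + 1)))"
    proof (cases m)
      case 0
      then have "Suc n = h" using mn h by simp
      then show ?thesis by (simp add: Y_def 0)
    next
      case (Suc a)
      have nz: "qn (Suc a) \<noteq> 0" using Suc lt by (intro qn_nonzero) auto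
      have "q ^ m * inverse (q ^ n * q) * qn m * (q ^ a * inverse (q ^ Suc n) * qn m * (dual_coeff a (Suc n) * tsum a))
          = q ^ m * inverse (q ^ n * q) * qn m * q ^ a * inverse (q ^ Suc n) * tsum a * (qn (Suc a) * dual_coeff a (Suc n))"
        using Suc by (simp add: mult_ac)
      also have "\<dots> = q ^ m * inverse (q ^ n) * qn m * tsum a * (q ^ m * dual_coeff m (Suc n))"
        unfolding dual_coeff_rec by (simp add: Suc field_simps)
      also have "\<dots> = q ^ m * inverse (q ^ n) * qn m * tsum a * (qn (Suc n) * dual_coeff m n)"
        unfolding dual_coeff_rec ..
      finally have fin: "q ^ m * inverse (q ^ n * q) * qn m * (q ^ a * inverse (q ^ Suc n) * qn m * (dual_coeff a (Suc n) * tsum a))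
          = q ^ m * inverse (q ^ n) * qn m * tsum a * (qn (Suc n) * dual_coeff m n)" .
      have "Y = q ^ m * inverse (q ^ n * q) * qn m * (q ^ a * inverse (q ^ Suc n) * qn m * (dual_coeff a (Suc n) * tsum a))
          - q ^ m * inverse (q ^ n * q) * qn m * (q * qn (Suc n) * (dual_coeff m n * tsum m))"
        by (simp add: Y_def Suc right_diff_distrib)
      then have "Y = q ^ m * inverse (q ^ n) * qn (Suc n) * dual_coeff m n * (qn m * (tsum a - tsum m))"
        unfolding fin by (simp add: field_simps)
      also have "qn m * (tsum a - tsum m) = - inverse (q ^ (m + 1))"
        using nz by (simp add: tsum_Suc Suc)
      finally show ?thesis by simp
    qed
    moreover have "qn (Suc n) = inverse q * qn n + q ^ n"
      using q_sq_ne by (simp add: qn_eq field_simps)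
    ultimately have "lift (gen_Delta h GF (gen_Delta h GE (kt m n m n))) = inverse q * dual_coeff m n"
      by (simp add: field_simps)
    then show ?thesis using mn lt by (simp add: glevel_def diag_fun_kt)
  next
    case False
    then show ?thesis
      using lt by (cases m; cases n; cases m'; cases n';
        auto simp: E_kt F_kt gen_Delta_simps lift_def glevel_def diag_fun_simps diag_fun_kt)
  qed
qed assumption

end

section \<open>Invariant vectors in the image of a power of A\<close>

context root_order
begin

lemma inv_coeff_nonzero: "m < h \<Longrightarrow> n < h \<Longrightarrow> inv_coeff m n \<noteq> 0"
  by (simp add: inv_coeff_def qnf_nonzero)

lemma lookup_Psi: 
  assumes "m < h" "n < h" "m' < h" "n' < h"
  shows "Poly_Mapping.lookup (Psi j) (idx m n m' n') = (if m = m' \<and> n = n' \<and> m + n = j then inv_coeff m n else 0)"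
proof -
  have "Poly_Mapping.lookup (Psi j) (idx m n m' n')
      = (\<Sum>a\<le>j. if a = m then (if j - m = n \<and> m = m' \<and> n = n' then inv_coeff m n else 0) else 0)"
    unfolding Psi_def lin_fun_sum[OF lin_fun_lookup] using assms
    by (intro sum.cong refl) (auto simp: lookup_kt)
  also have "\<dots> = (if m \<le> j then (if j - m = n \<and> m = m' \<and> n = n' then inv_coeff m n else 0) else 0)"
    by simp
  finally show ?thesis by auto
qed

lemma Hc_keys: "v \<in> Hc \<Longrightarrow> x \<in> Poly_Mapping.keys v \<Longrightarrow>
  \<exists>m n m' n'. m < h \<and> n < h \<and> m' < h \<and> n' < h \<and> x = idx m n m' n'"
  unfolding Hc_eq by (force simp: idx_def elim!: fock_idxE)

lemma Hc_eqI:
  assumes "u \<in> Hc" "v \<in> Hc"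
    and "\<And>m n m' n'. m < h \<Longrightarrow> n < h \<Longrightarrow> m' < h \<Longrightarrow> n' < h \<Longrightarrow>
      Poly_Mapping.lookup u (idx m n m' n') = Poly_Mapping.lookup v (idx m n m' n')"
  shows "u = v"
proof (rule poly_mapping_eqI)
  fix x
  show "Poly_Mapping.lookup u x = Poly_Mapping.lookup v x"
  proof (cases "x \<in> Poly_Mapping.keys u \<or> x \<in> Poly_Mapping.keys v")
    case True
    then show ?thesis using Hc_keys assms by blast
  qed (simp add: in_keys_iff)
qed

lemma kt_idx: "m < h \<Longrightarrow> n < h \<Longrightarrow> m' < h \<Longrightarrow> n' < h \<Longrightarrow> Poly_Mapping.single (idx m n m' n') 1 = kt m n m' n'"
  by (simp add: idx_def kt_single)

text \<open>Invariance under the two Cartan elements forces \<open>p = p'\<close> and \<open>m = m'\<close>.\<close>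

lemma H_inv_diagonal:
  assumes v: "v \<in> H_inv h" and lt: "m < h" "n < h" "m' < h" "n' < h"
    and ne: "Poly_Mapping.lookup v (idx m n m' n') \<noteq> 0"
  shows "m = m' \<and> n = n'"
proof -
  have vH: "v \<in> Hc" by (rule H_inv_Hc[OF v])
  have "Poly_Mapping.lookup (gen_Delta h Khalf v) (idx m n m' n')
      = r ^ m * r ^ n' / (r ^ n * r ^ m') * Poly_Mapping.lookup v (idx m n m' n')"
    by (rule Hc_fun_ext[OF lin_fun_comp[OF lin_fun_lookup gen_Delta_lin] lin_fun_scale[OF lin_fun_lookup] vH])
       (auto simp: K_Delta_kt lookup_kt)
  moreover have "Poly_Mapping.lookup (gen_B h Khalf v) (idx m n m' n')
      = r ^ m * r ^ n / (r ^ m' * r ^ n') * Poly_Mapping.lookup v (idx m n m' n')"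
    by (rule Hc_fun_ext[OF lin_fun_comp[OF lin_fun_lookup gen_B_lin] lin_fun_scale[OF lin_fun_lookup] vH])
       (auto simp: K_B_kt lookup_kt)
  moreover have "gen_Delta h Khalf v = v" "gen_B h Khalf v = v"
    using v by (simp_all add: H_inv_iff)
  ultimately have 1: "r ^ m * r ^ n' = r ^ n * r ^ m'" and 2: "r ^ m * r ^ n = r ^ m' * r ^ n'"
    using ne by (simp_all add: divide_simps)
  have q_r: "q ^ i = r ^ i * r ^ i" for i by (simp add: r_sq[symmetric] power_mult_distrib)
  have "(r ^ m * r ^ n') * (r ^ m * r ^ n) = (r ^ n * r ^ m') * (r ^ m' * r ^ n')"
    by (simp only: 1 2)
  then have "q ^ m * (r ^ n * r ^ n') = q ^ m' * (r ^ n * r ^ n')" unfolding q_r by (simp only: mult_ac)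
  then have "q ^ m = q ^ m'" by simp
  moreover have "(r ^ m * r ^ n') * (r ^ m' * r ^ n') = (r ^ n * r ^ m') * (r ^ m * r ^ n)"
    by (simp only: 1 2)
  then have "q ^ n' * (r ^ m * r ^ m') = q ^ n * (r ^ m * r ^ m')" unfolding q_r by (simp only: mult_ac)
  then have "q ^ n' = q ^ n" by simp
  ultimately show ?thesis using q_power_inj lt by metis
qed

text \<open>An invariant vector is diagonal, and its coefficients along each antidiagonal obey the first-order
  recursion of \<open>inv_coeff\<close>, so they are determined by one of them.\<close>

lemma H_inv_span:
  assumes v: "v \<in> H_inv h"
  obtains \<alpha> where "v = (\<Sum>j<2 * h - 1. scale (\<alpha> j) (Psi j))"
proof -
  have vH: "v \<in> Hc" by (rule H_inv_Hc[OF v])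
  define c where "c m n = Poly_Mapping.lookup v (idx m n m n)" for m n
  define \<beta> where "\<beta> m n = c m n / inv_coeff m n" for m n
  have E: "qn (Suc n) * c m (Suc n) - q ^ m * (inverse (q ^ n) * (qn (Suc m) * c (Suc m) n)) = 0"
    if lt: "Suc m < h" "Suc n < h" for m n
  proof -
    let ?x = "idx (Suc m) n m (Suc n)"
    have "Poly_Mapping.lookup (gen_Delta h GE v) ?x
        = qn (Suc n) * Poly_Mapping.lookup v (idx m (Suc n) m (Suc n))
          - q ^ m * inverse (q ^ n) * qn (Suc m) * Poly_Mapping.lookup v (idx (Suc m) n (Suc m) n)"
    proof (rule lin_fun_ext[OF lin_fun_comp[OF lin_fun_lookup gen_Delta_lin]
          lin_fun_diff[OF lin_fun_scale[OF lin_fun_lookup] lin_fun_scale[OF lin_fun_lookup]]])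
      fix x assume x: "x \<in> Poly_Mapping.keys v"
      obtain a b a' b' where ab: "a < h" "b < h" "a' < h" "b' < h" "x = idx a b a' b'"
        using Hc_keys[OF vH x] by blast
      then have "a' = a" "b' = b" using H_inv_diagonal[OF v ab(1-4)] x by (auto simp: in_keys_iff)
      then have x: "Poly_Mapping.single x 1 = kt a b a b" using ab by (simp add: kt_idx)
      show "Poly_Mapping.lookup (gen_Delta h GE (Poly_Mapping.single x 1)) ?x
        = qn (Suc n) * Poly_Mapping.lookup (Poly_Mapping.single x 1) (idx m (Suc n) m (Suc n))
          - q ^ m * inverse (q ^ n) * qn (Suc m) * Poly_Mapping.lookup (Poly_Mapping.single x 1) (idx (Suc m) n (Suc m) n)"
        unfolding x using lt ab
        by (cases a; cases b; auto simp: E_kt lookup_minus lookup_kt)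
    qed
    moreover have "gen_Delta h GE v = 0" using v by (simp add: H_inv_iff)
    ultimately show ?thesis by (simp add: c_def mult.assoc)
  qed
  have step: "\<beta> m (Suc n) = \<beta> (Suc m) n" if lt: "Suc m < h" "Suc n < h" for m n
  proof -
    define X where "X = qn (Suc n) * inv_coeff m (Suc n)"
    have X: "X = q ^ m * (inverse (q ^ n) * (qn (Suc m) * inv_coeff (Suc m) n))"
      unfolding X_def by (rule inv_coeff_rec[OF lt])
    have nz: "inv_coeff m (Suc n) \<noteq> 0" "inv_coeff (Suc m) n \<noteq> 0" "X \<noteq> 0"
      using lt by (simp_all add: inv_coeff_nonzero X_def qn_nonzero)
    have "qn (Suc n) * c m (Suc n) = \<beta> m (Suc n) * X"
      using nz by (simp add: \<beta>_def X_def)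
    moreover have "q ^ m * (inverse (q ^ n) * (qn (Suc m) * c (Suc m) n)) = \<beta> (Suc m) n * X"
      using nz by (simp add: \<beta>_def X)
    ultimately show ?thesis using E[OF lt] nz by simp
  qed
  have shift: "\<beta> m (n + d) = \<beta> (m + d) n" if "m + d < h" "n + d < h" for m n d
    using that
  proof (induction d arbitrary: n)
    case (Suc d)
    have "\<beta> m (n + Suc d) = \<beta> m (Suc n + d)" by simp
    also have "\<dots> = \<beta> (m + d) (Suc n)" using Suc by (intro Suc.IH) auto
    also have "\<dots> = \<beta> (Suc (m + d)) n" using Suc by (intro step) auto
    finally show ?case by simp
  qed simp
  define \<alpha> where "\<alpha> j = \<beta> (j - (h - 1)) (j - (j - (h - 1)))" for j
  have \<alpha>: "\<alpha> (m + n) = \<beta> m n" if "m < h" "n < h" for m n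
  proof -
    define a where "a = m + n - (h - 1)"
    have "a \<le> m" "n + (m - a) < h" using that by (auto simp: a_def)
    then have "\<beta> a (n + (m - a)) = \<beta> m n" using shift[of a "m - a" n] that by simp
    moreover have "m + n - a = n + (m - a)" using \<open>a \<le> m\<close> by simp
    ultimately show ?thesis by (simp add: \<alpha>_def a_def)
  qed
  have "v = (\<Sum>j<2 * h - 1. scale (\<alpha> j) (Psi j))"
  proof (rule Hc_eqI[OF vH])
    have "(\<Sum>j\<in>A. scale (\<alpha> j) (Psi j)) \<in> Hc" for A
      by (induction A rule: infinite_finite_induct) (auto intro: Hc.S_zero Hc.S_add Hc.S_scale Psi_Hc)
    then show "(\<Sum>j<2 * h - 1. scale (\<alpha> j) (Psi j)) \<in> Hc" .
    fix m n m' n' assume lt: "m < h" "n < h" "m' < h" "n' < h"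
    have range: "m + n < 2 * h - 1" using lt by simp
    have "Poly_Mapping.lookup (\<Sum>j<2 * h - 1. scale (\<alpha> j) (Psi j)) (idx m n m' n')
        = (\<Sum>j<2 * h - 1. if j = m + n then (if m = m' \<and> n = n' then \<alpha> (m + n) * inv_coeff m n else 0) else 0)"
      unfolding lin_fun_sum[OF lin_fun_lookup] by (intro sum.cong refl) (auto simp: lookup_Psi lt)
    also have "\<dots> = (if m = m' \<and> n = n' then \<alpha> (m + n) * inv_coeff m n else 0)"
      using range by simp
    also have "\<dots> = Poly_Mapping.lookup v (idx m n m' n')"
    proof (cases "m = m' \<and> n = n'")
      case True
      then show ?thesis using lt \<alpha>[of m n] by (auto simp: \<beta>_def c_def inv_coeff_nonzero)
    next
      case False
      then show ?thesis using H_inv_diagonal[OF v lt] by auto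
    qed
    finally show "Poly_Mapping.lookup v (idx m n m' n')
        = Poly_Mapping.lookup (\<Sum>j<2 * h - 1. scale (\<alpha> j) (Psi j)) (idx m n m' n')" by simp
  qed
  then show ?thesis using that by blast
qed

text \<open>The pairing of \<open>g\<^sub>j\<close> and \<open>\<Psi>\<^sub>j\<close> is the sum of
  \<open>q\<^bsup>-2m\<^esup>\<close> over \<open>m \<le> j\<close>, a
  \<open>q\<^sup>2\<close>-integer up to a power of \<open>q\<close>.\<close>

lemma glevel_Psi: "i \<noteq> j \<Longrightarrow> glevel j (Psi i) = 0" "Suc j < h \<Longrightarrow> glevel j (Psi j) \<noteq> 0"
proof -
  have sum: "glevel j (Psi i) = (\<Sum>m\<le>i. inv_coeff m (i - m) * glevel j (kt m (i - m) m (i - m)))" for i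
    by (simp add: Psi_def lin_fun_sum[OF glevel_lin] lin_fun_simps[OF glevel_lin])
  show "glevel j (Psi i) = 0" if "i \<noteq> j"
    unfolding sum using that by (intro sum.neutral) (auto simp: glevel_def diag_fun_kt)
  assume j: "Suc j < h"
  have "glevel j (Psi j) = (\<Sum>m\<le>j. inverse (q ^ (2 * m)))"
    unfolding sum using j
    by (intro sum.cong refl) (auto simp: glevel_def diag_fun_kt inv_coeff_def dual_coeff_def qnf_nonzero field_simps)
  also have "q ^ (2 * j) * \<dots> = (\<Sum>m\<le>j. q ^ (2 * (j - m)))"
    unfolding sum_distrib_left by (intro sum.cong refl) (simp add: power_diff diff_mult_distrib2 divide_inverse)
  also have "\<dots> = (\<Sum>m\<le>j. q ^ (2 * m))" by (rule sum.reindex_bij_witness[of _ "\<lambda>m. j - m" "\<lambda>m. j - m"]) auto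
  finally have "q ^ (2 * j) * glevel j (Psi j) = qint (Suc j)" by (simp add: qint_def lessThan_Suc_atMost)
  then show "glevel j (Psi j) \<noteq> 0" using qint_nonzero[of "Suc j"] j by auto
qed

lemma glevel_opA_pow: "v \<in> Hc \<Longrightarrow> glevel j ((opA h ^^ n) v) = (\<Prod>i<n. q * qn (Suc (j + i))) * glevel (j + n) v"
proof (induction n arbitrary: v)
  case (Suc n)
  have "(opA h ^^ Suc n) v = (opA h ^^ n) (opA h v)" by (simp add: funpow_swap1)
  then show ?case
    using Suc.IH[of "opA h v"] lin_endD(1)[OF opA_Hc Suc.prems] glevel_A[OF Suc.prems, of "j + n"] by simp
qed simp

lemma opA_pow_image_subspace: "subspace_of scale ((opA h ^^ n) ` H_inv h)"
proof unfold_locales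
  show "0 \<in> (opA h ^^ n) ` H_inv h"
    using HI.S_zero by (intro image_eqI[of _ _ 0]) (simp_all add: opA_pow_simps)
qed (auto simp: HI.S_add HI.S_scale simp flip: opA_pow_simps)

text \<open>The functionals show that the coefficient of \<open>\<Psi>\<^bsub>k-1\<^esub>\<close> is 0. As
  \<open>A\<^sup>k v = A\<^sup>h \<omega> = 0\<close>, all other coefficients that do not vanish
  belong to vectors \<open>\<Psi>\<^sub>j\<close> that lie at least \<open>h - k\<close> steps
  from the top of their Jordan chain.\<close>

lemma invariant_in_image:
  assumes k: "0 < k" "k < h" and v: "v \<in> H_inv h" and \<omega>: "\<omega> \<in> Hc" "v = (opA h ^^ (h - k)) \<omega>"
    and E: "\<eta> \<in> Hc" "gen_Delta h GE \<omega> = opA h \<eta>"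
  shows "v \<in> (opA h ^^ (h - k)) ` H_inv h"
proof -
  interpret Im: subspace_of scale "(opA h ^^ (h - k)) ` H_inv h" by (rule opA_pow_image_subspace)
  obtain \<alpha> where \<alpha>: "v = (\<Sum>j<2 * h - 1. scale (\<alpha> j) (Psi j))" using H_inv_span[OF v] .
  have "inverse q * glevel (h - 1) \<omega> = lift (gen_Delta h GF (opA h \<eta>))"
    using lift_FE[OF \<omega>(1)] E by simp
  also have "\<dots> = glevel h (gen_Delta h GF \<eta>)"
    using lift_A[of "gen_Delta h GF \<eta>"] lin_endD(1)[OF gen_Delta_Hc E(1)] A_comm(1)[OF E(1)] by simp
  also have "\<dots> = 0" by (rule glevel_F[OF E(1)])
  finally have "glevel (h - 1) \<omega> = 0" by simp
  then have "glevel (k - 1) v = 0"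
    using k by (simp add: \<omega>(2) glevel_opA_pow[OF \<omega>(1)])
  moreover have "glevel (k - 1) v = (\<Sum>j<2 * h - 1. if j = k - 1 then \<alpha> (k - 1) * glevel (k - 1) (Psi (k - 1)) else 0)"
    unfolding \<alpha> lin_fun_sum[OF glevel_lin]
    by (intro sum.cong refl) (auto simp: lin_fun_simps[OF glevel_lin] glevel_Psi)
  ultimately have \<alpha>k: "\<alpha> (k - 1) = 0"
    using k glevel_Psi(2)[of "k - 1"] by (simp add: less_diff_conv split: if_splits)
  have "(opA h ^^ k) v = (opA h ^^ (k + (h - k))) \<omega>" by (simp only: \<omega>(2) funpow_add o_apply)
  then have Ak: "(opA h ^^ k) v = 0" using k opA_nilpotent[OF \<omega>(1)] by simp
  \<comment> \<open>The product of the factors \<open>[i + 2], \<dots>, [i + k + 1]\<close> picked up on the way to level \<open>i\<close> avoids \<open>[h]\<close>.\<close>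
  have \<alpha>0: "\<alpha> (i + k) = 0" if i: "i + k < 2 * h - 1" and ne: "\<And>l. l < k \<Longrightarrow> i + 2 + l \<noteq> h" for i
  proof -
    \<comment> \<open>A point \<open>(a, i - a)\<close> of the antidiagonal that lies in the square of side \<open>h\<close>, for reading off a coefficient.\<close>
    define a where "a = i - (h - 1)"
    have a: "a < h" "i - a < h" "a \<le> i" using i by (auto simp: a_def)
    define C where "C = (\<Prod>l<k. qn (i + 2 + l))"
    have C: "C \<noteq> 0"
    proof -
      have "qn (i + 2 + l) \<noteq> 0" if "l < k" for l
        using ne[OF that] i that qn_nonzero[of "i + 2 + l"] qn_nonzero'[of "i + 2 + l"]
        by (cases "i + 2 + l < h") auto
      then show ?thesis by (simp add: C_def)
    qed
    have "Poly_Mapping.lookup ((opA h ^^ k) v) (idx a (i - a) a (i - a))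
        = (\<Sum>j<2 * h - 1. \<alpha> j * Poly_Mapping.lookup ((opA h ^^ k) (Psi j)) (idx a (i - a) a (i - a)))"
      unfolding \<alpha> by (simp add: sum_hvec[OF lin_UNIV_funpow[OF opA_lin]] opA_pow_simps lookup_sum)
    also have "\<dots> = (\<Sum>j<2 * h - 1. if j = i + k then \<alpha> (i + k) * (C * inv_coeff a (i - a)) else 0)"
    proof (intro sum.cong refl)
      fix j
      show "\<alpha> j * Poly_Mapping.lookup ((opA h ^^ k) (Psi j)) (idx a (i - a) a (i - a))
          = (if j = i + k then \<alpha> (i + k) * (C * inv_coeff a (i - a)) else 0)"
      proof (cases "j < k")
        case True
        then show ?thesis by (simp add: opA_pow_Psi_0)
      next
        case False
        then obtain j' where j: "j = j' + k" by (metis add.commute le_Suc_ex not_less)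
        show ?thesis using a unfolding j opA_pow_Psi by (auto simp: lookup_Psi C_def)
      qed
    qed
    also have "\<dots> = \<alpha> (i + k) * (C * inv_coeff a (i - a))" using i by simp
    finally show ?thesis using Ak C a inv_coeff_nonzero[of a "i - a"] by simp
  qed
  have "scale (\<alpha> j) (Psi j) \<in> (opA h ^^ (h - k)) ` H_inv h" if j: "j < 2 * h - 1" for j
  proof (cases "\<alpha> j = 0")
    case True
    then show ?thesis by (simp add: Im.S_zero)
  next
    case False
    then have jk: "j \<noteq> k - 1" using \<alpha>k by auto
    have not_killed: "j + 2 + l \<noteq> h \<and> j + (h - k) < 2 * h - 1" if "l < h - k" for l
    proof (cases "k \<le> j")
      case True
      then have "\<exists>l<k. j - k + 2 + l = h" using \<alpha>0[of "j - k"] False j by auto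
      then show ?thesis using True k that by auto
    next
      case False
      then show ?thesis using jk k that by auto
    qed
    define C where "C = (\<Prod>l<h - k. qn (j + 2 + l))"
    have C: "C \<noteq> 0"
    proof -
      have "qn (j + 2 + l) \<noteq> 0" if "l < h - k" for l
      proof -
        have "j + 2 + l < 2 * h" using not_killed[OF that] that by linarith
        then show ?thesis
          using not_killed[OF that] qn_nonzero[of "j + 2 + l"] qn_nonzero'[of "j + 2 + l"]
          by (cases "j + 2 + l < h") auto
      qed
      then show ?thesis by (simp add: C_def)
    qed
    have "(opA h ^^ (h - k)) (scale (inverse C) (Psi (j + (h - k)))) = Psi j"
      using C by (simp only: opA_pow_simps opA_pow_Psi C_def[symmetric] hv.scale_scale) simp
    then have "Psi j \<in> (opA h ^^ (h - k)) ` H_inv h"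
      by (metis HI.S_scale Psi_H_inv imageI)
    then show ?thesis by (rule Im.S_scale)
  qed
  then have "(\<Sum>j\<in>A. scale (\<alpha> j) (Psi j)) \<in> (opA h ^^ (h - k)) ` H_inv h" if "A \<subseteq> {..<2 * h - 1}" for A
    using that
    by (induction A rule: infinite_finite_induct) (auto simp: Im.S_zero Im.S_add)
  then show ?thesis unfolding \<alpha> by blast
qed

end

section \<open>Cochains\<close>

context root_order
begin

lemma Uq_smult_closed: "X \<in> carrier (Uq h) \<Longrightarrow> c \<odot>\<^bsub>Uq h\<^esub> X \<in> carrier (Uq h)"
proof -
  assume "X \<in> carrier (Uq h)"
  then obtain x where x: "x \<in> carrier U.U.MA" "X = U.U.I +>\<^bsub>U.U.MA\<^esub> x"
    using U.U.elem_A[unfolded U.U_A] by blast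
  have "c \<odot>\<^bsub>U.U.A\<^esub> X = U.U.I +>\<^bsub>U.U.MA\<^esub> scale c x"
    unfolding x(2) by (rule coset_scale[OF U.monoid_pairs U.U.ideal_I x(1)])
  moreover have "scale c x \<in> carrier U.U.MA"
    using x(1) subset_trans[OF keys_scale] by simp
  ultimately show ?thesis
    using U.U.coset_in_A unfolding U.U_A by metis
qed

lemma counit_laws:
  assumes "X \<in> carrier (Uq h)" "Y \<in> carrier (Uq h)"
  shows "Uq_counit (X \<oplus>\<^bsub>Uq h\<^esub> Y) = Uq_counit X + Uq_counit Y"
    "Uq_counit (X \<otimes>\<^bsub>Uq h\<^esub> Y) = Uq_counit X * Uq_counit Y"
    "Uq_counit (c \<odot>\<^bsub>Uq h\<^esub> X) = c * Uq_counit X"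
    "Uq_counit \<one>\<^bsub>Uq h\<^esub> = 1" "Uq_counit (gen_left h GE) = 0"
proof -
  interpret C: uq_module "(*)" "UNIV :: complex set" h "\<lambda>x v. counit_gen x * v" "\<lambda>x v. counit_gen x * v"
    by (rule counit_uq_module[OF h])
  interpret R: ring "Uq h" by (rule U.ring_Uq)
  note eq = Uq_counit_eq[OF h]
  show "Uq_counit (X \<oplus>\<^bsub>Uq h\<^esub> Y) = Uq_counit X + Uq_counit Y"
    using assms by (simp only: eq R.a_closed C.uact_add UNIV_I)
  show "Uq_counit (c \<odot>\<^bsub>Uq h\<^esub> X) = c * Uq_counit X"
    using assms by (simp only: eq Uq_smult_closed C.uact_scale UNIV_I)
  show "Uq_counit \<one>\<^bsub>Uq h\<^esub> = 1"
    by (simp only: eq R.one_closed C.uact_one UNIV_I)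
  show "Uq_counit (gen_left h GE) = 0"
    by (simp only: eq U.gen_left_closed C.uact_gen_left UNIV_I counit_gen.simps mult_zero_left)
  have "C.uact X (C.uact Y 1) = C.uact X (C.uact Y 1 * 1)" by (simp only: mult_1_right)
  also have "\<dots> = C.uact Y 1 * C.uact X 1"
    by (rule lin_endD(3)[OF C.uact_lin]) (use assms in simp_all)
  finally have XY: "C.uact X (C.uact Y 1) = C.uact Y 1 * C.uact X 1" .
  have "Uq_counit (X \<otimes>\<^bsub>Uq h\<^esub> Y) = C.uact Y 1 * C.uact X 1"
    using assms XY by (simp only: eq R.m_closed C.uact_mult UNIV_I)
  also have "\<dots> = Uq_counit X * Uq_counit Y"
    unfolding eq[OF assms(1)] eq[OF assms(2)] by (rule mult.commute)
  finally show "Uq_counit (X \<otimes>\<^bsub>Uq h\<^esub> Y) = Uq_counit X * Uq_counit Y" .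
qed

lemma act_Hc: "X \<in> carrier (Uq h) \<Longrightarrow> v \<in> Hc \<Longrightarrow> Uq_act h X v \<in> Hc"
  and act_add: "X \<in> carrier (Uq h) \<Longrightarrow> u \<in> Hc \<Longrightarrow> v \<in> Hc \<Longrightarrow> Uq_act h X (u + v) = Uq_act h X u + Uq_act h X v"
  and act_scale: "X \<in> carrier (Uq h) \<Longrightarrow> v \<in> Hc \<Longrightarrow> Uq_act h X (scale c v) = scale c (Uq_act h X v)"
  using U.uact_lin[of X] by (simp_all add: Uq_act_eq lin_end_def)

lemma act_diff: "X \<in> carrier (Uq h) \<Longrightarrow> u \<in> Hc \<Longrightarrow> v \<in> Hc \<Longrightarrow> Uq_act h X (u - v) = Uq_act h X u - Uq_act h X v"
  using act_add[of X u "scale (-1) v"] act_scale[of X v "-1"] Hc.S_scale[of v "-1"] by simp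

lemma act_0: "X \<in> carrier (Uq h) \<Longrightarrow> Uq_act h X 0 = 0"
  using act_scale[of X 0 0] Hc.S_zero by simp

lemma act_opA: 
  assumes "X \<in> carrier (Uq h)" "v \<in> Hc"
  shows "Uq_act h X (opA h v) = opA h (Uq_act h X v)"
  unfolding Uq_act_eq
  by (rule uact_intertwine[OF H_module H_module, symmetric])
     (use assms lin_endD(1)[OF opA_Hc] in \<open>simp_all add: opA_simps A_comm\<close>)

text \<open>\<open>X\<^sub>1 \<cdots> X\<^bsub>n-1\<^esub> (X\<^sub>n - \<epsilon>(X\<^sub>n)) v\<close>\<close>

fun aug_act :: "uq list \<Rightarrow> hvec \<Rightarrow> hvec" where
  "aug_act [] v = v"
| "aug_act [X] v = Uq_act h X v - scale (Uq_counit X) v"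
| "aug_act (X # Y # xs) v = Uq_act h X (aug_act (Y # xs) v)"

lemma aug_act_Cons: "xs \<noteq> [] \<Longrightarrow> aug_act (X # xs) v = Uq_act h X (aug_act xs v)"
  by (cases xs) simp_all

lemma aug_act_Hc: "set xs \<subseteq> carrier (Uq h) \<Longrightarrow> v \<in> Hc \<Longrightarrow> aug_act xs v \<in> Hc"
  by (induction xs v rule: aug_act.induct) (simp_all add: act_Hc Hc_diff Hc.S_scale)

lemma aug_act_lin:
  assumes "set xs \<subseteq> carrier (Uq h)" "u \<in> Hc" "v \<in> Hc"
  shows "aug_act xs (u + v) = aug_act xs u + aug_act xs v"
    "aug_act xs (scale c v) = scale c (aug_act xs v)"
    "aug_act xs (opA h v) = opA h (aug_act xs v)"
  using assms
  by (induction xs v rule: aug_act.induct)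
     (simp_all add: act_add act_scale act_opA aug_act_Hc hv.scale_right_distrib hv.scale_right_diff_distrib
       opA_simps mult.commute)

lemma aug_act_H_inv: 
  assumes "set xs \<subseteq> carrier (Uq h)" "xs \<noteq> []" "v \<in> H_inv h"
  shows "aug_act xs v = 0"
  using assms by (induction xs v rule: aug_act.induct) (simp_all add: H_inv_def act_0)

text \<open>Since \<open>1\<close> acts trivially, these arguments recover the action of \<open>X -
  \<epsilon>(X)\<close>.\<close>

lemma aug_act_ones:
  assumes "X \<in> carrier (Uq h)" "v \<in> Hc"
  shows "aug_act (replicate n \<one>\<^bsub>Uq h\<^esub> @ [X]) v = Uq_act h X v - scale (Uq_counit X) v"
proof (induction n)
  case (Suc n)
  then show ?case
    using assms by (simp add: aug_act_Cons Uq_act_eq[of "\<one>\<^bsub>Uq h\<^esub>"] U.uact_one act_Hc Hc_diff Hc.S_scale)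
qed simp

lemma aug_act_update:
  assumes "set xs \<subseteq> carrier (Uq h)" "i < length xs" "Y \<in> carrier (Uq h)" "v \<in> Hc"
  shows "aug_act (xs[i := xs ! i \<oplus>\<^bsub>Uq h\<^esub> Y]) v = aug_act xs v + aug_act (xs[i := Y]) v"
    "aug_act (xs[i := c \<odot>\<^bsub>Uq h\<^esub> xs ! i]) v = scale c (aug_act xs v)"
proof -
  have "aug_act (xs[i := xs ! i \<oplus>\<^bsub>Uq h\<^esub> Y]) v = aug_act xs v + aug_act (xs[i := Y]) v \<and>
    aug_act (xs[i := c \<odot>\<^bsub>Uq h\<^esub> xs ! i]) v = scale c (aug_act xs v)"
    using assms
  proof (induction xs arbitrary: i)
    case (Cons X xs)
    have X: "X \<in> carrier (Uq h)" and xs: "set xs \<subseteq> carrier (Uq h)" using Cons.prems by auto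
    show ?case
    proof (cases i)
      case 0
      show ?thesis
      proof (cases "xs = []")
        case True
        then show ?thesis using X Cons.prems 0
          by (simp add: Uq_act_eq U.uact_add U.uact_scale counit_laws hv.scale_left_distrib hv.scale_right_diff_distrib)
      next
        case False
        then show ?thesis using X Cons.prems 0 aug_act_Hc[OF xs, of v]
          by (simp add: aug_act_Cons Uq_act_eq U.uact_add U.uact_scale)
      qed
    next
      case (Suc j)
      then have j: "j < length xs" using Cons.prems by simp
      then have ne: "xs \<noteq> []" by auto
      have "set (xs[j := Y]) \<subseteq> carrier (Uq h)"
        using xs Cons.prems by (meson insert_subset set_update_subset_insert subset_trans)
      then show ?thesis
        using Cons.IH[OF xs j Cons.prems(3,4)] X xs Cons.prems ne Suc
        by (simp add: aug_act_Cons act_add act_scale aug_act_Hc)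
    qed
  qed simp
  then show "aug_act (xs[i := xs ! i \<oplus>\<^bsub>Uq h\<^esub> Y]) v = aug_act xs v + aug_act (xs[i := Y]) v"
    "aug_act (xs[i := c \<odot>\<^bsub>Uq h\<^esub> xs ! i]) v = scale c (aug_act xs v)" by blast+
qed

lemma merge_1: "merge h 1 (X # Y # xs) = (X \<otimes>\<^bsub>Uq h\<^esub> Y) # xs"
  by (simp add: merge_def)

lemma merge_Suc: "0 < k \<Longrightarrow> merge h (Suc k) (X # xs) = X # merge h k xs"
  by (cases k) (simp_all add: merge_def)

lemma merge_not_Nil: "merge h k xs \<noteq> []"
  by (simp add: merge_def)

text \<open>Merging two neighbours does not change the product, except at the end, where the factor \<open>X -
  \<epsilon>(X)\<close> is not multiplicative; see \<open>aug_act_merge_last\<close>.\<close>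

lemma aug_act_merge:
  assumes "set xs \<subseteq> carrier (Uq h)" "0 < k" "Suc k < length xs" "v \<in> Hc"
  shows "aug_act (merge h k xs) v = aug_act xs v"
  using assms
proof (induction xs arbitrary: k)
  case (Cons X xs)
  have X: "X \<in> carrier (Uq h)" and xs: "set xs \<subseteq> carrier (Uq h)" using Cons.prems by auto
  show ?case
  proof (cases "k = 1")
    case True
    then obtain Y Z zs where Y: "xs = Y # Z # zs"
      using Cons.prems by (cases xs rule: aug_act.cases[of "(xs, v)" for xs]) auto
    have Y': "Y \<in> carrier (Uq h)" and zs: "set (Z # zs) \<subseteq> carrier (Uq h)" using xs Y by auto
    show ?thesis
      unfolding True Y merge_1
      using X Y' aug_act_Hc[OF zs Cons.prems(4)] by (simp add: aug_act_Cons Uq_act_eq U.uact_mult)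
  next
    case False
    then obtain j where k: "k = Suc j" "0 < j" using Cons.prems by (cases k) auto
    have ne: "xs \<noteq> []" using Cons.prems by auto
    show ?thesis
      unfolding k(1) merge_Suc[OF k(2)]
      using Cons.IH[of j] k xs Cons.prems ne by (simp add: aug_act_Cons merge_not_Nil)
  qed
qed simp

text \<open>This is \<open>X Y - \<epsilon>(X Y) - (X - \<epsilon>(X)) \<epsilon>(Y) = X (Y -
  \<epsilon>(Y))\<close>.\<close>

lemma aug_act_merge_last:
  assumes "set xs \<subseteq> carrier (Uq h)" "0 < k" "length xs = Suc k" "v \<in> Hc"
  shows "aug_act (merge h k xs) v - scale (Uq_counit (last xs)) (aug_act (butlast xs) v) = aug_act xs v"
  using assms
proof (induction xs arbitrary: k)
  case (Cons X xs)
  have X: "X \<in> carrier (Uq h)" and xs: "set xs \<subseteq> carrier (Uq h)" using Cons.prems by auto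
  show ?case
  proof (cases "k = 1")
    case True
    then obtain Y where Y: "xs = [Y]" using Cons.prems by (cases xs) auto
    then have Y': "Y \<in> carrier (Uq h)" using xs by auto
    have "Uq_act h (X \<otimes>\<^bsub>Uq h\<^esub> Y) v = Uq_act h X (Uq_act h Y v)"
      unfolding Uq_act_eq by (rule U.uact_mult[OF X Y' Cons.prems(4)])
    then show ?thesis
      unfolding True Y merge_1
      using X Y' Cons.prems(4)
      by (simp add: counit_laws act_diff act_scale act_Hc Hc.S_scale
          hv.scale_right_diff_distrib mult.commute)
  next
    case False
    then obtain j where k: "k = Suc j" "0 < j" using Cons.prems by (cases k) auto
    have len: "length xs = Suc j" using Cons.prems k by simp
    then have ne: "xs \<noteq> []" "butlast xs \<noteq> []" using k by (auto simp: neq_Nil_conv length_Suc_conv)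
    have IH: "aug_act (merge h j xs) v - scale (Uq_counit (last xs)) (aug_act (butlast xs) v) = aug_act xs v"
      using Cons.IH[OF xs k(2) len Cons.prems(4)] .
    have bl: "set (butlast xs) \<subseteq> carrier (Uq h)" using xs by (meson in_set_butlastD subset_code(1))
    have m: "aug_act (merge h j xs) v = aug_act xs v + scale (Uq_counit (last xs)) (aug_act (butlast xs) v)"
      using IH by (simp add: algebra_simps)
    show ?thesis
      unfolding k(1) merge_Suc[OF k(2)]
      using X xs bl ne Cons.prems(4)
      by (simp add: aug_act_Cons merge_not_Nil m act_add act_scale aug_act_Hc Hc.S_scale)
  qed
qed simp

text \<open>The cochain \<open>d\<^sup>n v\<close>, by \<open>cochain_d_dcochain\<close>.\<close>

definition dcochain :: "nat \<Rightarrow> hvec \<Rightarrow> uq list \<Rightarrow> hvec" where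
  "dcochain n v xs = (if xs \<in> args h n then scale (qfact n) (aug_act xs v) else 0)"

lemma args_Suc: "xs \<in> args h (Suc n) \<Longrightarrow> tl xs \<in> args h n \<and> butlast xs \<in> args h n \<and> hd xs \<in> carrier (Uq h)
    \<and> last xs \<in> carrier (Uq h) \<and> xs \<noteq> []"
  by (cases xs) (auto simp: args_def dest: in_set_butlastD split: if_splits)

lemma merge_args:
  assumes "xs \<in> args h (Suc n)" "0 < k" "k \<le> n"
  shows "merge h k xs \<in> args h n"
proof -
  interpret R: ring "Uq h" by (rule U.ring_Uq)
  have "xs ! (k - 1) \<in> carrier (Uq h)" "xs ! k \<in> carrier (Uq h)"
    using assms by (auto simp: args_def subset_iff)
  moreover have "set (take (k - 1) xs) \<subseteq> carrier (Uq h)" "set (drop (k + 1) xs) \<subseteq> carrier (Uq h)"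
    using assms set_take_subset[of "k - 1" xs] set_drop_subset[of "k + 1" xs] by (auto simp: args_def)
  ultimately show ?thesis using assms by (auto simp: args_def merge_def)
qed

text \<open>Every term of the differential reproduces the same value: the first one and the inner mergings
  directly, the last merging together with the counit term by \<open>aug_act_merge_last\<close>.
  The powers of \<open>q\<^sup>2\<close> add up to the \<open>q\<^sup>2\<close>-integer that turns
  \<open>[n]!\<close> into \<open>[n + 1]!\<close>.\<close>

lemma cochain_d_dcochain: 
  assumes v: "v \<in> Hc"
  shows "cochain_d h n (dcochain n v) = dcochain (Suc n) v"
proof
  fix xs
  show "cochain_d h n (dcochain n v) xs = dcochain (Suc n) v xs"
  proof (cases "xs \<in> args h (Suc n)")
    case True
    note args = args_Suc[OF True]
    have xs: "set xs \<subseteq> carrier (Uq h)" "length xs = Suc n" using True by (simp_all add: args_def)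
    show ?thesis
    proof (cases "n = 0")
      case True
      then obtain X where "xs = [X]" using xs by (auto simp: length_Suc_conv)
      then show ?thesis using True xs by (simp add: cochain_d_def dcochain_def args_def qfact_Suc qint_def)
    next
      case False
      have tl: "set (tl xs) \<subseteq> carrier (Uq h)" "tl xs \<noteq> []"
        using args False xs(2) by (auto simp: args_def) (cases xs; auto)
      have first: "Uq_act h (hd xs) (dcochain n v (tl xs)) = scale (qfact n) (aug_act xs v)"
        using args tl v aug_act_Cons[of "tl xs" "hd xs" v]
        by (simp add: dcochain_def act_scale aug_act_Hc)
      have range: "{1..n} = insert n {1..<n}" using False by auto
      have "(\<Sum>k = 1..n. scale (qpow h 1 ^ (2 * k)) (dcochain n v (merge h k xs)))
          = (\<Sum>k = 1..n. scale (q ^ (2 * k) * qfact n) (aug_act (merge h k xs) v))"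
        using merge_args[OF True] by (intro sum.cong refl) (simp add: dcochain_def q_def)
      also have "\<dots> = scale (q ^ (2 * n) * qfact n) (aug_act (merge h n xs) v)
            + (\<Sum>k = 1..<n. scale (q ^ (2 * k) * qfact n) (aug_act xs v))"
        unfolding range using aug_act_merge[OF xs(1) _ _ v] xs by simp
      also have "aug_act (merge h n xs) v = aug_act xs v + scale (Uq_counit (last xs)) (aug_act (butlast xs) v)"
        using aug_act_merge_last[OF xs(1) _ xs(2) v] False by (simp add: algebra_simps)
      finally have middle: "(\<Sum>k = 1..n. scale (qpow h 1 ^ (2 * k)) (dcochain n v (merge h k xs)))
          = scale (q ^ (2 * n) * qfact n) (aug_act xs v + scale (Uq_counit (last xs)) (aug_act (butlast xs) v))
            + (\<Sum>k = 1..<n. scale (q ^ (2 * k) * qfact n) (aug_act xs v))" .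
      have "cochain_d h n (dcochain n v) xs = Uq_act h (hd xs) (dcochain n v (tl xs))
          + (\<Sum>k = 1..n. scale (qpow h 1 ^ (2 * k)) (dcochain n v (merge h k xs)))
          - scale (qpow h 1 ^ (2 * n) * Uq_counit (last xs)) (dcochain n v (butlast xs))"
        using True by (simp add: cochain_d_def)
      also have "dcochain n v (butlast xs) = scale (qfact n) (aug_act (butlast xs) v)"
        using args by (simp add: dcochain_def)
      finally have "cochain_d h n (dcochain n v) xs = scale (qfact n) (aug_act xs v)
          + scale (q ^ (2 * n) * qfact n) (aug_act xs v)
          + (\<Sum>k = 1..<n. scale (q ^ (2 * k) * qfact n) (aug_act xs v))"
        unfolding first middle by (simp add: q_def hv.scale_right_distrib mult_ac)
      also have "\<dots> = scale (qfact n * (1 + q ^ (2 * n) + (\<Sum>k = 1..<n. q ^ (2 * k)))) (aug_act xs v)"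
        by (simp add: distrib_left hv.scale_left_distrib hv.scale_sum_left sum_distrib_left mult.commute)
      also have "1 + q ^ (2 * n) + (\<Sum>k = 1..<n. q ^ (2 * k)) = qint (Suc n)"
      proof -
        have "{..<Suc n} = insert 0 (insert n {1..<n})" using False by auto
        then show ?thesis using False by (simp add: qint_def)
      qed
      finally have lhs: "cochain_d h n (dcochain n v) xs = scale (qfact n * qint (Suc n)) (aug_act xs v)" .
      have "dcochain (Suc n) v xs = scale (qfact n * qint (Suc n)) (aug_act xs v)"
        using True by (simp add: dcochain_def qfact_Suc)
      then show ?thesis unfolding lhs by (rule sym)
    qed
  qed (simp add: cochain_d_def dcochain_def)
qed

end

section \<open>The differential on cochains\<close>

definition cscale :: "complex \<Rightarrow> cochain \<Rightarrow> cochain" where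
  "cscale c \<omega> = (\<lambda>n xs. scale c (\<omega> n xs))"

lemma Cspace_simps:
  "zero (Cspace h) = 0" "add (Cspace h) = (+)" "smult (Cspace h) = cscale"
  by (simp_all add: Cspace_def cscale_def fun_eq_iff)

lemma cvector_space_cscale: "cvector_space cscale"
  by unfold_locales (simp_all add: cscale_def fun_eq_iff hv.scale_right_distrib hv.scale_left_distrib)

lemma linear_image_subspace:
  assumes "subspace_of sc S" "subspace_of sc S'" "S' \<subseteq> S" "lin_end sc S T"
  shows "subspace_of sc (T ` S')"
proof -
  interpret S: subspace_of sc S by fact
  interpret S': subspace_of sc S' by fact
  show ?thesis
  proof unfold_locales
    have "T 0 = 0" using lin_endD(3)[OF assms(4) S.S_zero, of 0] by simp
    then show "0 \<in> T ` S'" using S'.S_zero by (metis imageI)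
    fix u v c assume u: "u \<in> T ` S'"
    then obtain x where x: "x \<in> S'" "u = T x" by blast
    then show "sc c u \<in> T ` S'"
      using lin_endD(3)[OF assms(4), of x c] S'.S_scale[of x c] assms(3) by (metis imageI subsetD)
    assume "v \<in> T ` S'"
    then obtain y where y: "y \<in> S'" "v = T y" by blast
    then show "u + v \<in> T ` S'"
      using x lin_endD(2)[OF assms(4), of y x] S'.S_add[of x y] assms(3) by (metis imageI subsetD)
  qed
qed

lemma (in subspace_of) S_minus: "v \<in> S \<Longrightarrow> - v \<in> S"
  using S_scale[of v "-1"] by simp

lemma (in subspace_of) S_diff: "u \<in> S \<Longrightarrow> v \<in> S \<Longrightarrow> u - v \<in> S"
  using S_add[of u "- v"] S_minus[of v] by simp

lemma (in subspace_of) S_sum: "(\<And>a. a \<in> A \<Longrightarrow> f a \<in> S) \<Longrightarrow> sum f A \<in> S"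
  by (induction A rule: infinite_finite_induct) (auto intro: S_zero S_add)

lemma (in subspace_of) lin_end_simps:
  assumes "lin_end sc S T" "u \<in> S" "v \<in> S"
  shows "T (u - v) = T u - T v" "T 0 = 0"
proof -
  have "T (u - v + v) = T (u - v) + T v" by (rule lin_endD[OF assms(1)]) (use assms S_diff in auto)
  then show "T (u - v) = T u - T v" by simp
  show "T 0 = 0" using lin_endD(3)[OF assms(1) S_zero, of 0] by simp
qed

context root_order
begin

definition HC :: "cochain set" where "HC = {\<omega>. \<forall>n xs. \<omega> n xs \<in> Hc}"

lemma HC_subspace: "subspace_of cscale HC"
proof -
  interpret cvector_space cscale by (rule cvector_space_cscale)
  show ?thesis
    by unfold_locales (auto simp: HC_def cscale_def Hc.S_zero Hc.S_add Hc.S_scale)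
qed

lemma carrier_C_subset: "carrier (Cspace h) \<subseteq> HC"
proof
  fix \<omega> assume "\<omega> \<in> carrier (Cspace h)"
  then have "\<omega> n \<in> cochains h n" for n by (simp add: Cspace_def)
  then show "\<omega> \<in> HC" unfolding HC_def cochains_def using Hc.S_zero
    by (auto simp: cochains_def) metis
qed

lemma carrier_C_subspace: "subspace_of cscale (carrier (Cspace h))"
proof -
  interpret cvector_space cscale by (rule cvector_space_cscale)
  have fin: "finite {n. \<omega> n \<noteq> (\<lambda>_. 0)}" if "\<omega> \<in> carrier (Cspace h)" for \<omega>
    using that by (simp add: Cspace_def)
  show ?thesis
  proof unfold_locales
    show "0 \<in> carrier (Cspace h)" by (simp add: Cspace_def cochains_def Hc.S_zero fun_eq_iff)
    fix u v c assume u: "u \<in> carrier (Cspace h)"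
    have "{n. cscale c u n \<noteq> (\<lambda>_. 0)} \<subseteq> {n. u n \<noteq> (\<lambda>_. 0)}" by (auto simp: cscale_def)
    then show "cscale c u \<in> carrier (Cspace h)"
      using u finite_subset[OF _ fin[OF u]]
      by (simp add: Cspace_def cochains_def cscale_def Hc.S_scale hv.scale_right_distrib mult.commute)
    assume v: "v \<in> carrier (Cspace h)"
    have "{n. (u + v) n \<noteq> (\<lambda>_. 0)} \<subseteq> {n. u n \<noteq> (\<lambda>_. 0)} \<union> {n. v n \<noteq> (\<lambda>_. 0)}" by (auto simp: fun_eq_iff)
    then show "u + v \<in> carrier (Cspace h)"
      using u v finite_subset[OF _ finite_UnI[OF fin[OF u] fin[OF v]]]
      by (simp add: Cspace_def cochains_def Hc.S_add hv.scale_right_distrib)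
  qed
qed

lemma C_d_lin: "lin_end cscale HC (C_d h)"
proof (rule lin_endI)
  interpret C: subspace_of cscale HC by (rule HC_subspace)
  fix u v c assume v: "v \<in> HC"
  have vH: "v n xs \<in> Hc" for n xs using v by (simp add: HC_def)
  have "(\<Sum>k\<in>A. scale (qpow h 1 ^ (2 * k)) (v n (merge h k xs))) \<in> Hc" for A n xs
    by (rule Hc.S_sum) (simp add: Hc.S_scale vH)
  then have "cochain_d h n (v n) xs \<in> Hc" for n xs
    using args_Suc[of xs n] vH
    by (auto simp: cochain_d_def Hc.S_zero intro!: Hc_diff Hc.S_add Hc.S_scale act_Hc)
  then show "C_d h v \<in> HC" by (auto simp: HC_def C_d_def Hc.S_zero split: nat.splits)
  have "cochain_d h n (\<lambda>xs. scale c (v n xs)) ys = scale c (cochain_d h n (v n) ys)" for n ys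
    using args_Suc[of ys n] vH
    by (auto simp: cochain_d_def act_scale hv.scale_right_distrib hv.scale_right_diff_distrib
        hv.scale_sum_right mult.commute)
  then show "C_d h (cscale c v) = cscale c (C_d h v)"
    by (auto simp: C_d_def cscale_def fun_eq_iff split: nat.splits)
  assume u: "u \<in> HC"
  have uH: "u n xs \<in> Hc" for n xs using u by (simp add: HC_def)
  have "cochain_d h n (\<lambda>xs. u n xs + v n xs) ys = cochain_d h n (u n) ys + cochain_d h n (v n) ys" for n ys
    using args_Suc[of ys n] uH vH
    by (auto simp: cochain_d_def act_add hv.scale_right_distrib sum.distrib)
  then show "C_d h (u + v) = C_d h u + C_d h v"
    by (auto simp: C_d_def fun_eq_iff plus_fun_def split: nat.splits)
qed

lemma C_A_lin: "lin_end cscale HC (C_A h)"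
  by (rule lin_endI)
     (auto simp: HC_def C_A_def cscale_def fun_eq_iff opA_simps hv.scale_right_distrib mult.commute
       intro!: Hc.S_scale lin_endD(1)[OF opA_Hc])

lemma C_Q_eq: "C_Q h \<omega> = C_d h \<omega> + C_A h \<omega>"
  by (simp add: C_Q_def Cspace_simps)

lemma C_Q_lin: "lin_end cscale HC (C_Q h)"
proof -
  interpret C: subspace_of cscale HC by (rule HC_subspace)
  show ?thesis
    using C_d_lin C_A_lin unfolding lin_end_def
    by (auto simp: C_Q_eq C.S_add C.scale_right_distrib)
qed

text \<open>Modulo cochains with values in the image of \<open>A\<close>, the powers of \<open>Q\<close> are those of \<open>d\<close>.\<close>

definition AC :: "cochain set" where "AC = {\<omega>. \<forall>n xs. \<omega> n xs \<in> opA h ` Hc}"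

lemma A_image_subspace: "subspace_of scale (opA h ` Hc)"
  by (rule linear_image_subspace[OF subspace_Hc subspace_Hc subset_refl opA_Hc])

lemma C_d_simps: "C_d h \<omega> 0 = (\<lambda>_. 0)" "C_d h \<omega> (Suc n) = cochain_d h n (\<omega> n)"
  by (simp_all add: C_d_def)

lemma C_d_AC: "\<omega> \<in> AC \<Longrightarrow> C_d h \<omega> \<in> AC"
proof -
  interpret Im: subspace_of scale "opA h ` Hc" by (rule A_image_subspace)
  assume "\<omega> \<in> AC"
  then have \<omega>: "\<omega> n xs \<in> opA h ` Hc" for n xs by (simp add: AC_def)
  have act: "Uq_act h X v \<in> opA h ` Hc" if "X \<in> carrier (Uq h)" "v \<in> opA h ` Hc" for X v
    using that act_opA act_Hc by auto
  have "(\<Sum>k\<in>A. scale (qpow h 1 ^ (2 * k)) (\<omega> n (merge h k xs))) \<in> opA h ` Hc" for A n xs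
    by (rule Im.S_sum) (simp add: Im.S_scale \<omega>)
  then have "cochain_d h n (\<omega> n) xs \<in> opA h ` Hc" for n xs
    using args_Suc[of xs n] \<omega>
    by (auto simp: cochain_d_def intro!: Im.S_zero Im.S_diff Im.S_add Im.S_scale act simp del: image_iff)
  then show "C_d h \<omega> \<in> AC" unfolding AC_def C_d_def using Im.S_zero by (auto split: nat.splits)
qed

text \<open>Because \<open>d\<close> preserves these cochains, each occurrence of \<open>A\<close> in an
  expansion of \<open>Q\<^sup>n\<close> can be discarded.\<close>

lemma C_Q_pow_d:
  assumes \<omega>: "\<omega> \<in> HC"
  shows "(C_Q h ^^ n) \<omega> - (C_d h ^^ n) \<omega> \<in> AC"
proof (induction n)
  case 0
  show ?case using A_image_subspace by (simp add: AC_def subspace_of.S_zero)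
next
  case (Suc n)
  interpret C: subspace_of cscale HC by (rule HC_subspace)
  interpret Im: subspace_of scale "opA h ` Hc" by (rule A_image_subspace)
  have H: "(C_Q h ^^ n) \<omega> \<in> HC" "(C_d h ^^ n) \<omega> \<in> HC"
    using \<omega> C.lin_end_funpow[OF C_Q_lin, of n] C.lin_end_funpow[OF C_d_lin, of n] by (auto dest: lin_endD)
  have sum: "(C_Q h ^^ Suc n) \<omega> - (C_d h ^^ Suc n) \<omega>
      = C_d h ((C_Q h ^^ n) \<omega> - (C_d h ^^ n) \<omega>) + C_A h ((C_Q h ^^ n) \<omega>)"
    by (simp add: C_Q_eq C.lin_end_simps[OF C_d_lin H])
  have CA: "C_A h ((C_Q h ^^ n) \<omega>) \<in> AC"
    using H(1) by (auto simp: AC_def C_A_def HC_def intro!: Im.S_scale simp del: image_iff)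
  have add: "u + v \<in> AC" if "u \<in> AC" "v \<in> AC" for u v
    using that by (auto simp: AC_def intro!: Im.S_add simp del: image_iff)
  show ?case unfolding sum by (rule add[OF C_d_AC[OF Suc] CA])
qed

lemma args_0: "args h 0 = {[]}" by (auto simp: args_def)

lemma cochains_0: "f \<in> cochains h 0 \<Longrightarrow> f = dcochain 0 (f [])"
  by (auto simp: cochains_def dcochain_def args_0 fun_eq_iff)

lemma C_d_pow_dcochain:
  assumes "\<omega> \<in> carrier (Cspace h)"
  shows "((C_d h ^^ n) \<omega>) n = dcochain n (\<omega> 0 [])"
proof (induction n)
  case 0
  show ?case using assms cochains_0[of "\<omega> 0"] by (simp add: Cspace_def)
next
  case (Suc n)
  have "\<omega> 0 [] \<in> Hc" using carrier_C_subset assms by (auto simp: HC_def)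
  then show ?case by (simp add: C_d_simps Suc cochain_d_dcochain)
qed

lemma C_Q_pow_0: "((C_Q h ^^ n) \<omega>) 0 [] = (opA h ^^ n) (\<omega> 0 [])"
  by (induction n) (simp_all add: C_Q_eq C_d_def C_A_def)

lemma C_zero_eq: "C_zero v 0 [] = v" "0 < n \<Longrightarrow> C_zero v n = (\<lambda>_. 0)"
  by (auto simp: C_zero_def)

text \<open>The value of \<open>Q\<^bsup>h-k\<^esup> \<omega>\<close> at \<open>(1, \<dots>, 1, E)\<close>
  vanishes, which puts \<open>E \<omega>\<^sub>0\<close> into the image of \<open>A\<close> and
  makes \<open>invariant_in_image\<close> applicable.\<close>

lemma boundary_in_degree_0:
  assumes k: "0 < k" "k < h" and v: "v \<in> H_inv h"
    and b: "C_zero v \<in> im_pow (Cspace h) (C_Q h) (h - k)"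
  shows "v \<in> (opA h ^^ (h - k)) ` H_inv h"
proof -
  obtain \<omega> where \<omega>: "\<omega> \<in> carrier (Cspace h)" "C_zero v = (C_Q h ^^ (h - k)) \<omega>"
    using b by (auto simp: im_pow_def)
  then have HC: "\<omega> \<in> HC" and \<omega>0: "\<omega> 0 [] \<in> Hc" using carrier_C_subset by (auto simp: HC_def)
  obtain n where n: "h - k = Suc n" using k by (cases "h - k") auto
  let ?xs = "replicate n \<one>\<^bsub>Uq h\<^esub> @ [gen_left h GE]"
  interpret R: ring "Uq h" by (rule U.ring_Uq)
  interpret Im: subspace_of scale "opA h ` Hc" by (rule A_image_subspace)
  have xs: "?xs \<in> args h (h - k)" using n by (auto simp: args_def U.gen_left_closed)
  have "((C_Q h ^^ (h - k)) \<omega>) (h - k) ?xs - ((C_d h ^^ (h - k)) \<omega>) (h - k) ?xs \<in> opA h ` Hc"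
    using C_Q_pow_d[OF HC, of "h - k"] unfolding AC_def by (metis (mono_tags, lifting) fun_diff_def mem_Collect_eq)
  moreover have "((C_Q h ^^ (h - k)) \<omega>) (h - k) ?xs = 0"
    unfolding \<omega>(2)[symmetric] using n by (simp add: C_zero_eq)
  moreover have "((C_d h ^^ (h - k)) \<omega>) (h - k) ?xs = scale (qfact (h - k)) (gen_Delta h GE (\<omega> 0 []))"
    unfolding C_d_pow_dcochain[OF \<omega>(1)] dcochain_def using xs \<omega>0
    by (simp add: aug_act_ones U.gen_left_closed counit_laws[OF R.one_closed R.one_closed]
        Uq_act_eq U.uact_gen_left)
  ultimately have "scale (- inverse (qfact (h - k))) (- scale (qfact (h - k)) (gen_Delta h GE (\<omega> 0 []))) \<in> opA h ` Hc"
    by (intro Im.S_scale) simp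
  then have "gen_Delta h GE (\<omega> 0 []) \<in> opA h ` Hc"
    using qfact_nonzero[of "h - k"] k by simp
  then obtain \<eta> where "\<eta> \<in> Hc" "gen_Delta h GE (\<omega> 0 []) = opA h \<eta>" by blast
  moreover have "v = (opA h ^^ (h - k)) (\<omega> 0 [])"
    using C_Q_pow_0[of "h - k" \<omega>] by (simp add: \<omega>(2)[symmetric] C_zero_eq)
  ultimately show ?thesis using invariant_in_image[OF k v \<omega>0] by blast
qed

text \<open>A sequence \<open>s\<close> of vectors stands for the cochain whose component of degree \<open>n\<close> is \<open>d\<^sup>n (s n)\<close>.\<close>

definition incl :: "(nat \<Rightarrow> hvec) \<Rightarrow> cochain" where "incl s = (\<lambda>n. dcochain n (s n))"

definition HS :: "(nat \<Rightarrow> hvec) set" where "HS = {s. \<forall>n. s n \<in> Hc}"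

definition sscale :: "complex \<Rightarrow> (nat \<Rightarrow> hvec) \<Rightarrow> nat \<Rightarrow> hvec" where
  "sscale c s = (\<lambda>n. scale c (s n))"

definition shift :: "(nat \<Rightarrow> hvec) \<Rightarrow> nat \<Rightarrow> hvec" where
  "shift s n = (case n of 0 \<Rightarrow> 0 | Suc m \<Rightarrow> s m)"

definition twA :: "(nat \<Rightarrow> hvec) \<Rightarrow> nat \<Rightarrow> hvec" where
  "twA s n = scale (q ^ (2 * n)) (opA h (s n))"

definition seqQ :: "(nat \<Rightarrow> hvec) \<Rightarrow> nat \<Rightarrow> hvec" where
  "seqQ s = twA s + shift s"

lemma shift_simps [simp]: "shift s 0 = 0" "shift s (Suc n) = s n"
  by (simp_all add: shift_def)

lemma HS_subspace: "subspace_of sscale HS"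
  by unfold_locales (simp_all add: sscale_def HS_def fun_eq_iff hv.scale_right_distrib hv.scale_left_distrib
    Hc.S_zero Hc.S_add Hc.S_scale)

sublocale HS: subspace_of sscale HS by (rule HS_subspace)

lemma shift_lin: "lin_end sscale HS shift"
  by (rule lin_endI) (auto simp: shift_def HS_def sscale_def fun_eq_iff Hc.S_zero split: nat.splits)

lemma twA_lin: "lin_end sscale HS twA"
  by (rule lin_endI) (auto simp: twA_def HS_def sscale_def fun_eq_iff opA_simps hv.scale_right_distrib mult.commute
    intro!: Hc.S_scale lin_endD(1)[OF opA_Hc])

lemma seqQ_lin: "lin_end sscale HS seqQ"
  using twA_lin shift_lin unfolding lin_end_def
  by (auto simp: seqQ_def HS.S_add HS.scale_right_distrib)

lemma seqQ_pow_HS: "s \<in> HS \<Longrightarrow> (seqQ ^^ n) s \<in> HS"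
  using HS.lin_end_funpow[OF seqQ_lin, of n] by (auto dest: lin_endD)

lemma dcochain_lin:
  "u \<in> Hc \<Longrightarrow> v \<in> Hc \<Longrightarrow> dcochain n (u + v) xs = dcochain n u xs + dcochain n v xs"
  "v \<in> Hc \<Longrightarrow> dcochain n (scale c v) xs = scale c (dcochain n v xs)"
  "v \<in> Hc \<Longrightarrow> dcochain n (opA h v) xs = opA h (dcochain n v xs)"
  using aug_act_lin[of xs u v] aug_act_lin[of xs v v]
  by (auto simp: dcochain_def args_def hv.scale_right_distrib opA_simps mult.commute)

lemma dcochain_0 [simp]: "dcochain n 0 = (\<lambda>_. 0)"
  using dcochain_lin(2)[OF Hc.S_zero, of n 0] by (auto simp: fun_eq_iff)

lemma incl_lin:
  assumes "u \<in> HS" "s \<in> HS"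
  shows "incl (u + s) = incl u + incl s" "incl (sscale c s) = cscale c (incl s)"
  using assms by (auto simp: incl_def fun_eq_iff HS_def sscale_def cscale_def dcochain_lin)

lemma incl_d: "s \<in> HS \<Longrightarrow> C_d h (incl s) = incl (shift s)"
  by (auto simp: C_d_def incl_def fun_eq_iff HS_def cochain_d_dcochain split: nat.splits)

lemma incl_Q: "s \<in> HS \<Longrightarrow> C_Q h (incl s) = incl (seqQ s)"
proof -
  assume s: "s \<in> HS"
  then have sn: "s n \<in> Hc" for n by (simp add: HS_def)
  have "C_A h (incl s) = incl (twA s)"
    using sn lin_endD(1)[OF opA_Hc sn]
    by (simp add: C_A_def incl_def fun_eq_iff twA_def dcochain_lin q_def)
  then show ?thesis
    using s lin_endD(1)[OF twA_lin] lin_endD(1)[OF shift_lin]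
    by (simp add: C_Q_eq incl_d seqQ_def incl_lin add.commute)
qed

lemma incl_Q_pow: "s \<in> HS \<Longrightarrow> (C_Q h ^^ n) (incl s) = incl ((seqQ ^^ n) s)"
  by (induction n) (simp_all add: incl_Q seqQ_pow_HS)

lemma dcochain_cochains:
  assumes v: "v \<in> Hc"
  shows "dcochain n v \<in> cochains h n"
proof -
  interpret R: ring "Uq h" by (rule U.ring_Uq)
  have upd: "xs[i := Z] \<in> args h n" if "xs \<in> args h n" "Z \<in> carrier (Uq h)" for xs i Z
    using that set_update_subset_insert[of xs i Z] by (auto simp: args_def)
  have nth: "xs ! i \<in> carrier (Uq h)" if "xs \<in> args h n" "i < n" for xs i
    using that by (auto simp: args_def subset_iff)
  show ?thesis
    unfolding cochains_def
  proof (intro CollectI conjI allI ballI impI)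
    fix xs i Y c assume xs: "xs \<in> args h n"
    then have xs': "set xs \<subseteq> carrier (Uq h)" "length xs = n" by (simp_all add: args_def)
    show "dcochain n v xs \<in> Hc"
      using xs xs' v by (simp add: dcochain_def Hc.S_scale aug_act_Hc)
    assume i: "i < n"
    show "dcochain n v (xs[i := c \<odot>\<^bsub>Uq h\<^esub> xs ! i]) = scale c (dcochain n v xs)"
      using xs xs' i v upd[OF xs Uq_smult_closed[OF nth[OF xs i]], of i c] aug_act_update(2)[OF xs'(1) _ R.zero_closed v, of i c]
      by (simp add: dcochain_def mult.commute)
    assume Y: "Y \<in> carrier (Uq h)"
    show "dcochain n v (xs[i := xs ! i \<oplus>\<^bsub>Uq h\<^esub> Y]) = dcochain n v xs + dcochain n v (xs[i := Y])"
      using xs xs' i v Y upd[OF xs R.a_closed[OF nth[OF xs i] Y], of i] upd[OF xs Y, of i] aug_act_update(1)[OF xs'(1) _ Y v, of i]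
      by (simp add: dcochain_def hv.scale_right_distrib)
  qed (simp add: dcochain_def)
qed

lemma dcochain_high: "h \<le> n \<Longrightarrow> dcochain n v = (\<lambda>_. 0)"
  by (simp add: dcochain_def fun_eq_iff qfact_zero)

text \<open>With \<open>1\<close> as all but the last argument the value is a nonzero multiple of \<open>X v -
  \<epsilon>(X) v\<close>.\<close>

lemma dcochain_eq_0_iff:
  assumes "0 < n" "n < h" "v \<in> Hc"
  shows "dcochain n v = (\<lambda>_. 0) \<longleftrightarrow> v \<in> H_inv h"
proof
  assume v: "v \<in> H_inv h"
  show "dcochain n v = (\<lambda>_. 0)"
  proof
    fix xs show "dcochain n v xs = 0"
      using aug_act_H_inv[of xs v] v assms(1) by (auto simp: dcochain_def args_def)
  qed
next
  assume 0: "dcochain n v = (\<lambda>_. 0)"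
  interpret R: ring "Uq h" by (rule U.ring_Uq)
  obtain m where n: "n = Suc m" using assms(1) by (cases n) auto
  have "Uq_act h X v = scale (Uq_counit X) v" if X: "X \<in> carrier (Uq h)" for X
  proof -
    have "replicate m \<one>\<^bsub>Uq h\<^esub> @ [X] \<in> args h n" using X n by (auto simp: args_def)
    moreover have "dcochain n v (replicate m \<one>\<^bsub>Uq h\<^esub> @ [X]) = 0" using 0 by simp
    ultimately show ?thesis
      using qfact_nonzero[OF assms(2)] by (simp add: dcochain_def aug_act_ones[OF X assms(3)])
  qed
  then show "v \<in> H_inv h" using assms(3) by (simp add: H_inv_def)
qed

lemma incl_carrier: "s \<in> HS \<Longrightarrow> incl s \<in> carrier (Cspace h)"
proof -
  assume "s \<in> HS"
  moreover have "finite {n. incl s n \<noteq> (\<lambda>_. 0)}"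
    by (rule finite_subset[of _ "{..<h}"]) (auto simp: incl_def dcochain_high not_less[symmetric])
  ultimately show ?thesis by (simp add: Cspace_def incl_def HS_def dcochain_cochains)
qed

end

section \<open>Isomorphisms of quotients\<close>

lemma (in subspace_of) coset_elems:
  assumes "add W = (+)"
  shows "S +>\<^bsub>W\<^esub> x = {m + x |m. m \<in> S}"
  by (auto simp: a_r_coset_def' assms)

lemma (in subspace_of) coset_eq_iff:
  assumes W: "add W = (+)"
  shows "S +>\<^bsub>W\<^esub> x = S +>\<^bsub>W\<^esub> y \<longleftrightarrow> x - y \<in> S"
proof
  assume "S +>\<^bsub>W\<^esub> x = S +>\<^bsub>W\<^esub> y"
  moreover have "0 + x \<in> S +>\<^bsub>W\<^esub> x" unfolding coset_elems[OF W] using S_zero by blast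
  ultimately show "x - y \<in> S" unfolding coset_elems[OF W] by auto
next
  assume d: "x - y \<in> S"
  have 1: "m + x = (m + (x - y)) + y" "m + y = (m - (x - y)) + x" for m by simp_all
  show "S +>\<^bsub>W\<^esub> x = S +>\<^bsub>W\<^esub> y"
    unfolding coset_elems[OF W] using d S_add S_diff 1 by blast
qed

lemma (in subspace_of) coset_sum:
  assumes W: "add W = (+)"
  shows "(S +>\<^bsub>W\<^esub> x) <+>\<^bsub>W\<^esub> (S +>\<^bsub>W\<^esub> y) = S +>\<^bsub>W\<^esub> (x + y)"
proof -
  have "\<exists>m'\<in>S. (m + x) + (n + y) = m' + (x + y)" if "m \<in> S" "n \<in> S" for m n
    using that by (intro bexI[of _ "m + n"]) (simp_all add: add_ac S_add)
  moreover have "\<exists>m\<in>S. \<exists>n\<in>S. m' + (x + y) = (m + x) + (n + y)" if "m' \<in> S" for m'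
    using that S_zero by (intro bexI[of _ m'] bexI[of _ 0]) (simp_all add: add_ac)
  ultimately show ?thesis by (auto simp: set_add_def' W coset_elems[OF W]; metis)
qed

text \<open>Covers both scalar multiplication of cosets and induced maps.\<close>

lemma (in subspace_of) coset_map:
  assumes W: "add W = (+)" and T: "\<And>m. m \<in> S \<Longrightarrow> T m \<in> S" "\<And>m. m \<in> S \<Longrightarrow> T (m + x) = T m + T x"
  shows "S <+>\<^bsub>W\<^esub> T ` (S +>\<^bsub>W\<^esub> x) = S +>\<^bsub>W\<^esub> T x"
proof -
  have "T 0 = 0" using T(2)[OF S_zero] by simp
  have "\<exists>m'\<in>S. m + T (n + x) = m' + T x" if "m \<in> S" "n \<in> S" for m n
    using that T by (intro bexI[of _ "m + T n"]) (simp_all add: add.assoc S_add)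
  moreover have "\<exists>m\<in>S. \<exists>n\<in>S. m' + T x = m + T (n + x)" if "m' \<in> S" for m'
    using that S_zero by (intro bexI[of _ m'] bexI[of _ 0]) simp_all
  ultimately show ?thesis by (auto simp: set_add_def' W coset_elems[OF W]; metis)
qed

text \<open>Both homologies are quotients described by representatives: \<open>r\<close> parametrizes the
  cycles of the source by a space \<open>K\<close> of concrete vectors with boundaries
  \<open>Y\<close>, and the target consists of the classes modulo \<open>M\<close> of elements of
  \<open>L\<close>. The map is well defined by \<open>\<phi>_Y\<close> and lands in the target by
  \<open>to_L\<close>; \<open>from_L\<close> and \<open>inj\<close> give bijectivity.\<close>

lemma quotient_lin_iso:
  fixes r :: "'p::ab_group_add \<Rightarrow> 'a" and \<phi> :: "'p \<Rightarrow> 'c::ab_group_add"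
    and V :: "(complex, 'a) module" and W :: "(complex, 'c) module"
  assumes S: "subspace_of sc S" and Y: "subspace_of sc Y" "Y \<subseteq> S" and K: "subspace_of sc K" "K \<subseteq> S"
    and M: "subspace_of sc' M" and W: "add W = (+)" "smult W = sc'"
    and r_add: "\<And>u v. u \<in> S \<Longrightarrow> v \<in> S \<Longrightarrow> r (u + v) = r u \<oplus>\<^bsub>V\<^esub> r v"
    and r_scale: "\<And>c u. u \<in> S \<Longrightarrow> r (sc c u) = c \<odot>\<^bsub>V\<^esub> r u"
    and N: "N = r ` Y"
    and f: "\<And>u. u \<in> S \<Longrightarrow> f (r u) = \<phi> u"
    and \<phi>_add: "\<And>u v. u \<in> S \<Longrightarrow> v \<in> S \<Longrightarrow> \<phi> (u + v) = \<phi> u + \<phi> v"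
    and \<phi>_scale: "\<And>c u. u \<in> S \<Longrightarrow> \<phi> (sc c u) = sc' c (\<phi> u)"
    and \<phi>_Y: "\<And>u. u \<in> Y \<Longrightarrow> \<phi> u \<in> M"
    and A: "carrier A = (\<lambda>u. N +>\<^bsub>V\<^esub> r u) ` K" "add A = set_add V"
      "\<And>c X. c \<odot>\<^bsub>A\<^esub> X = N <+>\<^bsub>V\<^esub> (\<lambda>x. c \<odot>\<^bsub>V\<^esub> x) ` X"
    and B: "carrier B = (\<lambda>\<omega>. M +>\<^bsub>W\<^esub> \<omega>) ` L" "add B = set_add W"
      "\<And>c X. c \<odot>\<^bsub>B\<^esub> X = M <+>\<^bsub>W\<^esub> (\<lambda>x. c \<odot>\<^bsub>W\<^esub> x) ` X"
    and to_L: "\<And>u. u \<in> K \<Longrightarrow> \<exists>\<omega>\<in>L. \<phi> u - \<omega> \<in> M"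
    and from_L: "\<And>\<omega>. \<omega> \<in> L \<Longrightarrow> \<exists>u\<in>K. \<phi> u - \<omega> \<in> M"
    and inj: "\<And>u. u \<in> K \<Longrightarrow> \<phi> u \<in> M \<Longrightarrow> r u \<in> N"
  shows "lin_iso A B (induced W M f)"
proof -
  interpret S: subspace_of sc S by fact
  interpret Y: subspace_of sc Y by fact
  interpret K: subspace_of sc K by fact
  interpret M: subspace_of sc' M by fact
  have YS: "y \<in> Y \<Longrightarrow> y \<in> S" and KS: "u \<in> K \<Longrightarrow> u \<in> S" for y u using Y K by auto
  have coset: "N +>\<^bsub>V\<^esub> r u = {r (y + u) |y. y \<in> Y}" if "u \<in> S" for u
  proof -
    have "r y \<oplus>\<^bsub>V\<^esub> r u = r (y + u)" if "y \<in> Y" for y using \<open>u \<in> S\<close> that by (simp add: r_add YS)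
    then show ?thesis by (auto simp: a_r_coset_def' N)
  qed
  note M_coset = M.coset_elems[OF W(1)] and M_eq = M.coset_eq_iff[OF W(1)]
  have ind: "induced W M f (N +>\<^bsub>V\<^esub> r u) = M +>\<^bsub>W\<^esub> \<phi> u" if u: "u \<in> S" for u
  proof (rule Set.set_eqI)
    fix x
    show "x \<in> induced W M f (N +>\<^bsub>V\<^esub> r u) \<longleftrightarrow> x \<in> M +>\<^bsub>W\<^esub> \<phi> u"
    proof
      assume "x \<in> induced W M f (N +>\<^bsub>V\<^esub> r u)"
      then obtain m y where "m \<in> M" "y \<in> Y" "x = m + f (r (y + u))"
        by (auto simp: induced_def set_add_def' W coset[OF u])
      then have "x = (m + \<phi> y) + \<phi> u" "m + \<phi> y \<in> M"
        using u by (simp_all add: f S.S_add YS \<phi>_add \<phi>_Y M.S_add add.assoc)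
      then show "x \<in> M +>\<^bsub>W\<^esub> \<phi> u" unfolding M_coset by blast
    next
      assume "x \<in> M +>\<^bsub>W\<^esub> \<phi> u"
      then obtain m where m: "m \<in> M" "x = m + f (r u)" unfolding M_coset using f[OF u] by auto
      have "r u \<in> N +>\<^bsub>V\<^esub> r u" unfolding coset[OF u] using Y.S_zero by (auto intro!: exI[of _ 0])
      then show "x \<in> induced W M f (N +>\<^bsub>V\<^esub> r u)"
        using m by (auto simp: induced_def set_add_def' W)
    qed
  qed
  have A_add: "(N +>\<^bsub>V\<^esub> r u) \<oplus>\<^bsub>A\<^esub> (N +>\<^bsub>V\<^esub> r v) = N +>\<^bsub>V\<^esub> r (u + v)" if u: "u \<in> S" and v: "v \<in> S" for u v
  proof (rule Set.set_eqI)
    fix x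
    show "x \<in> (N +>\<^bsub>V\<^esub> r u) \<oplus>\<^bsub>A\<^esub> (N +>\<^bsub>V\<^esub> r v) \<longleftrightarrow> x \<in> N +>\<^bsub>V\<^esub> r (u + v)"
    proof
      assume "x \<in> (N +>\<^bsub>V\<^esub> r u) \<oplus>\<^bsub>A\<^esub> (N +>\<^bsub>V\<^esub> r v)"
      then obtain y z where yz: "y \<in> Y" "z \<in> Y" "x = r (y + u) \<oplus>\<^bsub>V\<^esub> r (z + v)"
        by (auto simp: A set_add_def' coset u v)
      then have "x = r ((y + z) + (u + v))" using u v by (simp add: r_add[symmetric] YS S.S_add add_ac)
      then show "x \<in> N +>\<^bsub>V\<^esub> r (u + v)"
        using yz u v Y.S_add[of y z] by (subst coset) (auto simp: S.S_add)
    next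
      assume "x \<in> N +>\<^bsub>V\<^esub> r (u + v)"
      then obtain y where y: "y \<in> Y" "x = r (y + (u + v))" using u v by (auto simp: coset S.S_add)
      then have "x = r (y + u) \<oplus>\<^bsub>V\<^esub> r (0 + v)" using u v by (simp add: r_add[symmetric] YS S.S_add add_ac)
      moreover have "r (y + u) \<in> N +>\<^bsub>V\<^esub> r u" unfolding coset[OF u] using y by blast
      moreover have "r (0 + v) \<in> N +>\<^bsub>V\<^esub> r v" unfolding coset[OF v] using Y.S_zero by blast
      ultimately show "x \<in> (N +>\<^bsub>V\<^esub> r u) \<oplus>\<^bsub>A\<^esub> (N +>\<^bsub>V\<^esub> r v)"
        by (auto simp: A set_add_def')
    qed
  qed
  have A_scale: "c \<odot>\<^bsub>A\<^esub> (N +>\<^bsub>V\<^esub> r u) = N +>\<^bsub>V\<^esub> r (sc c u)" if u: "u \<in> S" for c u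
  proof (rule Set.set_eqI)
    fix x
    show "x \<in> c \<odot>\<^bsub>A\<^esub> (N +>\<^bsub>V\<^esub> r u) \<longleftrightarrow> x \<in> N +>\<^bsub>V\<^esub> r (sc c u)"
    proof
      assume "x \<in> c \<odot>\<^bsub>A\<^esub> (N +>\<^bsub>V\<^esub> r u)"
      then obtain x' z where xz: "x' \<in> N" "z \<in> Y" "x = x' \<oplus>\<^bsub>V\<^esub> c \<odot>\<^bsub>V\<^esub> r (z + u)"
        by (auto simp: A set_add_def' coset[OF u])
      then obtain y where yz: "y \<in> Y" "z \<in> Y" "x = r y \<oplus>\<^bsub>V\<^esub> c \<odot>\<^bsub>V\<^esub> r (z + u)"
        unfolding N by blast
      then have "x = r ((y + sc c z) + sc c u)"
        using u by (simp add: r_add[symmetric] r_scale[symmetric] YS S.S_add S.S_scale S.scale_right_distrib add.assoc)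
      then show "x \<in> N +>\<^bsub>V\<^esub> r (sc c u)"
        using yz u Y.S_add[of y "sc c z"] Y.S_scale[of z c] by (subst coset) (auto simp: S.S_scale)
    next
      assume "x \<in> N +>\<^bsub>V\<^esub> r (sc c u)"
      then obtain y where y: "y \<in> Y" "x = r (y + sc c u)" using u by (auto simp: coset S.S_scale)
      then have "x = r y \<oplus>\<^bsub>V\<^esub> c \<odot>\<^bsub>V\<^esub> r (0 + u)"
        using u by (simp add: r_add r_scale YS S.S_scale)
      moreover have "r (0 + u) \<in> N +>\<^bsub>V\<^esub> r u" unfolding coset[OF u] using Y.S_zero by blast
      moreover have "r y \<in> N" using y by (simp add: N)
      ultimately show "x \<in> c \<odot>\<^bsub>A\<^esub> (N +>\<^bsub>V\<^esub> r u)"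
        by (auto simp: A set_add_def')
    qed
  qed
  have B_add: "(M +>\<^bsub>W\<^esub> \<omega>) \<oplus>\<^bsub>B\<^esub> (M +>\<^bsub>W\<^esub> \<eta>) = M +>\<^bsub>W\<^esub> (\<omega> + \<eta>)" for \<omega> \<eta>
    by (simp add: B M.coset_sum[OF W(1)])
  have B_scale: "c \<odot>\<^bsub>B\<^esub> (M +>\<^bsub>W\<^esub> \<omega>) = M +>\<^bsub>W\<^esub> (sc' c \<omega>)" for c \<omega>
    unfolding B(3) W(2) by (rule M.coset_map[OF W(1)]) (simp_all add: M.S_scale M.scale_right_distrib)
  have carrier_B: "M +>\<^bsub>W\<^esub> \<phi> u \<in> carrier B" if "u \<in> K" for u
    using to_L[OF that] by (auto simp: B M_eq)
  have inj': "N +>\<^bsub>V\<^esub> r u = N +>\<^bsub>V\<^esub> r v" if u: "u \<in> K" and v: "v \<in> K" and eq: "M +>\<^bsub>W\<^esub> \<phi> u = M +>\<^bsub>W\<^esub> \<phi> v" for u v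
  proof -
    have sub: "N +>\<^bsub>V\<^esub> r u \<subseteq> N +>\<^bsub>V\<^esub> r v" if u: "u \<in> K" and v: "v \<in> K" and eq: "\<phi> u - \<phi> v \<in> M" for u v
    proof -
      have "\<phi> (u - v + v) = \<phi> (u - v) + \<phi> v" using u v KS by (intro \<phi>_add S.S_diff) auto
      then have "\<phi> (u - v) \<in> M" using eq by simp
      then obtain y where y: "y \<in> Y" "r (u - v) = r y" using inj K.S_diff[OF u v] by (auto simp: N)
      have "r (z + u) = r (z + y + v)" if z: "z \<in> Y" for z
      proof -
        have "r (z + u) = r (z + v + (u - v))" by simp
        also have "\<dots> = r (z + v) \<oplus>\<^bsub>V\<^esub> r (u - v)"
          using u v z KS YS by (intro r_add S.S_add S.S_diff) auto
        also have "\<dots> = r (z + v + y)"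
          unfolding y using u v z y KS YS by (intro r_add[symmetric] S.S_add) auto
        finally show ?thesis by (simp add: add_ac)
      qed
      then show ?thesis
        using y u v KS Y.S_add by (auto simp: coset)
    qed
    show ?thesis using sub[OF u v] sub[OF v u] eq unfolding M_eq using M.S_minus[of "\<phi> u - \<phi> v"] by auto
  qed
  show ?thesis
    unfolding lin_iso_def lin_map_def bij_betw_def
  proof (intro conjI ballI allI)
    show "induced W M f \<in> carrier A \<rightarrow> carrier B"
      using carrier_B KS by (auto simp: A ind)
    show "induced W M f (X \<oplus>\<^bsub>A\<^esub> X') = induced W M f X \<oplus>\<^bsub>B\<^esub> induced W M f X'"
      if "X \<in> carrier A" "X' \<in> carrier A" for X X'
      using that KS unfolding A(1) by (auto simp: A_add ind B_add S.S_add \<phi>_add)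
    show "induced W M f (c \<odot>\<^bsub>A\<^esub> X) = c \<odot>\<^bsub>B\<^esub> induced W M f X" if "X \<in> carrier A" for c X
      using that KS unfolding A(1) by (auto simp: A_scale ind B_scale S.S_scale \<phi>_scale)
    show "inj_on (induced W M f) (carrier A)"
    proof (rule inj_onI)
      fix X X' assume X: "X \<in> carrier A" "X' \<in> carrier A" and eq: "induced W M f X = induced W M f X'"
      obtain u v where "u \<in> K" "v \<in> K" "X = N +>\<^bsub>V\<^esub> r u" "X' = N +>\<^bsub>V\<^esub> r v"
        using X unfolding A(1) by blast
      then show "X = X'" using eq inj'[of u v] KS by (simp add: ind)
    qed
    show "induced W M f ` carrier A = carrier B"
    proof
      show "induced W M f ` carrier A \<subseteq> carrier B" using carrier_B KS by (auto simp: A ind)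
      show "carrier B \<subseteq> induced W M f ` carrier A"
      proof
        fix X assume "X \<in> carrier B"
        then obtain \<omega> where \<omega>: "\<omega> \<in> L" "X = M +>\<^bsub>W\<^esub> \<omega>" by (auto simp: B)
        then obtain u where u: "u \<in> K" "\<phi> u - \<omega> \<in> M" using from_L by blast
        have "M +>\<^bsub>W\<^esub> \<phi> u = M +>\<^bsub>W\<^esub> \<omega>" using u(2) by (simp only: M_eq)
        then have "X = induced W M f (N +>\<^bsub>V\<^esub> r u)" by (simp only: \<omega>(2) ind[OF KS[OF u(1)]])
        then show "X \<in> induced W M f ` carrier A" using u by (auto simp: A)
      qed
    qed
  qed
qed

section \<open>Generalized homology of the small complex\<close>

context root_order
begin

definition deg0 :: "hvec \<Rightarrow> nat \<Rightarrow> hvec" where "deg0 v n = (if n = 0 then v else 0)"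

text \<open>The sequences that represent 0 in the small complex.\<close>

definition null_seqs :: "(nat \<Rightarrow> hvec) set" where
  "null_seqs = {z \<in> HS. z 0 = 0 \<and> (\<forall>n. 0 < n \<and> n < h \<longrightarrow> z n \<in> H_inv h)}"

text \<open>The hypothesis \<open>Q\<^bsup>h-j\<^esup> s = 0\<close> is weakened to invariance of all
  components, because only this passes to the element split off in \<open>seqQ_class\<close>.\<close>

definition inv_seqs :: "(nat \<Rightarrow> hvec) set" where "inv_seqs = {z \<in> HS. \<forall>n<h. z n \<in> H_inv h}"

lemma seqQ_simps: "seqQ s 0 = opA h (s 0)" "seqQ s (Suc n) = scale (q ^ (2 * Suc n)) (opA h (s (Suc n))) + s n"
  by (simp_all add: seqQ_def twA_def)

lemma null_seqs_subspace: "subspace_of sscale null_seqs"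
  by unfold_locales (auto simp: null_seqs_def HS.S_zero HS.S_add HS.S_scale HI.S_zero HI.S_add HI.S_scale,
    auto simp: sscale_def HI.S_scale)

lemma inv_seqs_subspace: "subspace_of sscale inv_seqs"
  by unfold_locales (auto simp: inv_seqs_def HS.S_zero HS.S_add HS.S_scale HI.S_zero HI.S_add HI.S_scale,
    auto simp: sscale_def HI.S_scale)

sublocale null_seqs: subspace_of sscale null_seqs by (rule null_seqs_subspace)
sublocale inv_seqs: subspace_of sscale inv_seqs by (rule inv_seqs_subspace)

lemma null_seqs_inv_seqs: "z \<in> null_seqs \<Longrightarrow> z \<in> inv_seqs"
  by (auto simp: null_seqs_def inv_seqs_def HI.S_zero) (metis HI.S_zero neq0_conv)

lemma seqQ_null_seqs: "z \<in> null_seqs \<Longrightarrow> seqQ z \<in> null_seqs"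
proof -
  assume z: "z \<in> null_seqs"
  have "seqQ z n \<in> H_inv h" if "0 < n" "n < h" for n
  proof -
    obtain m where m: "n = Suc m" using \<open>0 < n\<close> by (cases n) auto
    have "z m \<in> H_inv h" using z that m HI.S_zero by (cases "m = 0") (auto simp: null_seqs_def)
    moreover have "z n \<in> H_inv h" using z that by (simp add: null_seqs_def)
    ultimately show ?thesis unfolding m seqQ_simps by (intro HI.S_add HI.S_scale opA_H_inv)
  qed
  then show ?thesis using z lin_endD(1)[OF seqQ_lin] by (simp add: null_seqs_def seqQ_simps opA_simps)
qed

lemma seqQ_inv_seqs: "z \<in> inv_seqs \<Longrightarrow> seqQ z \<in> inv_seqs"
proof -
  assume z: "z \<in> inv_seqs"
  have "seqQ z n \<in> H_inv h" if "n < h" for n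
    using z that by (cases n) (auto simp: seqQ_simps inv_seqs_def intro!: HI.S_add HI.S_scale opA_H_inv)
  then show ?thesis using z lin_endD(1)[OF seqQ_lin] by (simp add: inv_seqs_def)
qed

lemma seqQ_pow_null_seqs: "z \<in> null_seqs \<Longrightarrow> (seqQ ^^ n) z \<in> null_seqs" by (induction n) (simp_all add: seqQ_null_seqs)
lemma seqQ_pow_inv_seqs: "z \<in> inv_seqs \<Longrightarrow> (seqQ ^^ n) z \<in> inv_seqs" by (induction n) (simp_all add: seqQ_inv_seqs)

lemma seqQ_pow_add: "u \<in> HS \<Longrightarrow> v \<in> HS \<Longrightarrow> (seqQ ^^ n) (u + v) = (seqQ ^^ n) u + (seqQ ^^ n) v"
  by (rule lin_endD[OF HS.lin_end_funpow[OF seqQ_lin]])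

text \<open>By the \<open>q\<close>-binomial theorem \<open>Q\<^sup>h\<close> is the sum of the power of the
  twisted \<open>A\<close>, which is 0, and the power of the shift, which moves all components out
  of the degrees below \<open>h\<close>.\<close>

lemma seqQ_h:
  assumes s: "s \<in> HS" and n: "n < h"
  shows "(seqQ ^^ h) s n = 0"
proof -
  have A: "(twA ^^ k) s n = scale (q ^ (2 * n * k)) ((opA h ^^ k) (s n))" for k
    by (induction k) (simp_all add: twA_def opA_simps power_add mult.commute distrib_left)
  have D: "(shift ^^ k) s n = (if n < k then 0 else s (n - k))" for k n
    by (induction k arbitrary: n) (simp_all add: shift_def split: nat.splits)
  have seqQ: "seqQ = (\<lambda>s. twA s + shift s)" by (simp add: fun_eq_iff seqQ_def)
  have comm: "twA (shift v) = sscale (q ^ 2) (shift (twA v))" if "v \<in> HS" for v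
  proof
    fix n show "twA (shift v) n = sscale (q ^ 2) (shift (twA v)) n"
      by (cases n) (simp_all add: twA_def sscale_def opA_simps power_add power2_eq_square mult_ac)
  qed
  have "(seqQ ^^ h) s = (twA ^^ h) s + (shift ^^ h) s"
    unfolding seqQ
    by (rule q_binomial_root[where S = HS and sc = sscale and X = twA and Y = shift and v = s,
        OF HS_subspace twA_lin shift_lin comm s])
  then show ?thesis using n s by (simp add: A D opA_nilpotent HS_def)
qed

lemma deg0_HS: "v \<in> Hc \<Longrightarrow> deg0 v \<in> HS"
  by (simp add: HS_def deg0_def Hc.S_zero)

lemma deg0_inv_seqs: "v \<in> H_inv h \<Longrightarrow> deg0 v \<in> inv_seqs"
  by (simp add: inv_seqs_def deg0_HS H_inv_Hc) (simp add: deg0_def HI.S_zero)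

lemma deg0_add: "deg0 (u + v) = deg0 u + deg0 v"
  by (simp add: deg0_def fun_eq_iff)

lemma seqQ_pow_deg0: "(seqQ ^^ n) (deg0 v) n = v \<and> (\<forall>m>n. (seqQ ^^ n) (deg0 v) m = 0)"
proof (induction n)
  case (Suc n)
  have "(seqQ ^^ Suc n) (deg0 v) m = 0" if "Suc n < m" for m
    using that Suc by (cases m) (simp_all add: seqQ_simps opA_simps)
  then show ?case using Suc by (simp add: seqQ_simps opA_simps)
qed (simp add: deg0_def)

text \<open>Up to terms that vanish in the small complex, an invariant vector of degree 0 is only moved by
  \<open>A\<close>.\<close>

lemma seqQ_pow_deg0_inv: "v \<in> H_inv h \<Longrightarrow> (seqQ ^^ n) (deg0 v) - deg0 ((opA h ^^ n) v) \<in> null_seqs"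
proof (induction n)
  case 0
  have "(seqQ ^^ 0) (deg0 v) - deg0 ((opA h ^^ 0) v) = 0" by (simp del: fun_diff_def)
  then show ?case using null_seqs.S_zero by metis
next
  case (Suc n)
  let ?v = "(opA h ^^ n) v"
  have v: "?v \<in> H_inv h" by (rule opA_pow_H_inv) fact
  have H: "(seqQ ^^ n) (deg0 v) \<in> HS" "deg0 ?v \<in> HS"
    using Suc.prems v by (auto intro!: seqQ_pow_HS deg0_HS H_inv_Hc)
  have "seqQ (deg0 ?v) n = (deg0 (opA h ?v) + (\<lambda>n. if n = 1 then ?v else 0)) n" for n
    by (cases n) (auto simp: seqQ_simps deg0_def opA_simps)
  then have "seqQ (deg0 ?v) - deg0 (opA h ?v) = (\<lambda>n. if n = 1 then ?v else 0)"
    by (simp add: fun_eq_iff)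
  also have "\<dots> \<in> null_seqs" using v by (auto simp: null_seqs_def HS_def HI.S_zero Hc.S_zero H_inv_Hc)
  finally have "seqQ ((seqQ ^^ n) (deg0 v) - deg0 ?v) + (seqQ (deg0 ?v) - deg0 (opA h ?v)) \<in> null_seqs"
    by (intro null_seqs.S_add seqQ_null_seqs Suc)
  moreover have "seqQ ((seqQ ^^ n) (deg0 v) - deg0 ?v) + (seqQ (deg0 ?v) - deg0 (opA h ?v))
      = (seqQ ^^ Suc n) (deg0 v) - deg0 ((opA h ^^ Suc n) v)"
    by (simp add: HS.lin_end_simps[OF seqQ_lin H])
  ultimately show ?case by metis
qed

text \<open>Since \<open>(Q y)\<^bsub>n+1\<^esub> = y\<^sub>n + q\<^bsup>2(n+1)\<^esup> A
  y\<^bsub>n+1\<^esub>\<close>, the components of \<open>y\<close> are found from the top degree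
  \<open>h - 1\<close> downwards; degree 0 leaves the remainder \<open>v\<close>.\<close>

lemma seqQ_one_step:
  assumes s: "s \<in> HS"
  obtains v y where "v \<in> Hc" "y \<in> HS" "s - (deg0 v + seqQ y) \<in> null_seqs"
proof -
  \<comment> \<open>The component of \<open>y\<close> in degree \<open>h - 1 - r\<close>.\<close>
  define a where "a = rec_nat 0 (\<lambda>r u. s (h - 1 - r) - scale (q ^ (2 * (h - 1 - r))) (opA h u))"
  have a: "a 0 = 0" "a (Suc r) = s (h - 1 - r) - scale (q ^ (2 * (h - 1 - r))) (opA h (a r))" for r
    by (simp_all add: a_def)
  have aH: "a r \<in> Hc" for r
    by (induction r) (use s in \<open>auto simp: a HS_def intro!: Hc.S_zero Hc_diff Hc.S_scale lin_endD(1)[OF opA_Hc]\<close>)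
  define y where "y n = (if n < h then a (h - 1 - n) else 0)" for n
  define v where "v = s 0 - opA h (y 0)"
  have y: "y \<in> HS" using aH by (simp add: HS_def y_def Hc.S_zero)
  have v: "v \<in> Hc"
    using s y by (auto simp: v_def HS_def intro!: Hc_diff lin_endD(1)[OF opA_Hc])
  have zero: "(s - (deg0 v + seqQ y)) n = 0" if "n < h" for n
  proof (cases n)
    case 0
    then show ?thesis by (simp add: deg0_def v_def seqQ_simps)
  next
    case (Suc m)
    have "h - 1 - m = Suc (h - 1 - n)" "h - 1 - (h - 1 - n) = n" using that Suc by auto
    then have "y m = s n - scale (q ^ (2 * n)) (opA h (y n))"
      using that Suc by (simp add: y_def a)
    then show ?thesis using Suc by (simp add: deg0_def seqQ_simps)
  qed
  have "s - (deg0 v + seqQ y) \<in> HS"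
    by (intro HS.S_diff HS.S_add s deg0_HS v lin_endD(1)[OF seqQ_lin] y)
  then have "s - (deg0 v + seqQ y) \<in> null_seqs"
    using zero h HI.S_zero unfolding null_seqs_def by (auto simp del: fun_diff_def plus_fun_apply)
  then show ?thesis using that v y by blast
qed

text \<open>Induction on \<open>j\<close> splits off one vector of degree 0 at a time. The top component of
  \<open>Q\<^bsup>h-1\<^esup> s\<close> shows that the split-off vector is invariant, so that the
  hypothesis passes to \<open>y\<close>; the image of the vector found for \<open>y\<close> is
  \<open>A\<close> of it, again of degree 0.\<close>

lemma seqQ_class:
  assumes "s \<in> HS" "(seqQ ^^ (h - j)) s \<in> inv_seqs" "j < h"
  shows "\<exists>v\<in>H_inv h. \<exists>y\<in>HS. s - (deg0 v + (seqQ ^^ j) y) \<in> null_seqs"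
  using assms
proof (induction j arbitrary: s)
  case 0
  then show ?case
    using null_seqs.S_zero HI.S_zero by (intro bexI[of _ 0] bexI[of _ s]) (simp_all add: deg0_def fun_eq_iff flip: zero_fun_def)
next
  case (Suc j)
  obtain v0 y z where v0: "v0 \<in> Hc" and y: "y \<in> HS" and zZ: "z \<in> null_seqs" and z: "z = s - (deg0 v0 + seqQ y)"
    using seqQ_one_step[OF Suc.prems(1)] by metis
  have zH: "z \<in> HS" using zZ by (simp add: null_seqs_def)
  have s: "s = deg0 v0 + (seqQ y + z)" by (simp add: z)
  have Qy: "seqQ y \<in> HS" by (rule lin_endD(1)[OF seqQ_lin y])
  have pow: "(seqQ ^^ n) s = (seqQ ^^ n) (deg0 v0) + ((seqQ ^^ Suc n) y + (seqQ ^^ n) z)" for n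
    unfolding s using deg0_HS[OF v0] Qy zH
    by (simp add: seqQ_pow_add HS.S_add funpow_swap1)
  have "(seqQ ^^ (j + (h - Suc j))) s \<in> inv_seqs"
    unfolding funpow_add o_apply by (rule seqQ_pow_inv_seqs) (rule Suc.prems)
  moreover have "j + (h - Suc j) = h - 1" using Suc.prems by simp
  ultimately have "(seqQ ^^ (h - 1)) s (h - 1) \<in> H_inv h" using h by (simp add: inv_seqs_def)
  moreover have "(seqQ ^^ (h - 1)) s (h - 1) = v0 + ((seqQ ^^ h) y (h - 1) + (seqQ ^^ (h - 1)) z (h - 1))"
    unfolding pow using seqQ_pow_deg0[of "h - 1" v0] h by simp
  moreover have "(seqQ ^^ h) y (h - 1) = 0" using h by (intro seqQ_h y) simp
  moreover have "(seqQ ^^ (h - 1)) z (h - 1) \<in> H_inv h"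
    using null_seqs_inv_seqs[OF seqQ_pow_null_seqs[OF zZ, of "h - 1"]] h by (simp add: inv_seqs_def)
  ultimately have v0I: "v0 \<in> H_inv h" using HI.S_diff by (metis add_0 add_diff_cancel_right')
  have "(seqQ ^^ Suc (h - Suc j)) y = (seqQ ^^ (h - Suc j)) s - (seqQ ^^ (h - Suc j)) (deg0 v0) - (seqQ ^^ (h - Suc j)) z"
    unfolding pow by simp
  also have "\<dots> \<in> inv_seqs"
    by (intro inv_seqs.S_diff Suc.prems seqQ_pow_inv_seqs deg0_inv_seqs v0I null_seqs_inv_seqs zZ)
  also have "Suc (h - Suc j) = h - j" using Suc.prems by simp
  finally obtain v' y' where v': "v' \<in> H_inv h" and y': "y' \<in> HS" and z': "y - (deg0 v' + (seqQ ^^ j) y') \<in> null_seqs"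
    using Suc.IH[OF y _ Suc_lessD[OF Suc.prems(3)]] by blast
  define z2 where "z2 = y - (deg0 v' + (seqQ ^^ j) y')"
  have yy: "y = deg0 v' + ((seqQ ^^ j) y' + z2)" by (simp add: z2_def)
  have z2: "z2 \<in> null_seqs" "z2 \<in> HS" using z' by (simp_all add: z2_def null_seqs_def)
  have "seqQ y = seqQ (deg0 v') + ((seqQ ^^ Suc j) y' + seqQ z2)"
    by (subst yy) (simp add: lin_endD(2)[OF seqQ_lin] HS.S_add deg0_HS H_inv_Hc v' seqQ_pow_HS y' z2)
  then have "s - (deg0 (v0 + opA h v') + (seqQ ^^ Suc j) y') = (seqQ (deg0 v') - deg0 (opA h v')) + (seqQ z2 + z)"
    unfolding s deg0_add by simp
  also have "\<dots> \<in> null_seqs"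
    using seqQ_pow_deg0_inv[OF v', of 1] by (intro null_seqs.S_add seqQ_null_seqs z2 zZ) simp
  finally show ?case
    using HI.S_add[OF v0I opA_H_inv[OF v']] y' by blast
qed

section \<open>The small complex as a complex of sequences\<close>

abbreviation inv_coset :: "hvec \<Rightarrow> hvec set" where "inv_coset x \<equiv> H_inv h +>\<^bsub>Hspace h\<^esub> x"

lemma Hspace_simps: "add (Hspace h) = (+)" "smult (Hspace h) = scale" "zero (Hspace h) = 0"
  by (simp_all add: Hspace_def free_space_def)

lemma cs_0: "inv_coset 0 = H_inv h"
  by (auto simp: HI.coset_elems Hspace_simps)

lemma cs_eq_iff: "inv_coset x = inv_coset y \<longleftrightarrow> x - y \<in> H_inv h"
  by (rule HI.coset_eq_iff) (rule Hspace_simps)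

lemma Hquot_simps:
  "carrier (Hquot h) = inv_coset ` Hc" "zero (Hquot h) = inv_coset 0"
  "inv_coset x \<oplus>\<^bsub>Hquot h\<^esub> inv_coset y = inv_coset (x + y)" "c \<odot>\<^bsub>Hquot h\<^esub> inv_coset x = inv_coset (scale c x)"
proof -
  show "carrier (Hquot h) = inv_coset ` Hc" by (auto simp: Hquot_def A_RCOSETS_def')
  show "zero (Hquot h) = inv_coset 0" by (simp add: Hquot_def cs_0)
  show "inv_coset x \<oplus>\<^bsub>Hquot h\<^esub> inv_coset y = inv_coset (x + y)"
    by (simp add: Hquot_def HI.coset_sum Hspace_simps)
  have "H_inv h <+>\<^bsub>Hspace h\<^esub> scale c ` inv_coset x = inv_coset (scale c x)"
    by (rule HI.coset_map) (simp_all add: Hspace_simps HI.S_scale hv.scale_right_distrib)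
  then show "c \<odot>\<^bsub>Hquot h\<^esub> inv_coset x = inv_coset (scale c x)" by (simp add: Hquot_def Hspace_simps)
qed

lemma induced_A: "induced (Hspace h) (H_inv h) (opA h) (inv_coset x) = inv_coset (opA h x)"
  unfolding induced_def by (rule HI.coset_map) (simp_all add: Hspace_simps opA_H_inv opA_simps)

text \<open>The element of the small complex with components \<open>s n\<close>. The entries outside the
  degrees \<open>1, \<dots>, h - 1\<close> are those of the zero element.\<close>

definition Brep :: "(nat \<Rightarrow> hvec) \<Rightarrow> bul" where
  "Brep s = (s 0, \<lambda>n. inv_coset (if 0 < n \<and> n < h then s n else 0))"

lemma middle_degree_iff: "1 \<le> n \<and> n \<le> h - 1 \<longleftrightarrow> 0 < n \<and> n < h"
  using h by auto

lemma Brep_carrier: "s \<in> HS \<Longrightarrow> Brep s \<in> carrier (Bspace h)"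
  unfolding Bspace_def Brep_def middle_degree_iff by (auto simp: HS_def Hquot_simps)

lemma Brep_lin:
  "Brep (s + t) = Brep s \<oplus>\<^bsub>Bspace h\<^esub> Brep t" "Brep (sscale c s) = c \<odot>\<^bsub>Bspace h\<^esub> Brep s"
  by (auto simp: Bspace_def Brep_def Hquot_simps sscale_def fun_eq_iff)

lemma Brep_zero: "B_zero h v = Brep (deg0 v)"
  by (auto simp: B_zero_def Brep_def deg0_def Hquot_simps fun_eq_iff)

lemma Brep_d: "B_d h (Brep s) = Brep (shift s)"
proof -
  have "snd (B_d h (Brep s)) n = snd (Brep (shift s)) n" for n
  proof (cases n)
    case (Suc m)
    then show ?thesis using h by (cases m) (auto simp: B_d_def Brep_def Hquot_simps)
  qed (auto simp: B_d_def Brep_def Hquot_simps)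
  then show ?thesis by (auto simp: prod_eq_iff fun_eq_iff B_d_def Brep_def)
qed

lemma Brep_Q: "B_Q h (Brep s) = Brep (seqQ s)"
proof -
  have "B_A h (Brep s) = Brep (twA s)"
    unfolding B_A_def Brep_def middle_degree_iff
    by (auto simp: induced_A Hquot_simps twA_def q_def fun_eq_iff)
  then show ?thesis by (simp add: B_Q_def Brep_d Brep_lin(1)[symmetric] seqQ_def add.commute)
qed

lemma Brep_Q_pow: "(B_Q h ^^ n) (Brep s) = Brep ((seqQ ^^ n) s)"
  by (induction n) (simp_all add: Brep_Q)

lemma Brep_eq_iff:
  assumes "s \<in> HS" "t \<in> HS"
  shows "Brep s = Brep t \<longleftrightarrow> s - t \<in> null_seqs"
proof -
  have H: "s - t \<in> HS" by (rule HS.S_diff) fact+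
  have "Brep s = Brep t \<longleftrightarrow> s 0 = t 0 \<and> (\<forall>n. 0 < n \<and> n < h \<longrightarrow> inv_coset (s n) = inv_coset (t n))"
    unfolding Brep_def prod.inject fun_eq_iff by auto
  also have "\<dots> \<longleftrightarrow> s - t \<in> null_seqs"
    using H by (simp add: null_seqs_def cs_eq_iff)
  finally show ?thesis .
qed

text \<open>The representing sequence may be taken to vanish from \<open>h\<close> on.\<close>

lemma Brep_cases:
  assumes "x \<in> carrier (Bspace h)"
  obtains s where "s \<in> HS" "x = Brep s" "\<And>n. h \<le> n \<Longrightarrow> s n = 0"
proof -
  obtain v u where x: "x = (v, u)" by (cases x)
  have v: "v \<in> Hc" and u: "\<forall>n. if 0 < n \<and> n < h then u n \<in> inv_coset ` Hc else u n = inv_coset 0"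
    using assms unfolding x Bspace_def middle_degree_iff by (simp_all add: Hquot_simps(1)[symmetric] Hquot_simps(2)[symmetric])
  have "\<exists>a. 0 < n \<and> n < h \<longrightarrow> a \<in> Hc \<and> u n = inv_coset a" for n
    using u[rule_format, of n] by (cases "0 < n \<and> n < h") auto
  then obtain f where f: "\<And>n. 0 < n \<and> n < h \<Longrightarrow> f n \<in> Hc \<and> u n = inv_coset (f n)" by metis
  define s where "s n = (if n = 0 then v else if n < h then f n else 0)" for n
  have "s \<in> HS" using v f Hc.S_zero by (auto simp: HS_def s_def)
  moreover have "u n = inv_coset (if 0 < n \<and> n < h then s n else 0)" for n
    using f[of n] u[rule_format, of n] by (auto simp: s_def split: if_splits)
  then have "x = Brep s" by (simp add: x Brep_def s_def fun_eq_iff)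
  moreover have "s n = 0" if "h \<le> n" for n using that h by (auto simp: s_def)
  ultimately show ?thesis by (rule that)
qed

lemma carrier_B: "carrier (Bspace h) = Brep ` HS"
  by (auto intro: Brep_carrier elim: Brep_cases)

section \<open>The inclusion\<close>

lemma incl_null_seqs: "z \<in> null_seqs \<Longrightarrow> incl z = 0"
proof -
  assume z: "z \<in> null_seqs"
  have "dcochain n (z n) = (\<lambda>_. 0)" for n
  proof -
    consider "n = 0" | "0 < n" "n < h" | "h \<le> n" by linarith
    then show ?thesis
    proof cases
      case 2
      then show ?thesis using z by (subst dcochain_eq_0_iff) (auto simp: null_seqs_def HS_def)
    qed (use z in \<open>simp_all add: null_seqs_def dcochain_high\<close>)
  qed
  then show ?thesis by (simp add: incl_def fun_eq_iff)
qed

lemma incl_cong: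
  assumes "s \<in> HS" "t \<in> HS" "s - t \<in> null_seqs"
  shows "incl s = incl t"
proof -
  have "incl (t + (s - t)) = incl t + incl (s - t)"
    using assms by (intro incl_lin) (simp_all add: null_seqs_def)
  then show ?thesis by (simp add: incl_null_seqs[OF assms(3)] del: fun_diff_def)
qed

lemma C_zero_incl: "C_zero v = incl (deg0 v)"
proof (intro ext)
  fix n xs show "C_zero v n xs = incl (deg0 v) n xs"
    by (cases "n = 0") (auto simp: C_zero_def incl_def deg0_def dcochain_def args_0)
qed

definition incl_map :: "bul \<Rightarrow> cochain" where
  "incl_map = restrict (\<lambda>x. incl (SOME s. s \<in> HS \<and> x = Brep s)) (carrier (Bspace h))"

lemma incl_map_Brep: "s \<in> HS \<Longrightarrow> incl_map (Brep s) = incl s"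
proof -
  assume s: "s \<in> HS"
  define t where "t = (SOME t. t \<in> HS \<and> Brep s = Brep t)"
  have "t \<in> HS \<and> Brep s = Brep t" unfolding t_def by (rule someI[of _ s]) (simp add: s)
  then have "incl s = incl t" using incl_cong[OF s, of t] Brep_eq_iff[OF s, of t] by simp
  then show ?thesis by (simp add: incl_map_def Brep_carrier[OF s] t_def)
qed

text \<open>Uniqueness holds because every element is a sum of a vector of degree 0 and the differential of an
  element with one component less.\<close>

lemma inclusion_eq: "inclusion h = incl_map"
  unfolding inclusion_def
proof (rule the_equality, intro conjI)
  show "incl_map \<in> extensional (carrier (Bspace h))" by (simp add: incl_map_def)
  show "lin_map (Bspace h) (Cspace h) incl_map"
    unfolding lin_map_def carrier_B
    by (auto simp: Cspace_simps incl_map_Brep incl_carrier incl_lin HS.S_add HS.S_scale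
        simp flip: Brep_lin)
  show "\<forall>n. incl_map ` B_deg h n \<subseteq> C_deg h n"
  proof (intro allI subsetI)
    fix n \<omega> assume "\<omega> \<in> incl_map ` B_deg h n"
    then obtain x where x: "x \<in> B_deg h n" "\<omega> = incl_map x" by blast
    then have "x \<in> carrier (Bspace h)" by (auto simp: B_deg_def)
    then obtain s where s: "s \<in> HS" "x = Brep s" by (rule Brep_cases)
    have 0: "s 0 = 0" if "n \<noteq> 0" using x that by (auto simp: s B_deg_def Brep_def)
    have m: "s m \<in> H_inv h" if "0 < m" "m < h" "m \<noteq> n" for m
    proof -
      have "snd x m = inv_coset 0" using x(1) that by (auto simp: B_deg_def Hquot_simps)
      then have "inv_coset (s m) = inv_coset 0" using that by (simp add: s Brep_def)
      then show ?thesis by (simp add: cs_eq_iff)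
    qed
    have "dcochain m (s m) = (\<lambda>_. 0)" if "m \<noteq> n" for m
    proof -
      consider "m = 0" | "0 < m" "m < h" | "h \<le> m" by linarith
      then show ?thesis
      proof cases
        case 2
        then show ?thesis using m that s by (subst dcochain_eq_0_iff) (auto simp: HS_def)
      qed (use that 0 in \<open>simp_all add: dcochain_high\<close>)
    qed
    then show "\<omega> \<in> C_deg h n"
      using s x by (simp add: C_deg_def incl_map_Brep incl_carrier) (simp add: incl_def)
  qed
  show "\<forall>x\<in>carrier (Bspace h). incl_map (B_d h x) = C_d h (incl_map x)"
    unfolding carrier_B by (auto simp: Brep_d incl_map_Brep incl_d lin_endD(1)[OF shift_lin])
  show "\<forall>v\<in>Hc. incl_map (B_zero h v) = C_zero v"
    by (simp add: Brep_zero incl_map_Brep deg0_HS C_zero_incl)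
next
  fix f
  assume f: "f \<in> extensional (carrier (Bspace h)) \<and> lin_map (Bspace h) (Cspace h) f \<and>
    (\<forall>n. f ` B_deg h n \<subseteq> C_deg h n) \<and> (\<forall>x\<in>carrier (Bspace h). f (B_d h x) = C_d h (f x)) \<and>
    (\<forall>v\<in>Hc. f (B_zero h v) = C_zero v)"
  have f_Brep: "f (Brep s) = incl s" if "s \<in> HS" "\<forall>n\<ge>t. s n = 0" for s t
    using that
  proof (induction t arbitrary: s)
    case 0
    then have s: "s = deg0 0" by (simp add: deg0_def fun_eq_iff)
    have "f (B_zero h 0) = C_zero 0" using f Hc.S_zero by blast
    then show ?case unfolding Brep_zero C_zero_incl s .
  next
    case (Suc t)
    define s' where "s' n = s (Suc n)" for n
    have s': "s' \<in> HS" "\<forall>n\<ge>t. s' n = 0" using Suc.prems by (simp_all add: s'_def HS_def)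
    have s0: "s 0 \<in> Hc" using Suc.prems by (simp add: HS_def)
    have "s n = (deg0 (s 0) + shift s') n" for n by (cases n) (simp_all add: deg0_def s'_def)
    then have s: "s = deg0 (s 0) + shift s'" by blast
    have H: "deg0 (s 0) \<in> HS" "shift s' \<in> HS"
      using s' deg0_HS[OF s0] lin_endD(1)[OF shift_lin] by auto
    have "f (Brep (deg0 (s 0)) \<oplus>\<^bsub>Bspace h\<^esub> Brep (shift s')) = f (Brep (deg0 (s 0))) \<oplus>\<^bsub>Cspace h\<^esub> f (Brep (shift s'))"
      using f Brep_carrier[OF H(1)] Brep_carrier[OF H(2)] unfolding lin_map_def by blast
    then have "f (Brep (deg0 (s 0) + shift s')) = f (Brep (deg0 (s 0))) + f (Brep (shift s'))"
      by (simp add: Brep_lin Cspace_simps)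
    moreover have "f (Brep (deg0 (s 0))) = incl (deg0 (s 0))"
      using f s0 by (simp add: Brep_zero[symmetric] C_zero_incl[symmetric])
    moreover have "f (Brep (shift s')) = C_d h (f (Brep s'))"
      unfolding Brep_d[symmetric] using f Brep_carrier[OF s'(1)] by blast
    moreover have "C_d h (f (Brep s')) = incl (shift s')" using Suc.IH[OF s'] s'(1) by (simp add: incl_d)
    ultimately have "f (Brep (deg0 (s 0) + shift s')) = incl (deg0 (s 0) + shift s')"
      using incl_lin(1)[OF H] by simp
    then show ?case by (simp only: s[symmetric])
  qed
  have "f x = incl_map x" if "x \<in> carrier (Bspace h)" for x
  proof -
    obtain s where "s \<in> HS" "x = Brep s" "\<And>n. h \<le> n \<Longrightarrow> s n = 0" by (rule Brep_cases[OF \<open>x \<in> carrier (Bspace h)\<close>]) blast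
    then show ?thesis using f_Brep[of s h] by (simp add: incl_map_Brep)
  qed
  then show "f = incl_map"
    using f by (intro extensionalityI[of f "carrier (Bspace h)"]) (simp_all add: incl_map_def)
qed

section \<open>Comparison of the homologies\<close>

lemma C_Q_pow_invariant:
  assumes "v \<in> H_inv h"
  shows "(C_Q h ^^ n) (C_zero v) = C_zero ((opA h ^^ n) v)"
  using assms unfolding C_zero_incl
  by (auto simp: incl_Q_pow deg0_HS H_inv_Hc intro!: incl_cong seqQ_pow_HS seqQ_pow_deg0_inv deg0_HS H_inv_Hc opA_pow_H_inv)

lemma C_zero_0: "C_zero 0 = 0"
  by (simp add: C_zero_def fun_eq_iff)

lemma C_zero_carrier: "v \<in> Hc \<Longrightarrow> C_zero v \<in> carrier (Cspace h)"
  by (simp add: C_zero_incl incl_carrier deg0_HS)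

text \<open>The components of \<open>Q\<^sup>k v\<close> in degrees \<open>k\<close> and 0 are
  \<open>d\<^sup>k v\<close> and \<open>A\<^sup>k v\<close>.\<close>

lemma kernel_in_degree_0:
  assumes k: "0 < k" "k < h"
  shows "ker_pow (Cspace h) (C_Q h) k \<inter> C_upto h 0 = C_zero ` {v \<in> H_inv h. (opA h ^^ k) v = 0}"
proof (intro equalityI subsetI)
  fix \<omega> assume "\<omega> \<in> ker_pow (Cspace h) (C_Q h) k \<inter> C_upto h 0"
  then have \<omega>: "\<omega> \<in> carrier (Cspace h)" "(C_Q h ^^ k) \<omega> = 0" "\<And>n. 0 < n \<Longrightarrow> \<omega> n = (\<lambda>_. 0)"
    by (auto simp: ker_pow_def C_upto_def Cspace_simps)
  define v where "v = \<omega> 0 []"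
  have v: "v \<in> Hc" using \<omega>(1) carrier_C_subset by (auto simp: HC_def v_def)
  have "\<omega> 0 = dcochain 0 v" using \<omega>(1) cochains_0[of "\<omega> 0"] by (simp add: Cspace_def v_def)
  then have "\<omega> n = incl (deg0 v) n" for n
    using \<omega>(3)[of n] by (cases "n = 0") (simp_all add: incl_def deg0_def)
  then have \<omega>v: "\<omega> = C_zero v" by (simp add: C_zero_incl fun_eq_iff)
  have "incl ((seqQ ^^ k) (deg0 v)) k = (\<lambda>_. 0)"
    using \<omega>(2) by (simp add: \<omega>v C_zero_incl incl_Q_pow deg0_HS v fun_eq_iff)
  then have "v \<in> H_inv h"
    using dcochain_eq_0_iff[OF k v] seqQ_pow_deg0[of k v] by (simp add: incl_def)
  moreover have "(opA h ^^ k) v = 0" using C_Q_pow_0[of k \<omega>] \<omega>(2) by (simp add: v_def)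
  ultimately show "\<omega> \<in> C_zero ` {v \<in> H_inv h. (opA h ^^ k) v = 0}" using \<omega>v by blast
next
  fix \<omega> assume "\<omega> \<in> C_zero ` {v \<in> H_inv h. (opA h ^^ k) v = 0}"
  then obtain v where v: "v \<in> H_inv h" "(opA h ^^ k) v = 0" "\<omega> = C_zero v" by blast
  then show "\<omega> \<in> ker_pow (Cspace h) (C_Q h) k \<inter> C_upto h 0"
    by (simp add: ker_pow_def C_upto_def Cspace_simps C_Q_pow_invariant C_zero_0 C_zero_carrier H_inv_Hc C_zero_eq)
qed

lemma C_boundaries_subspace: "subspace_of cscale (im_pow (Cspace h) (C_Q h) n)"
proof -
  interpret C: subspace_of cscale HC by (rule HC_subspace)
  show ?thesis unfolding im_pow_def
    by (rule linear_image_subspace[OF HC_subspace carrier_C_subspace carrier_C_subset C.lin_end_funpow[OF C_Q_lin]])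
qed

end

lemma homology_simps:
  "carrier (homology h k V \<delta>) = (\<lambda>u. im_pow V \<delta> (h - k) +>\<^bsub>V\<^esub> u) ` ker_pow V \<delta> k"
  "add (homology h k V \<delta>) = set_add V"
  "c \<odot>\<^bsub>homology h k V \<delta>\<^esub> X = im_pow V \<delta> (h - k) <+>\<^bsub>V\<^esub> (\<lambda>x. c \<odot>\<^bsub>V\<^esub> x) ` X"
  by (auto simp: homology_def A_RCOSETS_def' a_r_coset_def' set_add_def' fun_eq_iff)

lemma F_homology_simps:
  "carrier (F_homology h n k) = (\<lambda>\<omega>. im_pow (Cspace h) (C_Q h) (h - k) +>\<^bsub>Cspace h\<^esub> \<omega>)
     ` (ker_pow (Cspace h) (C_Q h) k \<inter> C_upto h n)"
  "add (F_homology h n k) = set_add (Cspace h)"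
  "c \<odot>\<^bsub>F_homology h n k\<^esub> X =
     im_pow (Cspace h) (C_Q h) (h - k) <+>\<^bsub>Cspace h\<^esub> (\<lambda>x. c \<odot>\<^bsub>Cspace h\<^esub> x) ` X"
  by (simp_all add: F_homology_def homology_simps)

context root_order
begin

lemma invariants_comparison:
  assumes k: "0 < k" "k < h"
  shows "lin_iso (homology h k (HI_space h) (opA h)) (F_homology h 0 k)
    (homology_map h k (Cspace h) (C_Q h) C_zero)"
  unfolding homology_map_def
proof (rule quotient_lin_iso[where S = "H_inv h" and Y = "(opA h ^^ (h - k)) ` H_inv h"
      and K = "{v \<in> H_inv h. (opA h ^^ k) v = 0}" and sc = scale and sc' = cscale and r = "\<lambda>v. v"
      and \<phi> = C_zero and V = "HI_space h" and N = "im_pow (HI_space h) (opA h) (h - k)"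
      and L = "ker_pow (Cspace h) (C_Q h) k \<inter> C_upto h 0"])
  let ?M = "im_pow (Cspace h) (C_Q h) (h - k)"
  interpret M: subspace_of cscale ?M by (rule C_boundaries_subspace)
  have A: "lin_end scale (H_inv h) (opA h ^^ n)" for n
    by (rule lin_endI) (simp_all add: opA_pow_H_inv opA_pow_simps)
  show "subspace_of scale (H_inv h)" by (rule HI.subspace_of_axioms)
  show "subspace_of scale ((opA h ^^ (h - k)) ` H_inv h)"
    by (rule linear_image_subspace[OF HI.subspace_of_axioms HI.subspace_of_axioms subset_refl A])
  show "(opA h ^^ (h - k)) ` H_inv h \<subseteq> H_inv h" by (auto intro: opA_pow_H_inv)
  have "(opA h ^^ k) 0 = 0" by (rule HI.lin_end_simps(2)[OF A HI.S_zero HI.S_zero])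
  then show "subspace_of scale {v \<in> H_inv h. (opA h ^^ k) v = 0}"
    by unfold_locales (simp_all add: HI.S_zero HI.S_add HI.S_scale opA_pow_simps)
  show "{v \<in> H_inv h. (opA h ^^ k) v = 0} \<subseteq> H_inv h" by blast
  show "subspace_of cscale ?M" by (rule M.subspace_of_axioms)
  show "add (Cspace h) = (+)" "smult (Cspace h) = cscale" by (rule Cspace_simps)+
  show "u + v = u \<oplus>\<^bsub>HI_space h\<^esub> v" "scale c u = c \<odot>\<^bsub>HI_space h\<^esub> u" for u v c
    by (simp_all add: HI_space_def Hspace_simps)
  show "im_pow (HI_space h) (opA h) (h - k) = (\<lambda>v. v) ` (opA h ^^ (h - k)) ` H_inv h"
    by (simp add: im_pow_def HI_space_def)
  show "C_zero u = C_zero u" for u ..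
  show "C_zero (u + v) = C_zero u + C_zero v" "C_zero (scale c u) = cscale c (C_zero u)" for u v c
    by (auto simp: C_zero_def cscale_def fun_eq_iff)
  show "C_zero u \<in> ?M" if "u \<in> (opA h ^^ (h - k)) ` H_inv h" for u
    using that by (auto simp: im_pow_def C_Q_pow_invariant[symmetric] C_zero_carrier H_inv_Hc)
  show "carrier (homology h k (HI_space h) (opA h)) =
      (\<lambda>u. im_pow (HI_space h) (opA h) (h - k) +>\<^bsub>HI_space h\<^esub> u) ` {v \<in> H_inv h. (opA h ^^ k) v = 0}"
    by (simp add: homology_simps ker_pow_def HI_space_def Hspace_simps)
  show "\<exists>\<omega>\<in>ker_pow (Cspace h) (C_Q h) k \<inter> C_upto h 0. C_zero u - \<omega> \<in> ?M"
    if "u \<in> {v \<in> H_inv h. (opA h ^^ k) v = 0}" for u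
    using that M.S_zero unfolding kernel_in_degree_0[OF k] by (intro bexI[of _ "C_zero u"]) simp_all
  show "\<exists>u\<in>{v \<in> H_inv h. (opA h ^^ k) v = 0}. C_zero u - \<omega> \<in> ?M"
    if "\<omega> \<in> ker_pow (Cspace h) (C_Q h) k \<inter> C_upto h 0" for \<omega>
  proof -
    obtain u where u: "u \<in> {v \<in> H_inv h. (opA h ^^ k) v = 0}" "\<omega> = C_zero u"
      using \<open>\<omega> \<in> _\<close> unfolding kernel_in_degree_0[OF k] by blast
    have "C_zero u - \<omega> \<in> ?M" unfolding u(2) diff_self by (rule M.S_zero)
    then show ?thesis using u(1) by (rule bexI)
  qed
  show "u \<in> im_pow (HI_space h) (opA h) (h - k)" if "u \<in> {v \<in> H_inv h. (opA h ^^ k) v = 0}" "C_zero u \<in> ?M" for u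
    using boundary_in_degree_0[OF k _ that(2)] that(1) by (simp add: im_pow_def HI_space_def)
qed (rule homology_simps F_homology_simps)+

text \<open>The invariant vector of \<open>seqQ_class\<close> is itself a cycle, as the component of degree 0
  shows.\<close>

lemma small_cycle_class:
  assumes k: "0 < k" "k < h" and s: "s \<in> HS" "(seqQ ^^ k) s \<in> null_seqs"
  obtains v y where "v \<in> H_inv h" "(opA h ^^ k) v = 0" "y \<in> HS"
    "s - (deg0 v + (seqQ ^^ (h - k)) y) \<in> null_seqs"
proof -
  have "h - (h - k) = k" "h - k < h" using k by auto
  then obtain v y where v: "v \<in> H_inv h" and y: "y \<in> HS" and Z: "s - (deg0 v + (seqQ ^^ (h - k)) y) \<in> null_seqs"
    using seqQ_class[of s "h - k"] s null_seqs_inv_seqs by metis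
  have H: "deg0 v \<in> HS" "(seqQ ^^ (h - k)) y \<in> HS" using v y by (auto intro: deg0_HS H_inv_Hc seqQ_pow_HS)
  have "(seqQ ^^ k) ((seqQ ^^ (h - k)) y) = (seqQ ^^ h) y"
    using k by (simp add: funpow_add[symmetric, THEN fun_cong, unfolded o_apply])
  then have "(seqQ ^^ k) (s - (deg0 v + (seqQ ^^ (h - k)) y)) = (seqQ ^^ k) s - ((seqQ ^^ k) (deg0 v) + (seqQ ^^ h) y)"
    using HS.lin_end_simps(1)[OF HS.lin_end_funpow[OF seqQ_lin] s(1) HS.S_add[OF H]] seqQ_pow_add[OF H]
    by simp
  moreover have "(seqQ ^^ k) (s - (deg0 v + (seqQ ^^ (h - k)) y)) 0 = 0"
    using seqQ_pow_null_seqs[OF Z, of k] unfolding null_seqs_def by blast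
  moreover have "(seqQ ^^ k) s 0 = 0" using s(2) by (simp add: null_seqs_def)
  moreover have "(seqQ ^^ h) y 0 = 0" using seqQ_h[OF y, of 0] h by simp
  ultimately have "(seqQ ^^ k) (deg0 v) 0 = 0" by simp
  moreover have "((seqQ ^^ k) (deg0 v) - deg0 ((opA h ^^ k) v)) 0 = 0"
    using seqQ_pow_deg0_inv[OF v, of k] unfolding null_seqs_def by blast
  ultimately have "(opA h ^^ k) v = 0" by (simp add: deg0_def)
  then show ?thesis using that v y Z by blast
qed

lemma small_complex_comparison:
  assumes k: "0 < k" "k < h"
  shows "lin_iso (homology h k (Bspace h) (B_Q h)) (F_homology h 0 k)
    (homology_map h k (Cspace h) (C_Q h) (inclusion h))"
  unfolding homology_map_def
proof (rule quotient_lin_iso[where S = HS and Y = "(seqQ ^^ (h - k)) ` HS"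
      and K = "{s \<in> HS. (seqQ ^^ k) s \<in> null_seqs}" and sc = sscale and sc' = cscale and r = Brep
      and \<phi> = incl and V = "Bspace h" and N = "im_pow (Bspace h) (B_Q h) (h - k)"
      and L = "ker_pow (Cspace h) (C_Q h) k \<inter> C_upto h 0"])
  let ?M = "im_pow (Cspace h) (C_Q h) (h - k)" and ?K = "{s \<in> HS. (seqQ ^^ k) s \<in> null_seqs}"
  interpret M: subspace_of cscale ?M by (rule C_boundaries_subspace)
  have Q: "lin_end sscale HS (seqQ ^^ n)" for n by (rule HS.lin_end_funpow[OF seqQ_lin])
  have incl_M: "incl ((seqQ ^^ (h - k)) y) \<in> ?M" if "y \<in> HS" for y
    using that by (auto simp: im_pow_def incl_Q_pow[symmetric] incl_carrier)
  have split: "incl u = C_zero v + incl ((seqQ ^^ (h - k)) y)"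
    if "u \<in> HS" "v \<in> H_inv h" "y \<in> HS" "u - (deg0 v + (seqQ ^^ (h - k)) y) \<in> null_seqs" for u v y
  proof -
    have H: "deg0 v \<in> HS" "(seqQ ^^ (h - k)) y \<in> HS"
      using that by (auto intro: deg0_HS H_inv_Hc seqQ_pow_HS)
    show ?thesis using incl_cong[OF that(1) HS.S_add[OF H] that(4)] incl_lin(1)[OF H] by (simp add: C_zero_incl)
  qed
  have image_N: "im_pow (Bspace h) (B_Q h) (h - k) = Brep ` (seqQ ^^ (h - k)) ` HS"
    by (simp add: im_pow_def carrier_B image_image Brep_Q_pow)
  have zero_B: "zero (Bspace h) = Brep 0"
    by (simp add: Bspace_def Brep_def Hquot_simps fun_eq_iff)
  have Z0: "Brep ((seqQ ^^ k) s) = Brep 0 \<longleftrightarrow> (seqQ ^^ k) s \<in> null_seqs" if "s \<in> HS" for s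
    using Brep_eq_iff[OF seqQ_pow_HS[OF that, of k] HS.S_zero] by (simp only: diff_zero)
  show "subspace_of sscale HS" by (rule HS_subspace)
  show "subspace_of sscale ((seqQ ^^ (h - k)) ` HS)"
    by (rule linear_image_subspace[OF HS_subspace HS_subspace subset_refl Q])
  show "(seqQ ^^ (h - k)) ` HS \<subseteq> HS" by (auto intro: seqQ_pow_HS)
  show "subspace_of sscale ?K"
  proof unfold_locales
    show "0 \<in> ?K" using HS.lin_end_simps(2)[OF Q HS.S_zero HS.S_zero] HS.S_zero null_seqs.S_zero by (simp only: mem_Collect_eq)
    show "u + v \<in> ?K" if "u \<in> ?K" "v \<in> ?K" for u v
      using that HS.S_add null_seqs.S_add by (simp add: seqQ_pow_add del: plus_fun_apply)
    show "sscale c v \<in> ?K" if "v \<in> ?K" for c v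
      using that HS.S_scale null_seqs.S_scale by (simp add: lin_endD(3)[OF Q])
  qed
  show "?K \<subseteq> HS" by blast
  show "subspace_of cscale ?M" by (rule M.subspace_of_axioms)
  show "add (Cspace h) = (+)" "smult (Cspace h) = cscale" by (rule Cspace_simps)+
  show "Brep (u + v) = Brep u \<oplus>\<^bsub>Bspace h\<^esub> Brep v" "Brep (sscale c u) = c \<odot>\<^bsub>Bspace h\<^esub> Brep u" for u v c
    by (rule Brep_lin)+
  show "im_pow (Bspace h) (B_Q h) (h - k) = Brep ` (seqQ ^^ (h - k)) ` HS" by (rule image_N)
  show "inclusion h (Brep u) = incl u" if "u \<in> HS" for u
    using that by (simp add: inclusion_eq incl_map_Brep)
  show "incl (u + v) = incl u + incl v" if "u \<in> HS" "v \<in> HS" for u v using that by (rule incl_lin)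
  show "incl (sscale c u) = cscale c (incl u)" if "u \<in> HS" for c u using that by (rule incl_lin(2)[OF _ that])
  show "incl u \<in> ?M" if "u \<in> (seqQ ^^ (h - k)) ` HS" for u using that incl_M by blast
  show "carrier (homology h k (Bspace h) (B_Q h)) =
      (\<lambda>u. im_pow (Bspace h) (B_Q h) (h - k) +>\<^bsub>Bspace h\<^esub> Brep u) ` ?K"
  proof -
    have "ker_pow (Bspace h) (B_Q h) k = Brep ` ?K"
      by (auto simp: ker_pow_def carrier_B Brep_Q_pow zero_B Z0)
    then show ?thesis by (simp add: homology_simps image_image)
  qed
  show "\<exists>\<omega>\<in>ker_pow (Cspace h) (C_Q h) k \<inter> C_upto h 0. incl u - \<omega> \<in> ?M" if "u \<in> ?K" for u
  proof -
    obtain v y where v: "v \<in> H_inv h" "(opA h ^^ k) v = 0" and y: "y \<in> HS" "u - (deg0 v + (seqQ ^^ (h - k)) y) \<in> null_seqs"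
      using small_cycle_class[OF k, of u] \<open>u \<in> ?K\<close> by blast
    have "incl u - C_zero v = incl ((seqQ ^^ (h - k)) y)"
      using split[OF _ v(1) y] \<open>u \<in> ?K\<close> by simp
    then have "incl u - C_zero v \<in> ?M" using incl_M[OF y(1)] by metis
    then show ?thesis using v unfolding kernel_in_degree_0[OF k] by blast
  qed
  show "\<exists>u\<in>?K. incl u - \<omega> \<in> ?M" if "\<omega> \<in> ker_pow (Cspace h) (C_Q h) k \<inter> C_upto h 0" for \<omega>
  proof -
    obtain v where v: "v \<in> H_inv h" "(opA h ^^ k) v = 0" "\<omega> = C_zero v"
      using \<open>\<omega> \<in> _\<close> unfolding kernel_in_degree_0[OF k] by blast
    have d0: "deg0 0 = 0" by (simp add: deg0_def fun_eq_iff)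
    have "(seqQ ^^ k) (deg0 v) \<in> null_seqs"
      using seqQ_pow_deg0_inv[OF v(1), of k] unfolding v(2) d0 by (simp only: diff_zero)
    then have "deg0 v \<in> ?K" using v by (simp add: deg0_HS H_inv_Hc)
    moreover have "incl (deg0 v) = \<omega>" using v(3) C_zero_incl by simp
    then have "incl (deg0 v) - \<omega> \<in> ?M" using M.S_zero by (simp only: diff_self)
    ultimately show ?thesis by (intro bexI[of _ "deg0 v"])
  qed
  show "Brep u \<in> im_pow (Bspace h) (B_Q h) (h - k)" if "u \<in> ?K" "incl u \<in> ?M" for u
  proof -
    have u: "u \<in> HS" using that by blast
    obtain v y where v: "v \<in> H_inv h" "(opA h ^^ k) v = 0" and y: "y \<in> HS" "u - (deg0 v + (seqQ ^^ (h - k)) y) \<in> null_seqs"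
      using small_cycle_class[OF k, of u] \<open>u \<in> ?K\<close> by blast
    have "C_zero v = incl u - incl ((seqQ ^^ (h - k)) y)" using split[OF u v(1) y] by simp
    then have "C_zero v \<in> ?M" using M.S_diff[OF that(2) incl_M[OF y(1)]] by metis
    then obtain v' where v': "v' \<in> H_inv h" "v = (opA h ^^ (h - k)) v'"
      using boundary_in_degree_0[OF k v(1)] by blast
    have H: "deg0 v' \<in> HS" using v' by (simp add: deg0_HS H_inv_Hc)
    have "u - (seqQ ^^ (h - k)) (deg0 v' + y)
        = (u - (deg0 v + (seqQ ^^ (h - k)) y)) - ((seqQ ^^ (h - k)) (deg0 v') - deg0 v)"
      unfolding seqQ_pow_add[OF H y(1)] by simp
    also have "\<dots> \<in> null_seqs"
      using seqQ_pow_deg0_inv[OF v'(1), of "h - k"] unfolding v'(2)[symmetric] by (rule null_seqs.S_diff[OF y(2)])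
    finally have "Brep u = Brep ((seqQ ^^ (h - k)) (deg0 v' + y))"
      using Brep_eq_iff[OF u seqQ_pow_HS[OF HS.S_add[OF H y(1)]]] by blast
    then show ?thesis unfolding image_N using HS.S_add[OF H y(1)] by blast
  qed
qed (rule homology_simps F_homology_simps)+

end

theorem theorem2:
  fixes h k :: nat
  assumes "2 \<le> h" and "1 \<le> k" and "k \<le> h - 1"
  shows "lin_iso (homology h k (Bspace h) (B_Q h)) (F_homology h 0 k)
           (homology_map h k (Cspace h) (C_Q h) (inclusion h))
       \<and> lin_iso (homology h k (HI_space h) (opA h)) (F_homology h 0 k)
           (homology_map h k (Cspace h) (C_Q h) C_zero)"
proof -
  interpret root_order h by unfold_locales (rule assms)
  have "0 < k" "k < h" using assms by auto
  then show ?thesis by (intro conjI small_complex_comparison invariants_comparison)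
qed

end
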